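(* Let $X\subset\mathbb{P}^4$ be a cubic threefold with $2\mathsf D_4$-singularities, given by $x_1x_2x_3+f_3(x_3,x_4,x_5)=0$ for a cubic form $f_3$. Then, for any $a\in k^\times$, the $\langle\sigma_{(12)}\tau_a\rangle$-action on $X$ is linearizable, where $$\sigma_{(12)}:(x_1,x_2,x_3,x_4,x_5)\mapsto(x_2,x_1,x_3,x_4,x_5),\qquad \tau_a:(x_1,x_2,x_3,x_4,x_5)\mapsto(ax_1,a^{-1}x_2,x_3,x_4,x_5).$$
   Context: The ground field $k$ is an uncountable algebraically closed field of characteristic zero. "$X$ has $2\mathsf D_4$-singularities" means that the singular locus of $X$ consists of exactly two points, both of type $\mathsf D_4$; up to isomorphism every such $X$ is given by an equation of the displayed form, with singular points $[1:0:0:0:0]$ and $[0:1:0:0:0]$. A $G$-action on $X$ is linearizable if $X$ is $G$-equivariantly birational to $\mathbb{P}(V)$ for some linear representation $V$ of $G$. *)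

theory Defs
  imports
    "HOL-Library.Poly_Mapping"
    "HOL-Library.Countable_Set"
    "HOL-Computational_Algebra.Polynomial"
    "HOL-Computational_Algebra.Formal_Power_Series"
    "HOL-Analysis.Abstract_Topology"
    "HOL-Algebra.Bij"
    "HOL-Algebra.Elementary_Groups"
    "Jordan_Normal_Form.Matrix"
begin

section \<open>Polynomials and forms\<close>

text \<open>
  A polynomial in the variables \<open>Var 0, Var 1, \<dots>\<close> is a finitely supported map from exponent
  vectors to coefficients.  Coordinates are counted from 0 throughout, so the variable
  \<open>x\<^sub>i\<close> of the literature is \<open>Var (i - 1)\<close>.
\<close>

type_synonym 'k mpoly = "(nat \<Rightarrow>\<^sub>0 nat) \<Rightarrow>\<^sub>0 'k"

definition Var :: "nat \<Rightarrow> 'k::comm_ring_1 mpoly" where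
  "Var i = Poly_Mapping.single (Poly_Mapping.single i 1) 1"

text \<open>Evaluation at \<open>x\<close> in a ring, with coefficients mapped there by \<open>h\<close>.\<close>

definition mpoly_eval ::
    "('k::comm_ring_1 \<Rightarrow> 'r::comm_ring_1) \<Rightarrow> (nat \<Rightarrow> 'r) \<Rightarrow> 'k mpoly \<Rightarrow> 'r" where
  "mpoly_eval h x f = (\<Sum>m\<in>Poly_Mapping.keys f. h (Poly_Mapping.lookup f m) * (\<Prod>i\<in>Poly_Mapping.keys m. x i ^ Poly_Mapping.lookup m i))"

definition eval_at :: "'k::comm_ring_1 vec \<Rightarrow> 'k mpoly \<Rightarrow> 'k" where
  "eval_at v f = mpoly_eval (\<lambda>c. c) (\<lambda>i. v $ i) f"

definition pderiv_mpoly :: "nat \<Rightarrow> 'k::comm_ring_1 mpoly \<Rightarrow> 'k mpoly" where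
  "pderiv_mpoly i f = (\<Sum>m\<in>Poly_Mapping.keys f.
     Poly_Mapping.single (m - Poly_Mapping.single i 1) (of_nat (Poly_Mapping.lookup m i) * Poly_Mapping.lookup f m))"

text \<open>Homogeneous polynomials of degree \<open>d\<close> (including 0) in the variables with index in \<open>I\<close>.\<close>

definition forms :: "nat set \<Rightarrow> nat \<Rightarrow> 'k::comm_ring_1 mpoly set" where
  "forms I d = {f. \<forall>m\<in>Poly_Mapping.keys f. Poly_Mapping.keys m \<subseteq> I \<and> (\<Sum>i\<in>Poly_Mapping.keys m. Poly_Mapping.lookup m i) = d}"


section \<open>Projective space\<close>

text \<open>
  The point \<open>[v]\<close> is the set of all nonzero multiples of \<open>v\<close>; \<open>proj_space n\<close> is the space
  of lines in \<open>k\<^sup>n\<close>, that is, projective space of dimension \<open>n - 1\<close>.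
\<close>

definition proj_pt :: "'k::field vec \<Rightarrow> 'k vec set" where
  "proj_pt v = {c \<cdot>\<^sub>v v | c. c \<noteq> 0}"

definition proj_space :: "nat \<Rightarrow> 'k::field vec set set" where
  "proj_space n = {proj_pt v | v. v \<in> carrier_vec n \<and> v \<noteq> 0\<^sub>v n}"

definition hypersurface :: "nat \<Rightarrow> 'k::field mpoly \<Rightarrow> 'k vec set set" where
  "hypersurface n F = {p \<in> proj_space n. \<forall>v\<in>p. eval_at v F = 0}"

definition zariski :: "nat \<Rightarrow> 'k::field vec set topology" where
  "zariski n = topology_generated_by
     {proj_space n - hypersurface n f | f d. f \<in> forms {..<n} d}"

text \<open>
  A map from a subset \<open>U\<close> of \<open>proj_space n\<close> to \<open>proj_space m\<close> is regular if it is given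
  locally by forms of equal degree without common zeros.
\<close>

definition regular_map ::
    "nat \<Rightarrow> nat \<Rightarrow> 'k::field vec set set \<Rightarrow> ('k vec set \<Rightarrow> 'k vec set) \<Rightarrow> bool" where
  "regular_map n m U \<phi> \<longleftrightarrow>
     (\<forall>p\<in>U. \<exists>N d (f :: nat \<Rightarrow> 'k mpoly).
        openin (zariski n) N \<and> p \<in> N \<and> (\<forall>j<m. f j \<in> forms {..<n} d) \<and>
        (\<forall>q\<in>N \<inter> U. \<forall>v\<in>q. vec m (\<lambda>j. eval_at v (f j)) \<noteq> 0\<^sub>v m \<and>
                              \<phi> q = proj_pt (vec m (\<lambda>j. eval_at v (f j)))))"


section \<open>Singularities of type \<open>D\<^sub>4\<close>\<close>

definition sing_locus :: "nat \<Rightarrow> 'k::field mpoly \<Rightarrow> 'k vec set set" where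
  "sing_locus n F =
     {p \<in> hypersurface n F. \<forall>v\<in>p. \<forall>i<n. eval_at v (pderiv_mpoly i F) = 0}"

text \<open>The power series ring \<open>k[[y\<^sub>0, y\<^sub>1, y\<^sub>2, y\<^sub>3]]\<close>, as an iterated one.\<close>

type_synonym 'k fps4 = "'k fps fps fps fps"

definition const4 :: "'k::field \<Rightarrow> 'k fps4" where
  "const4 c = fps_const (fps_const (fps_const (fps_const c)))"

definition Yvar :: "nat \<Rightarrow> 'k::field fps4" where
  "Yvar i = (if i = 0 then fps_const (fps_const (fps_const fps_X))
          else if i = 1 then fps_const (fps_const fps_X)
          else if i = 2 then fps_const fps_X
          else fps_X)"

definition algebra_aut4 :: "('k::field fps4 \<Rightarrow> 'k fps4) \<Rightarrow> bool" where
  "algebra_aut4 \<phi> \<longleftrightarrow> bij \<phi> \<and> (\<forall>c. \<phi> (const4 c) = const4 c) \<and>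
     (\<forall>f g. \<phi> (f + g) = \<phi> f + \<phi> g) \<and> (\<forall>f g. \<phi> (f * g) = \<phi> f * \<phi> g)"

text \<open>
  Contact equivalence: the hypersurface germs \<open>f = 0\<close> and \<open>g = 0\<close> are formally isomorphic.
  Algebra automorphisms of the local ring of power series are automatically local and
  continuous, so they are precisely the formal coordinate changes.
\<close>

definition contact_equivalent :: "'k::field fps4 \<Rightarrow> 'k fps4 \<Rightarrow> bool" where
  "contact_equivalent f g \<longleftrightarrow> (\<exists>\<phi> u. algebra_aut4 \<phi> \<and> u dvd 1 \<and> \<phi> f = u * g)"

text \<open>
  The germ of \<open>F\<close> at the point \<open>[A e\<^sub>0]\<close> in the affine coordinates \<open>A (1, y\<^sub>0, y\<^sub>1, y\<^sub>2, y\<^sub>3)\<close>.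
  Another choice of the invertible matrix \<open>A\<close> gives a contact equivalent germ.
\<close>

definition germ :: "'k::field mat \<Rightarrow> 'k mpoly \<Rightarrow> 'k fps4" where
  "germ A F = mpoly_eval const4
     (\<lambda>i. const4 (A $$ (i, 0)) + (\<Sum>j<4. const4 (A $$ (i, Suc j)) * Yvar j)) F"

definition is_D4_singularity :: "'k::field mpoly \<Rightarrow> 'k vec set \<Rightarrow> bool" where
  "is_D4_singularity F p \<longleftrightarrow>
     (\<exists>A\<in>carrier_mat 5 5. invertible_mat A \<and> col A 0 \<in> p \<and>
        contact_equivalent (germ A F) (Yvar 0 ^ 2 + Yvar 1 ^ 2 + Yvar 2 ^ 2 * Yvar 3 + Yvar 3 ^ 3))"

definition has_2D4 :: "'k::field mpoly \<Rightarrow> bool" where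
  "has_2D4 F \<longleftrightarrow> card (sing_locus 5 F) = 2 \<and> (\<forall>p\<in>sing_locus 5 F. is_D4_singularity F p)"


section \<open>Linearizability\<close>

text \<open>
  Equivariant birationality of \<open>S\<close> in \<open>proj_space n\<close> and \<open>T\<close> in \<open>proj_space m\<close> with actions
  \<open>\<alpha>\<close> and \<open>\<beta>\<close> of \<open>G\<close>: dense open subsets are isomorphic by \<open>\<phi>\<close>, and \<open>\<phi>\<close> is equivariant as a
  rational map (the open subset \<open>U\<close> itself need not be invariant).
\<close>

definition equivariantly_birational ::
    "('g, 'b) monoid_scheme \<Rightarrow> nat \<Rightarrow> 'k::field vec set set \<Rightarrow> ('g \<Rightarrow> 'k vec set \<Rightarrow> 'k vec set) \<Rightarrow>
     nat \<Rightarrow> 'k vec set set \<Rightarrow> ('g \<Rightarrow> 'k vec set \<Rightarrow> 'k vec set) \<Rightarrow> bool" where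
  "equivariantly_birational G n S \<alpha> m T \<beta> \<longleftrightarrow>
     (\<exists>U V \<phi>.
        openin (subtopology (zariski n) S) U \<and> subtopology (zariski n) S closure_of U = S \<and>
        openin (subtopology (zariski m) T) V \<and> subtopology (zariski m) T closure_of V = T \<and>
        bij_betw \<phi> U V \<and> regular_map n m U \<phi> \<and> regular_map m n V (inv_into U \<phi>) \<and>
        (\<forall>g\<in>carrier G. \<forall>p\<in>U. \<alpha> g p \<in> U \<longrightarrow> \<phi> (\<alpha> g p) = \<beta> g (\<phi> p)))"

definition GL :: "nat \<Rightarrow> 'k::field mat monoid" where
  "GL m = units_of (ring_mat TYPE('k) m ())"

text \<open>
  Every representation is isomorphic to a matrix representation \<open>\<rho>\<close> on \<open>k\<^sup>m\<close>, for some \<open>m\<close>.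
\<close>

definition linearizable ::
    "('g, 'b) monoid_scheme \<Rightarrow> nat \<Rightarrow> 'k::field vec set set \<Rightarrow>
     ('g \<Rightarrow> 'k vec set \<Rightarrow> 'k vec set) \<Rightarrow> bool" where
  "linearizable G n S \<alpha> \<longleftrightarrow>
     (\<exists>m \<rho>. \<rho> \<in> hom G (GL m) \<and>
        equivariantly_birational G n S \<alpha> m (proj_space m) (\<lambda>g p. (\<lambda>v. \<rho> g *\<^sub>v v) ` p))"


section \<open>The cubic threefold and its involution\<close>

definition cubic :: "'k::field mpoly \<Rightarrow> 'k mpoly" where
  "cubic f3 = Var 0 * Var 1 * Var 2 + f3"

definition sigma12 :: "'k::field vec \<Rightarrow> 'k vec" where
  "sigma12 v = vec_of_list [v $ 1, v $ 0, v $ 2, v $ 3, v $ 4]"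

definition tau :: "'k::field \<Rightarrow> 'k vec \<Rightarrow> 'k vec" where
  "tau a v = vec_of_list [a * v $ 0, inverse a * v $ 1, v $ 2, v $ 3, v $ 4]"

definition sigma_tau :: "'k::field \<Rightarrow> 'k vec set set \<Rightarrow> 'k vec set \<Rightarrow> 'k vec set" where
  "sigma_tau a S = restrict (\<lambda>p. (sigma12 \<circ> tau a) ` p) S"

definition sigma_tau_group :: "'k::field \<Rightarrow> 'k vec set set \<Rightarrow> ('k vec set \<Rightarrow> 'k vec set) monoid"
  where "sigma_tau_group a S = subgroup_generated (BijGroup S) {sigma_tau a S}"

text \<open>
  The generator is a permutation of the cubic, so \<^const>\<open>sigma_tau_group\<close> is the group it generates
  (\<^const>\<open>subgroup_generated\<close> would silently drop a generator outside the ambient group).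
\<close>

lemma mpoly_eval_superset:
  assumes "finite M" "Poly_Mapping.keys f \<subseteq> M"
  shows "mpoly_eval (\<lambda>c. c) x f =
           (\<Sum>m\<in>M. Poly_Mapping.lookup f m * (\<Prod>i\<in>Poly_Mapping.keys m. x i ^ Poly_Mapping.lookup m i))"
  unfolding mpoly_eval_def using assms
  by (intro sum.mono_neutral_left) (auto simp: in_keys_iff)

lemma mpoly_eval_add:
  "mpoly_eval (\<lambda>c. c) x (f + g) = mpoly_eval (\<lambda>c. c) x f + mpoly_eval (\<lambda>c. c) x g"
proof -
  let ?M = "Poly_Mapping.keys f \<union> Poly_Mapping.keys g"
  have "finite ?M" by simp
  moreover have "Poly_Mapping.keys (f + g) \<subseteq> ?M" by (rule Poly_Mapping.keys_add)
  ultimately show ?thesis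
    by (simp add: mpoly_eval_superset[of ?M] lookup_add distrib_right sum.distrib)
qed

lemma eval_at_cubic:
  "eval_at v (cubic f3) = v $ 0 * v $ 1 * v $ 2 + eval_at v f3"
proof -
  define e :: "nat \<Rightarrow>\<^sub>0 nat" where
    "e = Poly_Mapping.single 0 1 + Poly_Mapping.single 1 1 + Poly_Mapping.single 2 1"
  have e: "Poly_Mapping.keys e = {0, Suc 0, 2}" "Poly_Mapping.lookup e 0 = 1"
    "Poly_Mapping.lookup e (Suc 0) = 1" "Poly_Mapping.lookup e 2 = 1"
    by (auto simp: e_def in_keys_iff lookup_add lookup_single when_def split: if_splits)
  have "Var 0 * Var 1 * Var 2 = Poly_Mapping.single e (1 :: 'a)"
    by (simp add: Var_def mult_single e_def)
  then have "mpoly_eval (\<lambda>c. c) (\<lambda>i. v $ i) (Var 0 * Var 1 * Var 2) = v $ 0 * v $ 1 * v $ 2"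
    by (simp add: mpoly_eval_def e mult.assoc)
  then show ?thesis
    by (simp add: eval_at_def cubic_def mpoly_eval_add)
qed

lemma sigma_tau_carrier: "sigma12 (tau a v) \<in> carrier_vec 5"
  unfolding sigma12_def by (rule carrier_vecI) (simp del: vec_of_list_Cons vec_of_list_Nil)

lemma nth_simps5:
  "[u, v, w, x, y] ! 0 = u" "[u, v, w, x, y] ! Suc 0 = v" "[u, v, w, x, y] ! 1 = v"
  "[u, v, w, x, y] ! 2 = w" "[u, v, w, x, y] ! 3 = x" "[u, v, w, x, y] ! 4 = y"
  by (simp_all add: eval_nat_numeral)

lemma sigma_tau_nth:
  "sigma12 (tau a v) $ 0 = inverse a * v $ 1" "sigma12 (tau a v) $ Suc 0 = a * v $ 0"
  "sigma12 (tau a v) $ 2 = v $ 2" "sigma12 (tau a v) $ 3 = v $ 3" "sigma12 (tau a v) $ 4 = v $ 4"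
  unfolding sigma12_def tau_def vec_of_list_index by (simp_all only: nth_simps5)

lemma vec5_eqI:
  assumes "v \<in> carrier_vec 5" "w \<in> carrier_vec 5" "v $ 0 = w $ 0" "v $ Suc 0 = w $ Suc 0"
    "v $ 2 = w $ 2" "v $ 3 = w $ 3" "v $ 4 = w $ 4"
  shows "v = w"
proof (rule eq_vecI)
  fix i assume "i < dim_vec w"
  then have "i = 0 \<or> i = 1 \<or> i = 2 \<or> i = 3 \<or> i = 4" using assms(2) by auto
  then show "v $ i = w $ i" by (elim disjE) (simp_all only: assms(3-) One_nat_def)
qed (simp add: assms(1,2)[THEN carrier_vecD])

lemma sigma_tau_smult:
  "v \<in> carrier_vec 5 \<Longrightarrow> sigma12 (tau a (c \<cdot>\<^sub>v v)) = c \<cdot>\<^sub>v sigma12 (tau a v)"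
  by (rule vec5_eqI)
    (simp_all add: sigma_tau_carrier sigma_tau_nth sigma_tau_carrier[THEN carrier_vecD] algebra_simps)

lemma sigma_tau_involution:
  "a \<noteq> 0 \<Longrightarrow> v \<in> carrier_vec 5 \<Longrightarrow> sigma12 (tau a (sigma12 (tau a v))) = v"
  by (rule vec5_eqI) (auto simp: sigma_tau_carrier sigma_tau_nth)

lemma sigma_tau_eval:
  assumes "f3 \<in> forms {2, 3, 4} d" "a \<noteq> 0"
  shows "eval_at (sigma12 (tau a v)) (cubic f3) = eval_at v (cubic f3)"
proof -
  have "eval_at (sigma12 (tau a v)) f3 = eval_at v f3"
    unfolding eval_at_def mpoly_eval_def
  proof (intro sum.cong prod.cong refl arg_cong2[where f = "(*)"] arg_cong2[where f = "(^)"])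
    fix m i assume "m \<in> Poly_Mapping.keys f3" "i \<in> Poly_Mapping.keys m"
    then have "i \<in> {2, 3, 4}" using assms(1) unfolding forms_def by blast
    then show "sigma12 (tau a v) $ i = v $ i" by (auto simp: sigma_tau_nth)
  qed
  then show ?thesis using assms(2) by (simp add: eval_at_cubic sigma_tau_nth)
qed

lemma proj_pt_carrier: "v \<in> carrier_vec n \<Longrightarrow> w \<in> proj_pt v \<Longrightarrow> w \<in> carrier_vec n"
  by (auto simp: proj_pt_def)

lemma sigma_tau_in_Bij:
  assumes "f3 \<in> forms {2, 3, 4} d" "a \<noteq> 0"
  shows "sigma_tau a (hypersurface 5 (cubic f3)) \<in> carrier (BijGroup (hypersurface 5 (cubic f3)))"
proof -
  let ?S = "hypersurface 5 (cubic f3)" and ?t = "\<lambda>v. sigma12 (tau a v)"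
  let ?g = "\<lambda>p. ?t ` p"
  have car: "v \<in> carrier_vec 5" if "p \<in> ?S" "v \<in> p" for p v
    using that by (auto simp: hypersurface_def proj_space_def intro: proj_pt_carrier)
  have inv: "?g (?g p) = p" if "p \<in> ?S" for p
    using car[OF that] assms(2) by (force simp: image_image sigma_tau_involution)
  have "?g p \<in> ?S" if p: "p \<in> ?S" for p
  proof -
    obtain v where v: "v \<in> carrier_vec 5" "v \<noteq> 0\<^sub>v 5" "p = proj_pt v"
      using p by (auto simp: hypersurface_def proj_space_def)
    have "?g p = proj_pt (?t v)"
      using v by (auto simp: proj_pt_def sigma_tau_smult image_iff) (metis sigma_tau_smult)+
    moreover have "?t v \<noteq> 0\<^sub>v 5"
    proof
      assume z: "?t v = 0\<^sub>v 5"
      then have "v = ?t (0\<^sub>v 5)" using sigma_tau_involution[OF assms(2) v(1)] by simp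
      also have "\<dots> = 0\<^sub>v 5" by (rule vec5_eqI) (auto simp: sigma_tau_carrier sigma_tau_nth)
      finally show False using v(2) by simp
    qed
    ultimately have "?g p \<in> proj_space 5"
      unfolding proj_space_def using sigma_tau_carrier by blast
    then show ?thesis
      using p by (auto simp: hypersurface_def sigma_tau_eval[OF assms])
  qed
  then have "bij_betw ?g ?S ?S"
    using inv by (intro bij_betwI[where g = ?g]) auto
  then have "bij_betw (restrict ?g ?S) ?S ?S"
    by (rule bij_betw_cong[THEN iffD1, rotated]) simp
  then show ?thesis
    by (simp add: BijGroup_def Bij_def sigma_tau_def o_def)
qed

end

theory Submission
  imports Defs
begin

text \<open>
  Let \<open>X\<close> be the cubic threefold, with coordinates \<open>x\<^sub>0, \<dots>, x\<^sub>4\<close>.  The cubic form restricted to the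
  line \<open>x\<^sub>2 = 0\<close> has a root \<open>(\<alpha>, \<beta>)\<close>, and the plane in \<open>X\<close> spanned by \<open>(0, 0, 0, \<alpha>, \<beta>)\<close> and the two
  singular points is invariant under the action.  Projection from it makes \<open>X\<close> a family of quadric
  surfaces over the projective line, on whose base the action is trivial.  After a diagonal change
  of coordinates, by a square root of \<open>a\<close>, the action exchanges \<open>x\<^sub>0\<close> and \<open>x\<^sub>1\<close>, so its fixed points on
  a fibre form a conic.  By Tsen's theorem this family of conics has a section.  Projecting each
  quadric from its point on the section maps it birationally and equivariantly to a plane on which
  the involution acts linearly, and altogether \<open>X\<close> to projective 3-space with the action of
  \<open>diag (1, 1, 1, -1)\<close>.

  The instance of Tsen's theorem is elementary: the discriminant of the family has to be a norm from
  a quadratic extension of \<open>k(t)\<close>, and over an algebraically closed field every linear factor of it is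
  one (\<open>poly_is_norm\<close>).  This gives explicit forms for the projection and its inverse, and
  \<open>equivariantly_birational_by_forms\<close> reduces birationality to three polynomial identities
  (\<open>\<Psi>_\<Phi>\<close>, \<open>\<Psi>_on_cubic\<close>, \<open>\<Phi>_\<Psi>\<close>) and density of the domain in \<open>X\<close> (\<open>domain_dense\<close>).  Density
  replaces irreducibility of \<open>X\<close>; it is obtained by joining every point of \<open>X\<close> to the domain by
  rational curves (\<open>curve_in_closure\<close>).

  The two coordinate points \<open>[1:0:0:0:0]\<close> and \<open>[0:1:0:0:0]\<close> are always singular.  As there are no
  others, the cubic form has simple roots on the line \<open>x\<^sub>2 = 0\<close> (\<open>simple_roots_at_infinity\<close>).  This
  makes the coefficient \<open>c\<^sub>1\<close> and the discriminant of the normal form nonzero, which is what both the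
  norm argument and density rest on.
\<close>

section \<open>Polynomials as functions\<close>

lemma eval_at_zero: "eval_at v 0 = 0"
  by (simp add: eval_at_def mpoly_eval_def)

lemma eval_at_add: "eval_at v (f + g) = eval_at v f + eval_at v g"
  by (simp add: eval_at_def mpoly_eval_add)

lemma eval_at_sum: "eval_at v (\<Sum>i\<in>I. F i) = (\<Sum>i\<in>I. eval_at v (F i))"
  by (induction I rule: infinite_finite_induct) (simp_all add: eval_at_zero eval_at_add)

lemma eval_at_single:
  "eval_at v (Poly_Mapping.single m c)
     = c * (\<Prod>i\<in>Poly_Mapping.keys m. (v $ i) ^ Poly_Mapping.lookup m i)"
  by (simp add: eval_at_def mpoly_eval_def)

lemma monomial_value_superset:
  fixes x :: "nat \<Rightarrow> 'a::comm_semiring_1"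
  assumes "finite J" "Poly_Mapping.keys m \<subseteq> J"
  shows "(\<Prod>i\<in>Poly_Mapping.keys m. x i ^ Poly_Mapping.lookup m i)
           = (\<Prod>i\<in>J. x i ^ Poly_Mapping.lookup m i)"
  using assms by (intro prod.mono_neutral_left) (auto simp: in_keys_iff)

lemma monomial_value_add:
  fixes x :: "nat \<Rightarrow> 'a::comm_semiring_1"
  shows "(\<Prod>i\<in>Poly_Mapping.keys (m + m'). x i ^ Poly_Mapping.lookup (m + m') i)
           = (\<Prod>i\<in>Poly_Mapping.keys m. x i ^ Poly_Mapping.lookup m i)
             * (\<Prod>i\<in>Poly_Mapping.keys m'. x i ^ Poly_Mapping.lookup m' i)"
proof -
  let ?J = "Poly_Mapping.keys m \<union> Poly_Mapping.keys m'"
  have "finite ?J" by simp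
  note superset = monomial_value_superset[OF this, of _ x]
  show ?thesis
    unfolding superset[OF Poly_Mapping.keys_add] superset[OF Un_upper1] superset[OF Un_upper2]
    by (simp add: lookup_add power_add prod.distrib)
qed

lemma sum_of_terms:
  "f = (\<Sum>m\<in>Poly_Mapping.keys f. Poly_Mapping.single m (Poly_Mapping.lookup f m))"
  by (rule poly_mapping_eqI) (auto simp: lookup_sum lookup_single when_def in_keys_iff)

lemma eval_at_mult: "eval_at v (f * g) = eval_at v f * eval_at v g"
proof -
  have "f * g = (\<Sum>m\<in>Poly_Mapping.keys f. Poly_Mapping.single m (Poly_Mapping.lookup f m))
      * (\<Sum>m\<in>Poly_Mapping.keys g. Poly_Mapping.single m (Poly_Mapping.lookup g m))"
    by (simp flip: sum_of_terms)
  also have "eval_at v \<dots> = (\<Sum>m\<in>Poly_Mapping.keys f. \<Sum>m'\<in>Poly_Mapping.keys g.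
      eval_at v (Poly_Mapping.single m (Poly_Mapping.lookup f m))
        * eval_at v (Poly_Mapping.single m' (Poly_Mapping.lookup g m')))"
    by (simp add: sum_product mult_single eval_at_sum eval_at_single monomial_value_add mult_ac)
  also have "\<dots> = eval_at v f * eval_at v g"
    by (simp flip: sum_product eval_at_sum sum_of_terms)
  finally show ?thesis .
qed

subsection \<open>Forms\<close>

text \<open>
  The maps of this theory are given by formulas, so it is convenient to speak of the functions
  that forms define rather than of the forms.
\<close>

definition form_fun :: "nat \<Rightarrow> nat \<Rightarrow> ('k::field vec \<Rightarrow> 'k) \<Rightarrow> bool" where
  "form_fun n d g \<longleftrightarrow> (\<exists>f\<in>forms {..<n} d. g = (\<lambda>v. eval_at v f))"

lemma forms_mono: "I \<subseteq> J \<Longrightarrow> f \<in> forms I d \<Longrightarrow> f \<in> forms J d"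
  unfolding forms_def by blast

lemma forms_add: "f \<in> forms I d \<Longrightarrow> g \<in> forms I d \<Longrightarrow> f + g \<in> forms I d"
  unfolding forms_def using Poly_Mapping.keys_add[of f g] by blast

lemma forms_mult:
  assumes "f \<in> forms I d" "g \<in> forms I e"
  shows "f * g \<in> forms I (d + e)"
proof -
  have degree: "(\<Sum>i\<in>Poly_Mapping.keys (a + b). Poly_Mapping.lookup (a + b) i)
      = (\<Sum>i\<in>Poly_Mapping.keys a. Poly_Mapping.lookup a i)
        + (\<Sum>i\<in>Poly_Mapping.keys b. Poly_Mapping.lookup b i)" for a b :: "nat \<Rightarrow>\<^sub>0 nat"
  proof -
    let ?J = "Poly_Mapping.keys a \<union> Poly_Mapping.keys b"
    have superset: "(\<Sum>i\<in>Poly_Mapping.keys c. Poly_Mapping.lookup c i)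
        = (\<Sum>i\<in>?J. Poly_Mapping.lookup c i)" if "Poly_Mapping.keys c \<subseteq> ?J" for c
      using that by (intro sum.mono_neutral_left) (auto simp: in_keys_iff)
    show ?thesis
      unfolding superset[OF Poly_Mapping.keys_add] superset[OF Un_upper1] superset[OF Un_upper2]
      by (simp add: lookup_add sum.distrib)
  qed
  show ?thesis
    unfolding forms_def
  proof (intro CollectI ballI)
    fix m assume "m \<in> Poly_Mapping.keys (f * g)"
    then obtain a b where "m = a + b" "a \<in> Poly_Mapping.keys f" "b \<in> Poly_Mapping.keys g"
      using keys_mult[of f g] by blast
    moreover have "Poly_Mapping.keys (a + b) \<subseteq> I"
      using calculation assms Poly_Mapping.keys_add[of a b] unfolding forms_def by blast
    ultimately show "Poly_Mapping.keys m \<subseteq> I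
        \<and> (\<Sum>i\<in>Poly_Mapping.keys m. Poly_Mapping.lookup m i) = d + e"
      using assms by (auto simp: degree forms_def)
  qed
qed

lemma Var_in_forms: "i \<in> I \<Longrightarrow> Var i \<in> forms I 1"
  by (auto simp: Var_def forms_def)

lemma form_fun_const: "form_fun n 0 (\<lambda>v. k)"
  unfolding form_fun_def
  by (rule bexI[of _ "Poly_Mapping.single 0 k"]) (auto simp: eval_at_single forms_def)

lemma form_fun_coord: "i < n \<Longrightarrow> form_fun n 1 (\<lambda>v. v $ i)"
  unfolding form_fun_def
proof (rule bexI)
  show "(\<lambda>v. v $ i) = (\<lambda>v. eval_at v (Var i))" by (simp add: Var_def eval_at_single)
qed (rule Var_in_forms, simp)

lemma form_fun_add:
  "form_fun n d f \<Longrightarrow> form_fun n d g \<Longrightarrow> form_fun n d (\<lambda>v. f v + g v)"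
  unfolding form_fun_def
  by (auto simp: forms_add intro!: bexI[of _ "_ + _"] simp flip: eval_at_add)

lemma form_fun_mult:
  "form_fun n d f \<Longrightarrow> form_fun n e g \<Longrightarrow> form_fun n (d + e) (\<lambda>v. f v * g v)"
  unfolding form_fun_def
  by (auto simp: forms_mult intro!: bexI[of _ "_ * _"] simp flip: eval_at_mult)

lemma form_fun_scale: "form_fun n d f \<Longrightarrow> form_fun n d (\<lambda>v. k * f v)"
  using form_fun_mult[OF form_fun_const[of n k]] by fastforce

lemma form_fun_diff:
  "form_fun n d f \<Longrightarrow> form_fun n d g \<Longrightarrow> form_fun n d (\<lambda>v. f v - g v)"
  using form_fun_add[OF _ form_fun_scale[of n d g "-1"]] by fastforce

lemma form_fun_power: "form_fun n d f \<Longrightarrow> form_fun n (k * d) (\<lambda>v. f v ^ k)"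
proof (induction k)
  case (Suc k)
  then show ?case using form_fun_mult[of n d f "k * d" "\<lambda>v. f v ^ k"] by simp
qed (simp add: form_fun_const)

lemma form_fun_mult_eq:
  "form_fun n d f \<Longrightarrow> form_fun n e g \<Longrightarrow> d + e = k \<Longrightarrow> form_fun n k (\<lambda>v. f v * g v)"
  using form_fun_mult by blast

lemma form_fun_power_eq: "form_fun n d f \<Longrightarrow> m * d = k \<Longrightarrow> form_fun n k (\<lambda>v. f v ^ m)"
  using form_fun_power by blast

lemma form_fun_homogeneous:
  assumes "form_fun n d g" "v \<in> carrier_vec n"
  shows "g (k \<cdot>\<^sub>v v) = k ^ d * g v"
proof -
  obtain f where f: "f \<in> forms {..<n} d" and g: "g = (\<lambda>v. eval_at v f)"
    using assms(1) unfolding form_fun_def by blast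
  have "(\<Prod>i\<in>Poly_Mapping.keys m. ((k \<cdot>\<^sub>v v) $ i) ^ Poly_Mapping.lookup m i)
      = k ^ d * (\<Prod>i\<in>Poly_Mapping.keys m. (v $ i) ^ Poly_Mapping.lookup m i)"
    if "m \<in> Poly_Mapping.keys f" for m
  proof -
    have m: "Poly_Mapping.keys m \<subseteq> {..<n}"
      "(\<Sum>i\<in>Poly_Mapping.keys m. Poly_Mapping.lookup m i) = d"
      using f that unfolding forms_def by auto
    have "(\<Prod>i\<in>Poly_Mapping.keys m. ((k \<cdot>\<^sub>v v) $ i) ^ Poly_Mapping.lookup m i)
        = (\<Prod>i\<in>Poly_Mapping.keys m. k ^ Poly_Mapping.lookup m i * (v $ i) ^ Poly_Mapping.lookup m i)"
      using m(1) assms(2) by (intro prod.cong) (auto simp: power_mult_distrib)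
    also have "\<dots> = k ^ d * (\<Prod>i\<in>Poly_Mapping.keys m. (v $ i) ^ Poly_Mapping.lookup m i)"
      by (simp add: prod.distrib flip: m(2) power_sum)
    finally show ?thesis .
  qed
  then show ?thesis
    by (simp add: g eval_at_def mpoly_eval_def sum_distrib_left mult.left_commute)
qed

subsection \<open>Polynomial functions of one variable\<close>

definition poly_fun :: "('k::comm_ring_1 \<Rightarrow> 'k) \<Rightarrow> bool" where
  "poly_fun g \<longleftrightarrow> (\<exists>q. \<forall>x. g x = poly q x)"

lemma poly_fun_const: "poly_fun (\<lambda>x. k)"
  unfolding poly_fun_def by (rule exI[of _ "[:k:]"]) auto

lemma poly_fun_id: "poly_fun (\<lambda>x. x)"
  unfolding poly_fun_def by (rule exI[of _ "[:0, 1:]"]) auto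

lemma poly_fun_add: "poly_fun f \<Longrightarrow> poly_fun g \<Longrightarrow> poly_fun (\<lambda>x. f x + g x)"
  unfolding poly_fun_def by (metis poly_add)

lemma poly_fun_mult: "poly_fun f \<Longrightarrow> poly_fun g \<Longrightarrow> poly_fun (\<lambda>x. f x * g x)"
  unfolding poly_fun_def by (metis poly_mult)

lemma poly_fun_minus: "poly_fun f \<Longrightarrow> poly_fun (\<lambda>x. - f x)"
  unfolding poly_fun_def by (metis poly_minus)

lemma poly_fun_diff: "poly_fun f \<Longrightarrow> poly_fun g \<Longrightarrow> poly_fun (\<lambda>x. f x - g x)"
  unfolding poly_fun_def by (metis poly_diff)

lemma poly_fun_power: "poly_fun f \<Longrightarrow> poly_fun (\<lambda>x. f x ^ n)"
  unfolding poly_fun_def by (metis poly_power)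

lemma poly_fun_sum: "(\<And>i. i \<in> I \<Longrightarrow> poly_fun (F i)) \<Longrightarrow> poly_fun (\<lambda>x. \<Sum>i\<in>I. F i x)"
  by (induction I rule: infinite_finite_induct) (simp_all add: poly_fun_const poly_fun_add)

lemma poly_fun_prod: "(\<And>i. i \<in> I \<Longrightarrow> poly_fun (F i)) \<Longrightarrow> poly_fun (\<lambda>x. \<Prod>i\<in>I. F i x)"
  by (induction I rule: infinite_finite_induct) (simp_all add: poly_fun_const poly_fun_mult)

lemmas poly_fun_intros = poly_fun_const poly_fun_id poly_fun_add poly_fun_mult poly_fun_minus
  poly_fun_diff poly_fun_power

lemma finite_zeros_poly_fun:
  fixes g :: "'k::idom \<Rightarrow> 'k"
  assumes "poly_fun g" "g x \<noteq> 0"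
  shows "finite {x. g x = 0}"
  using assms unfolding poly_fun_def by (auto intro!: poly_roots_finite)

lemma poly_fun_form_fun:
  assumes "form_fun n d g" "\<And>i. i < n \<Longrightarrow> poly_fun (\<lambda>x. c x $ i)"
  shows "poly_fun (\<lambda>x. g (c x))"
proof -
  obtain f where f: "f \<in> forms {..<n} d" and g: "g = (\<lambda>v. eval_at v f)"
    using assms(1) unfolding form_fun_def by blast
  have "i < n" if "m \<in> Poly_Mapping.keys f" "i \<in> Poly_Mapping.keys m" for m i
    using f that unfolding forms_def by blast
  then show ?thesis
    unfolding g eval_at_def mpoly_eval_def
    by (intro poly_fun_sum poly_fun_mult poly_fun_const poly_fun_prod poly_fun_power assms(2))
qed


section \<open>Curves and density in the Zariski topology\<close>

lemma proj_pt_self: "v \<in> proj_pt v"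
  unfolding proj_pt_def by (rule CollectI, rule exI[of _ 1]) simp

lemma proj_pt_smult: "k \<noteq> 0 \<Longrightarrow> proj_pt (k \<cdot>\<^sub>v v) = proj_pt v"
  unfolding proj_pt_def
proof (intro equalityI subsetI; clarsimp simp: smult_smult_assoc)
  fix c :: 'a assume "k \<noteq> 0" "c \<noteq> 0"
  then show "\<exists>c'. c \<cdot>\<^sub>v v = (c' * k) \<cdot>\<^sub>v v \<and> c' \<noteq> 0"
    by (intro exI[of _ "c / k"]) simp
qed (metis mult_eq_0_iff)

lemma proj_spaceE:
  assumes "p \<in> proj_space n"
  obtains v where "v \<in> carrier_vec n" "v \<noteq> 0\<^sub>v n" "p = proj_pt v"
  using assms unfolding proj_space_def by blast

lemma proj_space_rep:
  assumes "p \<in> proj_space n" "v \<in> p"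
  shows "v \<in> carrier_vec n" "v \<noteq> 0\<^sub>v n" "p = proj_pt v"
proof -
  obtain w where w: "w \<in> carrier_vec n" "w \<noteq> 0\<^sub>v n" "p = proj_pt w"
    using assms(1) by (rule proj_spaceE)
  then obtain k where k: "k \<noteq> 0" "v = k \<cdot>\<^sub>v w" using assms(2) by (auto simp: proj_pt_def)
  show "v \<in> carrier_vec n" "p = proj_pt v" using w k by (simp_all add: proj_pt_smult)
  have "w = (1 / k) \<cdot>\<^sub>v v" using k by (simp add: smult_smult_assoc)
  then show "v \<noteq> 0\<^sub>v n" using w(2) by auto
qed

lemma proj_pt_in_proj_space: "v \<in> carrier_vec n \<Longrightarrow> v \<noteq> 0\<^sub>v n \<Longrightarrow> proj_pt v \<in> proj_space n"
  unfolding proj_space_def by blast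

lemma form_fun_zero_proj_pt:
  assumes "form_fun n d g" "v \<in> carrier_vec n"
  shows "(\<forall>w\<in>proj_pt v. g w = 0) \<longleftrightarrow> g v = 0" "(\<forall>w\<in>proj_pt v. g w \<noteq> 0) \<longleftrightarrow> g v \<noteq> 0"
  using form_fun_homogeneous[OF assms] proj_pt_self[of v] by (auto simp: proj_pt_def)

lemma in_hypersurface_iff:
  assumes "F \<in> forms {..<n} d" "v \<in> carrier_vec n" "v \<noteq> 0\<^sub>v n"
  shows "proj_pt v \<in> hypersurface n F \<longleftrightarrow> eval_at v F = 0"
proof -
  have "form_fun n d (\<lambda>v. eval_at v F)" using assms(1) unfolding form_fun_def by blast
  from form_fun_zero_proj_pt(1)[OF this assms(2)] show ?thesis
    using assms by (simp add: hypersurface_def proj_pt_in_proj_space)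
qed

lemma openin_nonzero:
  assumes "form_fun n d g"
  shows "openin (zariski n) {p \<in> proj_space n. \<forall>v\<in>p. g v \<noteq> 0}"
proof -
  obtain f where f: "f \<in> forms {..<n} d" and g: "g = (\<lambda>v. eval_at v f)"
    using assms(1) unfolding form_fun_def by blast
  have "{p \<in> proj_space n. \<forall>v\<in>p. g v \<noteq> 0} = proj_space n - hypersurface n f"
    using form_fun_zero_proj_pt[OF assms]
    by (auto simp: g hypersurface_def proj_pt_in_proj_space elim!: proj_spaceE)
  then show ?thesis
    unfolding zariski_def using f by (auto intro!: topology_generated_by_Basis)
qed

lemma topspace_zariski: "topspace (zariski n) = (proj_space n :: 'k::field vec set set)"
proof
  show "topspace (zariski n) \<subseteq> proj_space n"
    unfolding zariski_def topology_generated_by_topspace by blast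
  have "openin (zariski n) (proj_space n :: 'k vec set set)"
    using openin_nonzero[OF form_fun_const, of n "1 :: 'k"] by simp
  then show "(proj_space n :: 'k vec set set) \<subseteq> topspace (zariski n)" by (rule openin_subset)
qed

lemma curve_leaves_open_finitely_often:
  assumes "openin (zariski n) N" "proj_pt (c 0) \<in> N"
    and "\<And>i. i < n \<Longrightarrow> poly_fun (\<lambda>x. c x $ i)" and "\<And>x. c x \<in> carrier_vec n"
  shows "finite {x :: 'k::field. c x \<noteq> 0\<^sub>v n \<and> proj_pt (c x) \<notin> N}"
proof -
  have "generate_topology_on {proj_space n - hypersurface n f | f d. f \<in> forms {..<n} d} N"
    using assms(1) unfolding zariski_def by (rule openin_topology_generated_by)
  then show ?thesis using assms(2)
  proof (induction N)
    case (Int N N')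
    have "{x. c x \<noteq> 0\<^sub>v n \<and> proj_pt (c x) \<notin> N \<inter> N'}
        = {x. c x \<noteq> 0\<^sub>v n \<and> proj_pt (c x) \<notin> N} \<union> {x. c x \<noteq> 0\<^sub>v n \<and> proj_pt (c x) \<notin> N'}"
      by blast
    then show ?case using Int by simp
  next
    case (UN K)
    then obtain N where "N \<in> K" "proj_pt (c 0) \<in> N" by blast
    with UN.IH have "finite {x. c x \<noteq> 0\<^sub>v n \<and> proj_pt (c x) \<notin> N}" by blast
    then show ?case by (rule finite_subset[rotated]) (use \<open>N \<in> K\<close> in blast)
  next
    case (Basis N)
    then obtain f d where f: "f \<in> forms {..<n} d" and N: "N = proj_space n - hypersurface n f"
      by blast
    have g: "form_fun n d (\<lambda>v. eval_at v f)" using f unfolding form_fun_def by blast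
    have "c 0 \<noteq> 0\<^sub>v n"
      using Basis.prems proj_space_rep(2)[OF _ proj_pt_self] by (auto simp: N)
    then have "eval_at (c 0) f \<noteq> 0"
      using Basis.prems in_hypersurface_iff[OF f assms(4)] by (auto simp: N)
    then have "finite {x. eval_at (c x) f = 0}"
      by (intro finite_zeros_poly_fun poly_fun_form_fun[OF g] assms(3))
    then show ?case
      by (rule finite_subset[rotated])
        (auto simp: N in_hypersurface_iff[OF f assms(4)] proj_pt_in_proj_space assms(4))
  qed auto
qed

text \<open>
  Density is proved one point at a time: a polynomial curve through the point whose general
  member lies in a set puts the point into the closure of that set.
\<close>

lemma curve_in_closure:
  fixes c :: "'k::field_char_0 \<Rightarrow> 'k vec"
  assumes "S \<subseteq> proj_space n" "proj_pt (c 0) \<in> S"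
    and "\<And>i. i < n \<Longrightarrow> poly_fun (\<lambda>x. c x $ i)" and "\<And>x. c x \<in> carrier_vec n"
    and "poly_fun g" "g x\<^sub>1 \<noteq> 0"
    and generic: "\<And>x. g x \<noteq> 0 \<Longrightarrow>
      c x \<noteq> 0\<^sub>v n \<and> proj_pt (c x) \<in> subtopology (zariski n) S closure_of T"
  shows "proj_pt (c 0) \<in> subtopology (zariski n) S closure_of T"
proof -
  let ?X = "subtopology (zariski n) S"
  have "proj_pt (c 0) \<in> ?X closure_of (?X closure_of T)"
  proof (rule in_closure_of[THEN iffD2], intro conjI allI impI)
    show "proj_pt (c 0) \<in> topspace ?X"
      using assms(1,2) by (auto simp: topspace_zariski)
  next
    fix W assume W: "proj_pt (c 0) \<in> W \<and> openin ?X W"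
    then obtain N where N: "openin (zariski n) N" "W = N \<inter> S"
      by (auto simp: openin_subtopology)
    have "finite ({x. c x \<noteq> 0\<^sub>v n \<and> proj_pt (c x) \<notin> N} \<union> {x. g x = 0})"
      using curve_leaves_open_finitely_often[OF N(1) _ assms(3,4)] W N(2)
        finite_zeros_poly_fun[OF assms(5,6)] by simp
    then obtain x where "x \<notin> {x. c x \<noteq> 0\<^sub>v n \<and> proj_pt (c x) \<notin> N} \<union> {x. g x = 0}"
      using ex_new_if_finite[OF infinite_UNIV_char_0] by blast
    then have "proj_pt (c x) \<in> N" "proj_pt (c x) \<in> ?X closure_of T"
      using generic[of x] by auto
    moreover have "?X closure_of T \<subseteq> S"
      using closure_of_subset_topspace[of ?X T] by auto
    ultimately show "\<exists>y. y \<in> ?X closure_of T \<and> y \<in> W" using N(2) by blast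
  qed
  then show ?thesis by simp
qed

lemma nonzero_dense_in_proj_space:
  fixes g :: "'k::field_char_0 vec \<Rightarrow> 'k"
  assumes "form_fun m d g" "w\<^sub>0 \<in> carrier_vec m" "g w\<^sub>0 \<noteq> 0" "0 < d"
  shows "subtopology (zariski m) (proj_space m) closure_of
           {q \<in> proj_space m. \<forall>w\<in>q. g w \<noteq> 0} = proj_space m"
    (is "?X closure_of ?V = _")
proof
  show "?X closure_of ?V \<subseteq> proj_space m"
    using closure_of_subset_topspace[of ?X ?V] by auto
  show "proj_space m \<subseteq> ?X closure_of ?V"
  proof
    fix q :: "'k vec set" assume q: "q \<in> proj_space m"
    then obtain w where w: "w \<in> carrier_vec m" "w \<noteq> 0\<^sub>v m" "q = proj_pt w" by (rule proj_spaceE)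
    define c where "c = (\<lambda>x. vec m (\<lambda>i. w $ i + x * (w\<^sub>0 $ i - w $ i)))"
    have c: "c 0 = w" "c 1 = w\<^sub>0" "\<And>x. c x \<in> carrier_vec m"
      using w(1) assms(2) by (auto simp: c_def)
    have poly: "poly_fun (\<lambda>x. c x $ i)" if "i < m" for i
      using that by (simp add: c_def poly_fun_intros)
    have g0: "g (0\<^sub>v m) = 0"
    proof -
      have "0\<^sub>v m = 0 \<cdot>\<^sub>v (0\<^sub>v m :: 'k vec)" by (rule eq_vecI) auto
      then have "g (0\<^sub>v m) = g (0 \<cdot>\<^sub>v 0\<^sub>v m)" by (rule arg_cong)
      also have "\<dots> = 0 ^ d * g (0\<^sub>v m)" by (rule form_fun_homogeneous[OF assms(1)]) simp
      finally show ?thesis using assms(4) by (simp only: zero_power mult_zero_left)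
    qed
    have "proj_pt (c 0) \<in> ?X closure_of ?V"
    proof (rule curve_in_closure[where g = "\<lambda>x. g (c x)" and x\<^sub>1 = 1])
      fix x assume x: "g (c x) \<noteq> 0"
      then have nz: "c x \<noteq> 0\<^sub>v m" using g0 by auto
      then have "proj_pt (c x) \<in> ?V"
        using x form_fun_zero_proj_pt(2)[OF assms(1) c(3)] by (simp add: proj_pt_in_proj_space c(3))
      moreover have "?V \<subseteq> ?X closure_of ?V"
        by (rule closure_of_subset) (auto simp: topspace_zariski)
      ultimately show "c x \<noteq> 0\<^sub>v m \<and> proj_pt (c x) \<in> ?X closure_of ?V" using nz by blast
    qed (use q w c assms poly in \<open>auto intro!: poly_fun_form_fun[OF assms(1)]\<close>)
    then show "q \<in> ?X closure_of ?V" using c w by simp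
  qed
qed


section \<open>A criterion for equivariant birationality\<close>

text \<open>
  If two maps given by forms are mutually inverse up to the scalar factors \<open>c\<close> and \<open>c'\<close>, they
  restrict to mutually inverse bijections between the loci where these factors do not vanish:
  for \<open>w = \<Phi> v\<close>, comparing \<open>\<Phi> (\<Psi> (\<Phi> v))\<close> computed in two ways gives \<open>c' w = c v ^ d\<close>, so
  neither map leads out of these loci.
\<close>

lemma equivariantly_birational_by_forms:
  fixes \<Phi> \<Psi> :: "'k::field_char_0 vec \<Rightarrow> 'k vec"
  assumes F: "F \<in> forms {..<n} k"
    and \<Phi>: "\<And>j. j < m \<Longrightarrow> form_fun n d (\<lambda>v. \<Phi> v $ j)" "\<And>v. \<Phi> v \<in> carrier_vec m"
    and \<Psi>: "\<And>i. i < n \<Longrightarrow> form_fun m e (\<lambda>w. \<Psi> w $ i)" "\<And>w. \<Psi> w \<in> carrier_vec n"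
    and c: "form_fun n dc c" and c': "form_fun m dc' c'" and pos: "0 < d" "0 < e" "0 < dc'"
    and \<Psi>\<Phi>: "\<And>v. v \<in> carrier_vec n \<Longrightarrow> eval_at v F = 0 \<Longrightarrow> \<Psi> (\<Phi> v) = c v \<cdot>\<^sub>v v"
    and \<Psi>F: "\<And>w. w \<in> carrier_vec m \<Longrightarrow> eval_at (\<Psi> w) F = 0"
    and \<Phi>\<Psi>: "\<And>w. w \<in> carrier_vec m \<Longrightarrow> \<Phi> (\<Psi> w) = c' w \<cdot>\<^sub>v w"
    and dense: "subtopology (zariski n) (hypersurface n F) closure_of
                  {p \<in> hypersurface n F. \<forall>v\<in>p. c v \<noteq> 0} = hypersurface n F"
    and nontrivial: "w\<^sub>0 \<in> carrier_vec m" "c' w\<^sub>0 \<noteq> 0"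
    and equivariant: "\<And>g p v. g \<in> carrier G \<Longrightarrow> p \<in> hypersurface n F \<Longrightarrow> v \<in> p \<Longrightarrow>
            \<exists>v'\<in>\<alpha> g p. proj_pt (\<Phi> v') = \<beta> g (proj_pt (\<Phi> v))"
  shows "equivariantly_birational G n (hypersurface n F) \<alpha> m (proj_space m) \<beta>"
proof -
  let ?S = "hypersurface n F"
  define U where "U = {p \<in> ?S. \<forall>v\<in>p. c v \<noteq> 0}"
  define V where "V = {q \<in> proj_space m. \<forall>w\<in>q. c' w \<noteq> 0}"
  define \<phi> where "\<phi> = (\<lambda>p. proj_pt (\<Phi> (SOME v. v \<in> p)))"
  define \<psi> where "\<psi> = (\<lambda>q. proj_pt (\<Psi> (SOME w. w \<in> q)))"
  have dim: "dim_vec (\<Phi> v) = m" "dim_vec (\<Psi> w) = n" for v w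
    using \<Phi>(2) \<Psi>(2) by (auto intro: carrier_vecD)
  have zero: "0 \<cdot>\<^sub>v v = (0\<^sub>v k :: 'k vec)" if "v \<in> carrier_vec k" for v k
    using that by (intro eq_vecI) auto
  have smult_zero: "a \<cdot>\<^sub>v 0\<^sub>v k = (0\<^sub>v k :: 'k vec)" for a k
    by (intro eq_vecI) auto
  have \<Phi>_smult: "\<Phi> (k \<cdot>\<^sub>v v) = k ^ d \<cdot>\<^sub>v \<Phi> v" if "v \<in> carrier_vec n" for k v
    using form_fun_homogeneous[OF \<Phi>(1) that] by (intro eq_vecI) (auto simp: dim)
  have \<Psi>_smult: "\<Psi> (k \<cdot>\<^sub>v w) = k ^ e \<cdot>\<^sub>v \<Psi> w" if "w \<in> carrier_vec m" for k w
    using form_fun_homogeneous[OF \<Psi>(1) that] by (intro eq_vecI) (auto simp: dim)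
  have \<Phi>0: "\<Phi> (0\<^sub>v n) = 0\<^sub>v m"
    using \<Phi>_smult[of "0\<^sub>v n" 0] pos(1) zero[OF \<Phi>(2)] by (simp add: smult_zero zero_power)
  have \<Psi>0: "\<Psi> (0\<^sub>v m) = 0\<^sub>v n"
    using \<Psi>_smult[of "0\<^sub>v m" 0] pos(2) zero[OF \<Psi>(2)] by (simp add: smult_zero zero_power)
  have S_rep: "v \<in> carrier_vec n \<and> v \<noteq> 0\<^sub>v n \<and> p = proj_pt v \<and> eval_at v F = 0"
    if "p \<in> ?S" "v \<in> p" for p v
    using that proj_space_rep[of p n v] by (auto simp: hypersurface_def)
  have \<phi>_eq: "\<phi> p = proj_pt (\<Phi> v)" if "p \<in> ?S" "v \<in> p" for p v
  proof -
    have "(SOME v. v \<in> p) \<in> p" using that(2) by (rule someI)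
    then have "(SOME v. v \<in> p) \<in> proj_pt v" using S_rep that by blast
    then obtain k where "k \<noteq> 0" "(SOME v. v \<in> p) = k \<cdot>\<^sub>v v" by (auto simp: proj_pt_def)
    then show ?thesis using S_rep[OF that] by (simp add: \<phi>_def \<Phi>_smult proj_pt_smult)
  qed
  have \<psi>_eq: "\<psi> q = proj_pt (\<Psi> w)" if "q \<in> proj_space m" "w \<in> q" for q w
  proof -
    have "(SOME w. w \<in> q) \<in> q" using that(2) by (rule someI)
    then have "(SOME w. w \<in> q) \<in> proj_pt w" using proj_space_rep that by blast
    then obtain k where "k \<noteq> 0" "(SOME w. w \<in> q) = k \<cdot>\<^sub>v w" by (auto simp: proj_pt_def)
    then show ?thesis using proj_space_rep[OF that] by (simp add: \<psi>_def \<Psi>_smult proj_pt_smult)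
  qed
  have U: "\<Phi> v \<noteq> 0\<^sub>v m \<and> \<phi> p = proj_pt (\<Phi> v) \<and> \<phi> p \<in> V \<and> \<psi> (\<phi> p) = p"
    if p: "p \<in> U" "v \<in> p" for p v
  proof -
    have v: "v \<in> carrier_vec n" "v \<noteq> 0\<^sub>v n" "p = proj_pt v" "eval_at v F = 0" "c v \<noteq> 0" "p \<in> ?S"
      using p S_rep[of p v] by (auto simp: U_def)
    have inverse: "\<Psi> (\<Phi> v) = c v \<cdot>\<^sub>v v" by (rule \<Psi>\<Phi>) (use v in auto)
    have nz: "\<Phi> v \<noteq> 0\<^sub>v m"
    proof
      assume "\<Phi> v = 0\<^sub>v m"
      then have "c v \<cdot>\<^sub>v v = 0\<^sub>v n" using inverse \<Psi>0 by simp
      then have "inverse (c v) \<cdot>\<^sub>v (c v \<cdot>\<^sub>v v) = 0\<^sub>v n" by (simp add: smult_zero)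
      then show False using v by (simp add: smult_smult_assoc)
    qed
    then obtain j where j: "j < m" "\<Phi> v $ j \<noteq> 0"
      using \<Phi>(2)[of v] by (metis eq_vecI carrier_vecD index_zero_vec)
    have "c v ^ d \<cdot>\<^sub>v \<Phi> v = c' (\<Phi> v) \<cdot>\<^sub>v \<Phi> v"
      using \<Phi>\<Psi>[OF \<Phi>(2), of v] by (simp add: inverse \<Phi>_smult v)
    then have "(c v ^ d \<cdot>\<^sub>v \<Phi> v) $ j = (c' (\<Phi> v) \<cdot>\<^sub>v \<Phi> v) $ j" by simp
    then have "c' (\<Phi> v) \<noteq> 0" using j v(5) \<Phi>(2)[of v] by auto
    moreover have \<phi>: "\<phi> p = proj_pt (\<Phi> v)" using \<phi>_eq p v by blast
    ultimately have "\<phi> p \<in> V"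
      using form_fun_zero_proj_pt(2)[OF c' \<Phi>(2)] nz \<Phi>(2) by (simp add: V_def proj_pt_in_proj_space)
    moreover have "\<psi> (\<phi> p) = proj_pt (\<Psi> (\<Phi> v))"
      using \<psi>_eq[of "\<phi> p" "\<Phi> v"] calculation \<phi> proj_pt_self by (auto simp: V_def)
    ultimately show ?thesis using nz \<phi> inverse v by (simp add: proj_pt_smult)
  qed
  have V: "\<Psi> w \<noteq> 0\<^sub>v n \<and> \<psi> q = proj_pt (\<Psi> w) \<and> \<psi> q \<in> U \<and> \<phi> (\<psi> q) = q"
    if q: "q \<in> V" "w \<in> q" for q w
  proof -
    have w: "w \<in> carrier_vec m" "w \<noteq> 0\<^sub>v m" "q = proj_pt w" "c' w \<noteq> 0" "q \<in> proj_space m"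
      using q proj_space_rep[of q m w] by (auto simp: V_def)
    have inverse: "\<Phi> (\<Psi> w) = c' w \<cdot>\<^sub>v w" by (rule \<Phi>\<Psi>) (use w in auto)
    have nz: "\<Psi> w \<noteq> 0\<^sub>v n"
    proof
      assume "\<Psi> w = 0\<^sub>v n"
      then have "c' w \<cdot>\<^sub>v w = 0\<^sub>v m" using inverse \<Phi>0 by simp
      then have "inverse (c' w) \<cdot>\<^sub>v (c' w \<cdot>\<^sub>v w) = 0\<^sub>v m" by (simp add: smult_zero)
      then show False using w by (simp add: smult_smult_assoc)
    qed
    then obtain i where i: "i < n" "\<Psi> w $ i \<noteq> 0"
      using \<Psi>(2)[of w] by (metis eq_vecI carrier_vecD index_zero_vec)
    have on_F: "eval_at (\<Psi> w) F = 0" by (rule \<Psi>F) (rule w)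
    have "c' w ^ e \<cdot>\<^sub>v \<Psi> w = c (\<Psi> w) \<cdot>\<^sub>v \<Psi> w"
      using \<Psi>\<Phi>[OF \<Psi>(2) on_F] by (simp add: inverse \<Psi>_smult w)
    then have "(c' w ^ e \<cdot>\<^sub>v \<Psi> w) $ i = (c (\<Psi> w) \<cdot>\<^sub>v \<Psi> w) $ i" by simp
    then have "c (\<Psi> w) \<noteq> 0" using i w(4) \<Psi>(2)[of w] by auto
    moreover have \<psi>: "\<psi> q = proj_pt (\<Psi> w)" using \<psi>_eq q w by blast
    moreover have "\<psi> q \<in> ?S" unfolding \<psi> using in_hypersurface_iff[OF F \<Psi>(2) nz] on_F by simp
    ultimately have U: "\<psi> q \<in> U"
      using form_fun_zero_proj_pt(2)[OF c \<Psi>(2)] by (simp add: U_def)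
    moreover have "\<phi> (\<psi> q) = proj_pt (\<Phi> (\<Psi> w))"
      using \<phi>_eq[of "\<psi> q" "\<Psi> w"] \<psi> \<open>\<psi> q \<in> ?S\<close> proj_pt_self by auto
    ultimately show ?thesis using nz \<psi> inverse w by (simp add: proj_pt_smult)
  qed
  have U_rep: "\<exists>v. v \<in> p" if "p \<in> U" for p
    using that proj_pt_self by (auto simp: U_def hypersurface_def elim!: proj_spaceE)
  have V_rep: "\<exists>w. w \<in> q" if "q \<in> V" for q
    using that proj_pt_self by (auto simp: V_def elim!: proj_spaceE)
  have bij: "bij_betw \<phi> U V"
  proof (rule bij_betwI[where g = \<psi>])
    show "\<phi> \<in> U \<rightarrow> V" using U U_rep by (meson Pi_I)
    show "\<psi> \<in> V \<rightarrow> U" using V V_rep by (meson Pi_I)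
    show "\<psi> (\<phi> p) = p" if "p \<in> U" for p using U[OF that] U_rep[OF that] by auto
    show "\<phi> (\<psi> q) = q" if "q \<in> V" for q using V[OF that] V_rep[OF that] by auto
  qed
  have inv: "inv_into U \<phi> q = \<psi> q" if q: "q \<in> V" for q
  proof -
    have "\<psi> q \<in> U" "\<phi> (\<psi> q) = q" using V[OF q] V_rep[OF q] by auto
    then show ?thesis using bij_betw_imp_inj_on[OF bij] by (metis inv_into_f_f)
  qed
  have openU: "openin (zariski n) {p \<in> proj_space n. \<forall>v\<in>p. c v \<noteq> 0}"
    and openV: "openin (zariski m) {q \<in> proj_space m. \<forall>w\<in>q. c' w \<noteq> 0}"
    using openin_nonzero[OF c] openin_nonzero[OF c'] by auto
  have regular: "regular_map n m U \<phi>"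
    unfolding regular_map_def
  proof
    fix p assume p: "p \<in> U"
    have "\<exists>f. \<forall>j<m. f j \<in> forms {..<n} d \<and> (\<lambda>v. \<Phi> v $ j) = (\<lambda>v. eval_at v (f j))"
      using \<Phi>(1) unfolding form_fun_def by metis
    then obtain f where f: "\<And>j. j < m \<Longrightarrow> f j \<in> forms {..<n} d"
      "\<And>j v. j < m \<Longrightarrow> \<Phi> v $ j = eval_at v (f j)" by metis
    have "vec m (\<lambda>j. eval_at v (f j)) = \<Phi> v" for v
      using \<Phi>(2)[of v] f(2) by (intro eq_vecI) auto
    moreover have "p \<in> {p \<in> proj_space n. \<forall>v\<in>p. c v \<noteq> 0}"
      using p by (auto simp: U_def hypersurface_def)
    ultimately show "\<exists>N d f. openin (zariski n) N \<and> p \<in> N \<and> (\<forall>j<m. f j \<in> forms {..<n} d)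
        \<and> (\<forall>q\<in>N \<inter> U. \<forall>v\<in>q. vec m (\<lambda>j. eval_at v (f j)) \<noteq> 0\<^sub>v m
              \<and> \<phi> q = proj_pt (vec m (\<lambda>j. eval_at v (f j))))"
      using openU f(1) U by (intro exI[of _ "{p \<in> proj_space n. \<forall>v\<in>p. c v \<noteq> 0}"] exI[of _ d]
          exI[of _ f]) auto
  qed
  have regular_inv: "regular_map m n V (inv_into U \<phi>)"
    unfolding regular_map_def
  proof
    fix q assume q: "q \<in> V"
    have "\<exists>f. \<forall>i<n. f i \<in> forms {..<m} e \<and> (\<lambda>w. \<Psi> w $ i) = (\<lambda>w. eval_at w (f i))"
      using \<Psi>(1) unfolding form_fun_def by metis
    then obtain f where f: "\<And>i. i < n \<Longrightarrow> f i \<in> forms {..<m} e"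
      "\<And>i w. i < n \<Longrightarrow> \<Psi> w $ i = eval_at w (f i)" by metis
    have "vec n (\<lambda>i. eval_at w (f i)) = \<Psi> w" for w
      using \<Psi>(2)[of w] f(2) by (intro eq_vecI) auto
    then show "\<exists>N d f. openin (zariski m) N \<and> q \<in> N \<and> (\<forall>j<n. f j \<in> forms {..<m} d)
        \<and> (\<forall>q\<in>N \<inter> V. \<forall>v\<in>q. vec n (\<lambda>j. eval_at v (f j)) \<noteq> 0\<^sub>v n
              \<and> inv_into U \<phi> q = proj_pt (vec n (\<lambda>j. eval_at v (f j))))"
      using openV[folded V_def] q f(1) V inv by (intro exI[of _ V] exI[of _ e] exI[of _ f]) auto
  qed
  have S: "?S \<subseteq> proj_space n" by (auto simp: hypersurface_def)
  show ?thesis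
    unfolding equivariantly_birational_def
  proof (rule exI[of _ U], rule exI[of _ V], rule exI[of _ \<phi>], intro conjI ballI impI bij regular regular_inv)
    show "openin (subtopology (zariski n) ?S) U"
      unfolding openin_subtopology
      by (rule exI[of _ "{p \<in> proj_space n. \<forall>v\<in>p. c v \<noteq> 0}"]) (use openU S in \<open>auto simp: U_def\<close>)
    show "openin (subtopology (zariski m) (proj_space m)) V"
      unfolding openin_subtopology
      by (rule exI[of _ V]) (use openV in \<open>auto simp: V_def\<close>)
    show "subtopology (zariski n) ?S closure_of U = ?S"
      unfolding U_def by (rule dense)
    show "subtopology (zariski m) (proj_space m) closure_of V = proj_space m"
      unfolding V_def by (rule nonzero_dense_in_proj_space[OF c' nontrivial pos(3)])
    fix g p assume g: "g \<in> carrier G" "p \<in> U" "\<alpha> g p \<in> U"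
    then obtain v where v: "v \<in> p" using U_rep by blast
    obtain v' where "v' \<in> \<alpha> g p" "proj_pt (\<Phi> v') = \<beta> g (proj_pt (\<Phi> v))"
      using equivariant[OF g(1) _ v] g(2) by (auto simp: U_def)
    then show "\<phi> (\<alpha> g p) = \<beta> g (\<phi> p)"
      using U[OF g(2) v] U[OF g(3)] by metis
  qed
qed


section \<open>Binary quartics as norms\<close>

text \<open>
  Over an algebraically closed field every polynomial is a norm \<open>Y\<^sup>2 + x U\<^sup>2\<close> from the quadratic
  extension of \<open>k(x)\<close> by a root of \<open>- x\<close>: norms are closed under multiplication, and the linear
  polynomial \<open>x - r\<close> is the norm with \<open>Y\<^sup>2 = - r\<close> and \<open>U = 1\<close>.
\<close>

lemma poly_is_norm:
  fixes P :: "'k::alg_closed_field poly"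
  assumes "degree P \<le> n"
  shows "\<exists>Y U. P = Y ^ 2 + [:0, 1:] * U ^ 2 \<and> 2 * degree Y \<le> n \<and> (U = 0 \<or> 2 * degree U + 1 \<le> n)"
  using assms
proof (induction n arbitrary: P)
  case 0
  then obtain k where P: "P = [:k:]" by (auto elim: degree_eq_zeroE)
  obtain y where "y ^ 2 = k" using nth_root_exists[of 2 k] by auto
  then have "P = [:y:] ^ 2 + [:0, 1:] * 0 ^ 2" by (simp add: P power2_eq_square)
  then show ?case by (intro exI[of _ "[:y:]"] exI[of _ 0]) simp
next
  case (Suc n)
  show ?case
  proof (cases "degree P \<le> n")
    case True
    from Suc.IH[OF this] obtain Y U where "P = Y ^ 2 + [:0, 1:] * U ^ 2" "2 * degree Y \<le> n"
      "U = 0 \<or> 2 * degree U + 1 \<le> n" by blast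
    then show ?thesis by (intro exI[of _ Y] exI[of _ U]) auto
  next
    case False
    then obtain r where "poly P r = 0" using alg_closed_imp_poly_has_root[of P] by auto
    then obtain Q where P: "P = [:- r, 1:] * Q" by (auto simp: poly_eq_0_iff_dvd)
    then have "degree P = Suc (degree Q)" if "Q \<noteq> 0"
      unfolding P using that by (subst degree_mult_eq) auto
    then have "degree Q \<le> n" using Suc.prems by (cases "Q = 0") auto
    from Suc.IH[OF this] obtain Y U where Q: "Q = Y ^ 2 + [:0, 1:] * U ^ 2"
      and Y: "2 * degree Y \<le> n" and U: "U = 0 \<or> 2 * degree U + 1 \<le> n" by blast
    obtain y where y: "y ^ 2 = - r" using nth_root_exists[of 2 "- r"] by auto
    let ?Y = "Polynomial.smult y Y - [:0, 1:] * U" and ?U = "Polynomial.smult y U + Y"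
    have linear: "[:- r, 1:] = [:y:] ^ 2 + [:0, 1:]" by (simp add: power2_eq_square flip: y)
    have smult: "Polynomial.smult y T = [:y:] * T" for T by simp
    have "P = ?Y ^ 2 + [:0, 1:] * ?U ^ 2"
      unfolding P Q linear smult by (simp only: power2_eq_square algebra_simps)
    moreover have "2 * degree ?Y \<le> Suc n"
    proof -
      have "degree ([:0, 1:] * U) \<le> Suc (degree U)"
        using degree_mult_le[of "[:0, 1:]" U] by simp
      then have "2 * degree ([:0, 1:] * U) \<le> Suc n" using U by (cases "U = 0") auto
      moreover have "2 * degree (Polynomial.smult y Y) \<le> Suc n" using Y degree_smult_le[of y Y] by linarith
      ultimately have "degree ?Y \<le> Suc n div 2" by (intro degree_diff_le) linarith+
      then show ?thesis by linarith
    qed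
    moreover have "?U = 0 \<or> 2 * degree ?U + 1 \<le> Suc n"
    proof -
      have "degree ?U \<le> n div 2"
        by (rule degree_add_le) (use Y U degree_smult_le[of y U] in auto)
      then show ?thesis by auto
    qed
    ultimately show ?thesis by blast
  qed
qed

text \<open>
  Homogenized: for degree 4 the degree bounds of the previous lemma make \<open>Y\<close> a quadratic and
  \<open>U\<close> a linear form, so the identity holds without denominators.
\<close>

lemma binary_quartic_is_norm:
  fixes d :: "nat \<Rightarrow> 'k::alg_closed_field"
  obtains y\<^sub>0 y\<^sub>1 y\<^sub>2 u\<^sub>0 u\<^sub>1 where
    "\<And>z c. d 0 * z ^ 4 + d 1 * z ^ 3 * c + d 2 * z ^ 2 * c ^ 2 + d 3 * z * c ^ 3 + d 4 * c ^ 4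
       = (y\<^sub>0 * z ^ 2 + y\<^sub>1 * z * c + y\<^sub>2 * c ^ 2) ^ 2 + z * c * (u\<^sub>0 * z + u\<^sub>1 * c) ^ 2"
proof -
  let ?P = "[:d 0, d 1, d 2, d 3, d 4:]"
  have "degree ?P \<le> 4"
    by (intro degree_le) (auto simp: coeff_pCons eval_nat_numeral split: nat.split)
  from poly_is_norm[OF this] obtain Y U where YU: "?P = Y ^ 2 + [:0, 1:] * U ^ 2"
    "2 * degree Y \<le> 4" "U = 0 \<or> 2 * degree U + 1 \<le> 4" by blast
  obtain y\<^sub>0 y\<^sub>1 y\<^sub>2 where y: "Y = [:y\<^sub>0, y\<^sub>1, y\<^sub>2:]"
  proof
    show "Y = [:coeff Y 0, coeff Y 1, coeff Y 2:]"
      using YU(2)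
      by (intro poly_eqI) (auto simp: coeff_pCons coeff_eq_0 eval_nat_numeral split: nat.split)
  qed
  obtain u\<^sub>0 u\<^sub>1 where u: "U = [:u\<^sub>0, u\<^sub>1:]"
  proof
    show "U = [:coeff U 0, coeff U 1:]"
      using YU(3)
      by (intro poly_eqI) (auto simp: coeff_pCons coeff_eq_0 eval_nat_numeral split: nat.split)
  qed
  have d: "d 0 = y\<^sub>0 ^ 2" "d 1 = y\<^sub>0 * y\<^sub>1 + y\<^sub>0 * y\<^sub>1 + u\<^sub>0 ^ 2"
    "d 2 = y\<^sub>1 ^ 2 + y\<^sub>0 * y\<^sub>2 + y\<^sub>0 * y\<^sub>2 + u\<^sub>0 * u\<^sub>1 + u\<^sub>0 * u\<^sub>1"
    "d 3 = y\<^sub>1 * y\<^sub>2 + y\<^sub>1 * y\<^sub>2 + u\<^sub>1 ^ 2" "d 4 = y\<^sub>2 ^ 2"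
    using YU(1) by (simp_all add: y u power2_eq_square algebra_simps)
  show thesis
  proof (rule that)
    fix z c
    show "d 0 * z ^ 4 + d 1 * z ^ 3 * c + d 2 * z ^ 2 * c ^ 2 + d 3 * z * c ^ 3 + d 4 * c ^ 4
       = (y\<^sub>0 * z ^ 2 + y\<^sub>1 * z * c + y\<^sub>2 * c ^ 2) ^ 2 + z * c * (u\<^sub>0 * z + u\<^sub>1 * c) ^ 2"
      unfolding d by (simp add: eval_nat_numeral algebra_simps)
  qed
qed


section \<open>Coordinate vectors\<close>

definition quint :: "'k \<Rightarrow> 'k \<Rightarrow> 'k \<Rightarrow> 'k \<Rightarrow> 'k \<Rightarrow> 'k vec" where
  "quint x\<^sub>0 x\<^sub>1 x\<^sub>2 x\<^sub>3 x\<^sub>4 = vec_of_list [x\<^sub>0, x\<^sub>1, x\<^sub>2, x\<^sub>3, x\<^sub>4]"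

lemma quint_nth [simp]:
  "quint x\<^sub>0 x\<^sub>1 x\<^sub>2 x\<^sub>3 x\<^sub>4 $ 0 = x\<^sub>0" "quint x\<^sub>0 x\<^sub>1 x\<^sub>2 x\<^sub>3 x\<^sub>4 $ Suc 0 = x\<^sub>1" "quint x\<^sub>0 x\<^sub>1 x\<^sub>2 x\<^sub>3 x\<^sub>4 $ 2 = x\<^sub>2"
  "quint x\<^sub>0 x\<^sub>1 x\<^sub>2 x\<^sub>3 x\<^sub>4 $ 3 = x\<^sub>3" "quint x\<^sub>0 x\<^sub>1 x\<^sub>2 x\<^sub>3 x\<^sub>4 $ 4 = x\<^sub>4"
  unfolding quint_def vec_of_list_index by (simp_all only: nth_simps5)

lemma quint_carrier [simp]: "quint x\<^sub>0 x\<^sub>1 x\<^sub>2 x\<^sub>3 x\<^sub>4 \<in> carrier_vec 5"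
  unfolding quint_def by (rule carrier_vecI) (simp del: vec_of_list_Cons vec_of_list_Nil)

lemma dim_quint [simp]: "dim_vec (quint x\<^sub>0 x\<^sub>1 x\<^sub>2 x\<^sub>3 x\<^sub>4) = 5"
  using quint_carrier by (rule carrier_vecD)

lemma quint_smult: "k \<cdot>\<^sub>v quint x\<^sub>0 x\<^sub>1 x\<^sub>2 x\<^sub>3 x\<^sub>4 = quint (k * x\<^sub>0) (k * x\<^sub>1) (k * x\<^sub>2) (k * x\<^sub>3) (k * x\<^sub>4)"
  by (rule vec5_eqI) auto

lemma quint_eq_zero_iff:
  "quint x\<^sub>0 x\<^sub>1 x\<^sub>2 x\<^sub>3 x\<^sub>4 = 0\<^sub>v 5 \<longleftrightarrow> x\<^sub>0 = 0 \<and> x\<^sub>1 = 0 \<and> x\<^sub>2 = 0 \<and> x\<^sub>3 = 0 \<and> x\<^sub>4 = (0::'k::zero)"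
proof
  assume *: "quint x\<^sub>0 x\<^sub>1 x\<^sub>2 x\<^sub>3 x\<^sub>4 = 0\<^sub>v 5"
  have "quint x\<^sub>0 x\<^sub>1 x\<^sub>2 x\<^sub>3 x\<^sub>4 $ i = 0" if "i < 5" for i using that by (simp add: *)
  from this[of 0] this[of 1] this[of 2] this[of 3] this[of 4]
  show "x\<^sub>0 = 0 \<and> x\<^sub>1 = 0 \<and> x\<^sub>2 = 0 \<and> x\<^sub>3 = 0 \<and> x\<^sub>4 = 0" by simp
qed (rule vec5_eqI, auto)

definition quad :: "'k \<Rightarrow> 'k \<Rightarrow> 'k \<Rightarrow> 'k \<Rightarrow> 'k vec" where
  "quad w\<^sub>0 w\<^sub>1 w\<^sub>2 w\<^sub>3 = vec_of_list [w\<^sub>0, w\<^sub>1, w\<^sub>2, w\<^sub>3]"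

lemma quad_nth [simp]:
  "quad w\<^sub>0 w\<^sub>1 w\<^sub>2 w\<^sub>3 $ 0 = w\<^sub>0" "quad w\<^sub>0 w\<^sub>1 w\<^sub>2 w\<^sub>3 $ Suc 0 = w\<^sub>1" "quad w\<^sub>0 w\<^sub>1 w\<^sub>2 w\<^sub>3 $ 2 = w\<^sub>2"
  "quad w\<^sub>0 w\<^sub>1 w\<^sub>2 w\<^sub>3 $ 3 = w\<^sub>3"
  unfolding quad_def vec_of_list_index by (simp_all add: eval_nat_numeral)

lemma quad_carrier [simp]: "quad w\<^sub>0 w\<^sub>1 w\<^sub>2 w\<^sub>3 \<in> carrier_vec 4"
  unfolding quad_def by (rule carrier_vecI) (simp del: vec_of_list_Cons vec_of_list_Nil)

lemma dim_quad [simp]: "dim_vec (quad w\<^sub>0 w\<^sub>1 w\<^sub>2 w\<^sub>3) = 4"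
  using quad_carrier by (rule carrier_vecD)

lemma vec4_eqI:
  assumes "v \<in> carrier_vec 4" "w \<in> carrier_vec 4" "v $ 0 = w $ 0" "v $ Suc 0 = w $ Suc 0"
    "v $ 2 = w $ 2" "v $ 3 = w $ 3"
  shows "v = w"
proof (rule eq_vecI)
  fix i assume "i < dim_vec w"
  then have "i = 0 \<or> i = Suc 0 \<or> i = 2 \<or> i = 3" using assms(2) by auto
  then show "v $ i = w $ i" by (elim disjE) (simp_all only: assms(3-))
qed (simp add: assms(1,2)[THEN carrier_vecD])


section \<open>The ternary cubic and the singular locus\<close>

text \<open>
  A cubic form in \<open>x\<^sub>2, x\<^sub>3, x\<^sub>4\<close> is written out in its ten coefficients: its values and partial
  derivatives are then plain ring expressions, and substitutions can be checked by normalization.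
\<close>

definition ternary_cubic :: "(nat \<Rightarrow> nat \<Rightarrow> 'k::comm_ring_1) \<Rightarrow> 'k \<Rightarrow> 'k \<Rightarrow> 'k \<Rightarrow> 'k" where
  "ternary_cubic \<kappa> x y w = \<kappa> 0 0 * x ^ 3 + \<kappa> 1 0 * x ^ 2 * y + \<kappa> 0 1 * x ^ 2 * w + \<kappa> 2 0 * x * y ^ 2
     + \<kappa> 1 1 * x * y * w + \<kappa> 0 2 * x * w ^ 2 + \<kappa> 3 0 * y ^ 3 + \<kappa> 2 1 * y ^ 2 * w
     + \<kappa> 1 2 * y * w ^ 2 + \<kappa> 0 3 * w ^ 3"

definition ternary_cubic_x :: "(nat \<Rightarrow> nat \<Rightarrow> 'k::comm_ring_1) \<Rightarrow> 'k \<Rightarrow> 'k \<Rightarrow> 'k \<Rightarrow> 'k" where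
  "ternary_cubic_x \<kappa> x y w = 3 * \<kappa> 0 0 * x ^ 2 + 2 * \<kappa> 1 0 * x * y + 2 * \<kappa> 0 1 * x * w
     + \<kappa> 2 0 * y ^ 2 + \<kappa> 1 1 * y * w + \<kappa> 0 2 * w ^ 2"

definition ternary_cubic_y :: "(nat \<Rightarrow> nat \<Rightarrow> 'k::comm_ring_1) \<Rightarrow> 'k \<Rightarrow> 'k \<Rightarrow> 'k \<Rightarrow> 'k" where
  "ternary_cubic_y \<kappa> x y w = \<kappa> 1 0 * x ^ 2 + 2 * \<kappa> 2 0 * x * y + \<kappa> 1 1 * x * w
     + 3 * \<kappa> 3 0 * y ^ 2 + 2 * \<kappa> 2 1 * y * w + \<kappa> 1 2 * w ^ 2"

definition ternary_cubic_w :: "(nat \<Rightarrow> nat \<Rightarrow> 'k::comm_ring_1) \<Rightarrow> 'k \<Rightarrow> 'k \<Rightarrow> 'k \<Rightarrow> 'k" where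
  "ternary_cubic_w \<kappa> x y w = \<kappa> 0 1 * x ^ 2 + \<kappa> 1 1 * x * y + 2 * \<kappa> 0 2 * x * w
     + \<kappa> 2 1 * y ^ 2 + 2 * \<kappa> 1 2 * y * w + 3 * \<kappa> 0 3 * w ^ 2"

lemmas ternary_cubic_defs =
  ternary_cubic_def ternary_cubic_x_def ternary_cubic_y_def ternary_cubic_w_def

definition cubic_exponent :: "nat \<Rightarrow> nat \<Rightarrow> nat \<Rightarrow>\<^sub>0 nat" where
  "cubic_exponent i j = Poly_Mapping.single 2 (3 - i - j) + Poly_Mapping.single 3 i
     + Poly_Mapping.single 4 j"

lemma lookup_cubic_exponent:
  "Poly_Mapping.lookup (cubic_exponent i j) n
     = (if n = 2 then 3 - i - j else if n = 3 then i else if n = 4 then j else 0)"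
  by (simp add: cubic_exponent_def lookup_add lookup_single when_def)

lemma keys_cubic_exponent: "Poly_Mapping.keys (cubic_exponent i j) \<subseteq> {2, 3, 4}"
  by (auto simp: in_keys_iff lookup_cubic_exponent split: if_splits)

definition cubic_index :: "(nat \<times> nat) set" where
  "cubic_index = {(0,0), (1,0), (0,1), (2,0), (1,1), (0,2), (3,0), (2,1), (1,2), (0,3)}"

lemma keys_form_cubic:
  assumes "f \<in> forms {2, 3, 4} 3"
  shows "Poly_Mapping.keys f \<subseteq> (\<lambda>(i, j). cubic_exponent i j) ` cubic_index"
proof
  fix m assume "m \<in> Poly_Mapping.keys f"
  then have m: "Poly_Mapping.keys m \<subseteq> {2, 3, 4}"
    "(\<Sum>i\<in>Poly_Mapping.keys m. Poly_Mapping.lookup m i) = 3"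
    using assms by (auto simp: forms_def)
  have "(\<Sum>i\<in>Poly_Mapping.keys m. Poly_Mapping.lookup m i) = (\<Sum>i\<in>{2, 3, 4}. Poly_Mapping.lookup m i)"
    using m(1) by (intro sum.mono_neutral_left) (auto simp: in_keys_iff)
  then have total: "Poly_Mapping.lookup m 2 + Poly_Mapping.lookup m 3 + Poly_Mapping.lookup m 4 = 3"
    using m(2) by simp
  define i j where "i = Poly_Mapping.lookup m 3" and "j = Poly_Mapping.lookup m 4"
  have "Poly_Mapping.lookup m n = Poly_Mapping.lookup (cubic_exponent i j) n" for n
    using total m(1) by (auto simp: lookup_cubic_exponent i_def j_def in_keys_iff)
  then have "m = cubic_exponent i j" by (intro poly_mapping_eqI)
  moreover have "(i, j) \<in> cubic_index"
  proof -
    have "i + j \<le> 3" using total by (simp add: i_def j_def)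
    moreover from this have "i \<in> {0, 1, 2, 3}" "j \<in> {0, 1, 2, 3}" by auto
    ultimately show ?thesis by (elim insertE emptyE; simp add: cubic_index_def)
  qed
  ultimately show "m \<in> (\<lambda>(i, j). cubic_exponent i j) ` cubic_index" by force
qed

lemma inj_cubic_exponent: "inj_on (\<lambda>(i, j). cubic_exponent i j) cubic_index"
proof (rule inj_onI, clarify)
  fix i j i' j' assume eq: "cubic_exponent i j = cubic_exponent i' j'"
  have "Poly_Mapping.lookup (cubic_exponent i j) 3 = Poly_Mapping.lookup (cubic_exponent i' j') 3"
    "Poly_Mapping.lookup (cubic_exponent i j) 4 = Poly_Mapping.lookup (cubic_exponent i' j') 4"
    by (simp_all only: eq)
  then show "i = i' \<and> j = j'" by (simp add: lookup_cubic_exponent)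
qed

definition cubic_coeff :: "'k::comm_ring_1 mpoly \<Rightarrow> nat \<Rightarrow> nat \<Rightarrow> 'k" where
  "cubic_coeff f i j = Poly_Mapping.lookup f (cubic_exponent i j)"

lemma sum_cubic_index:
  "(\<Sum>(i, j)\<in>cubic_index. h i j) = h 0 0 + h 1 0 + h 0 1 + h 2 0 + h 1 1 + h 0 2 + h 3 0 + h 2 1
     + h 1 2 + (h 0 3 :: 'a::comm_monoid_add)"
  by (simp add: cubic_index_def add.assoc)

lemma eval_at_ternary:
  assumes "f \<in> forms {2, 3, 4} 3"
  shows "eval_at v f = ternary_cubic (cubic_coeff f) (v $ 2) (v $ 3) (v $ 4)"
proof -
  let ?e = "\<lambda>(i, j). cubic_exponent i j"
  have "finite (?e ` cubic_index)" by (simp add: cubic_index_def)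
  then have "eval_at v f = (\<Sum>m\<in>?e ` cubic_index. Poly_Mapping.lookup f m
      * (\<Prod>i\<in>Poly_Mapping.keys m. (v $ i) ^ Poly_Mapping.lookup m i))"
    unfolding eval_at_def using keys_form_cubic[OF assms] by (rule mpoly_eval_superset)
  also have "\<dots> = (\<Sum>(i, j)\<in>cubic_index. cubic_coeff f i j
      * (\<Prod>n\<in>{2, 3, 4}. (v $ n) ^ Poly_Mapping.lookup (cubic_exponent i j) n))"
    by (subst sum.reindex[OF inj_cubic_exponent])
      (auto intro!: sum.cong simp: cubic_coeff_def monomial_value_superset[OF _ keys_cubic_exponent])
  also have "\<dots> = ternary_cubic (cubic_coeff f) (v $ 2) (v $ 3) (v $ 4)"
    by (simp add: sum_cubic_index lookup_cubic_exponent ternary_cubic_def mult.assoc)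
  finally show ?thesis .
qed

lemma eval_at_pderiv_superset:
  assumes "finite M" "Poly_Mapping.keys f \<subseteq> M"
  shows "eval_at v (pderiv_mpoly i f) = (\<Sum>m\<in>M. of_nat (Poly_Mapping.lookup m i) * Poly_Mapping.lookup f m
     * (\<Prod>j\<in>Poly_Mapping.keys (m - Poly_Mapping.single i 1).
          (v $ j) ^ Poly_Mapping.lookup (m - Poly_Mapping.single i 1) j))"
  unfolding pderiv_mpoly_def eval_at_sum eval_at_single using assms
  by (intro sum.mono_neutral_left) (auto simp: in_keys_iff)

lemma eval_at_pderiv_add:
  "eval_at v (pderiv_mpoly i (f + g)) = eval_at v (pderiv_mpoly i f) + eval_at v (pderiv_mpoly i g)"
proof -
  let ?M = "Poly_Mapping.keys f \<union> Poly_Mapping.keys g"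
  have "finite ?M" by simp
  note superset = eval_at_pderiv_superset[OF this]
  show ?thesis
    unfolding superset[OF Poly_Mapping.keys_add] superset[OF Un_upper1] superset[OF Un_upper2]
    by (simp add: lookup_add algebra_simps sum.distrib)
qed

lemma eval_at_pderiv_ternary:
  fixes f :: "'k::comm_ring_1 mpoly"
  assumes "f \<in> forms {2, 3, 4} 3"
  shows "eval_at v (pderiv_mpoly 0 f) = 0" "eval_at v (pderiv_mpoly (Suc 0) f) = 0"
    "eval_at v (pderiv_mpoly 2 f) = ternary_cubic_x (cubic_coeff f) (v $ 2) (v $ 3) (v $ 4)"
    "eval_at v (pderiv_mpoly 3 f) = ternary_cubic_y (cubic_coeff f) (v $ 2) (v $ 3) (v $ 4)"
    "eval_at v (pderiv_mpoly 4 f) = ternary_cubic_w (cubic_coeff f) (v $ 2) (v $ 3) (v $ 4)"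
proof -
  let ?e = "\<lambda>(i, j). cubic_exponent i j"
  have keys: "Poly_Mapping.keys (cubic_exponent i j - Poly_Mapping.single l 1) \<subseteq> {2, 3, 4}" for i j l
    by (auto simp: in_keys_iff lookup_minus lookup_cubic_exponent split: if_splits)
  have fin: "finite (?e ` cubic_index)" by (simp add: cubic_index_def)
  have deriv: "eval_at v (pderiv_mpoly l f)
      = (\<Sum>(i, j)\<in>cubic_index. of_nat (Poly_Mapping.lookup (cubic_exponent i j) l) * cubic_coeff f i j
      * (\<Prod>n\<in>{2, 3, 4}. (v $ n) ^ Poly_Mapping.lookup (cubic_exponent i j - Poly_Mapping.single l 1) n))" for l
    unfolding eval_at_pderiv_superset[OF fin keys_form_cubic[OF assms]]
    by (subst sum.reindex[OF inj_cubic_exponent])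
      (auto intro!: sum.cong simp: cubic_coeff_def monomial_value_superset[OF _ keys]
        simp del: One_nat_def)
  show "eval_at v (pderiv_mpoly 0 f) = 0" "eval_at v (pderiv_mpoly (Suc 0) f) = 0"
    unfolding deriv sum_cubic_index by (simp_all add: lookup_cubic_exponent)
  show "eval_at v (pderiv_mpoly 2 f) = ternary_cubic_x (cubic_coeff f) (v $ 2) (v $ 3) (v $ 4)"
    "eval_at v (pderiv_mpoly 3 f) = ternary_cubic_y (cubic_coeff f) (v $ 2) (v $ 3) (v $ 4)"
    "eval_at v (pderiv_mpoly 4 f) = ternary_cubic_w (cubic_coeff f) (v $ 2) (v $ 3) (v $ 4)"
    unfolding deriv sum_cubic_index
    by (simp_all add: lookup_cubic_exponent lookup_minus lookup_single when_def ternary_cubic_defs mult_ac)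
qed

lemma eval_at_pderiv_product:
  "eval_at v (pderiv_mpoly 0 (Var 0 * Var 1 * Var 2)) = v $ 1 * v $ 2"
  "eval_at v (pderiv_mpoly (Suc 0) (Var 0 * Var 1 * Var 2)) = v $ 0 * v $ 2"
  "eval_at v (pderiv_mpoly 2 (Var 0 * Var 1 * Var 2)) = v $ 0 * v $ 1"
  "eval_at v (pderiv_mpoly 3 (Var 0 * Var 1 * Var 2)) = 0"
  "eval_at v (pderiv_mpoly 4 (Var 0 * Var 1 * Var 2)) = 0"
proof -
  define e :: "nat \<Rightarrow>\<^sub>0 nat" where
    "e = Poly_Mapping.single 0 1 + Poly_Mapping.single 1 1 + Poly_Mapping.single 2 1"
  have lookup: "Poly_Mapping.lookup e n = (if n < 3 then 1 else 0)" for n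
    by (auto simp: e_def lookup_add lookup_single when_def)
  have keys: "Poly_Mapping.keys (e - Poly_Mapping.single l 1) \<subseteq> {0, 1, 2}" for l
    by (auto simp: in_keys_iff lookup_minus lookup split: if_splits)
  have "Var 0 * Var 1 * Var 2 = Poly_Mapping.single e (1 :: 'a)"
    by (simp add: Var_def mult_single e_def)
  then have deriv: "eval_at v (pderiv_mpoly l (Var 0 * Var 1 * Var 2)) = of_nat (Poly_Mapping.lookup e l)
      * (\<Prod>n\<in>{0, 1, 2}. (v $ n) ^ Poly_Mapping.lookup (e - Poly_Mapping.single l 1) n)" for l
    by (simp add: pderiv_mpoly_def eval_at_single monomial_value_superset[OF _ keys] del: One_nat_def)
  show "eval_at v (pderiv_mpoly 0 (Var 0 * Var 1 * Var 2)) = v $ 1 * v $ 2"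
    "eval_at v (pderiv_mpoly (Suc 0) (Var 0 * Var 1 * Var 2)) = v $ 0 * v $ 2"
    "eval_at v (pderiv_mpoly 2 (Var 0 * Var 1 * Var 2)) = v $ 0 * v $ 1"
    "eval_at v (pderiv_mpoly 3 (Var 0 * Var 1 * Var 2)) = 0"
    "eval_at v (pderiv_mpoly 4 (Var 0 * Var 1 * Var 2)) = 0"
    unfolding deriv by (simp_all add: lookup lookup_minus lookup_single when_def)
qed

lemma cubic_in_forms:
  assumes "f \<in> forms {2, 3, 4} 3"
  shows "cubic f \<in> forms {..<5} 3"
proof -
  have "Var 0 * Var 1 * Var 2 \<in> forms {..<5} (1 + 1 + 1)"
    by (intro forms_mult Var_in_forms) auto
  moreover have "f \<in> forms {..<5} 3" by (rule forms_mono[OF _ assms]) auto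
  ultimately show ?thesis unfolding cubic_def by (intro forms_add) (simp_all add: eval_nat_numeral)
qed

lemma ternary_cubic_homogeneous:
  "ternary_cubic \<kappa> (k * x) (k * y) (k * w) = k ^ 3 * ternary_cubic \<kappa> x y w"
  "ternary_cubic_x \<kappa> (k * x) (k * y) (k * w) = k ^ 2 * ternary_cubic_x \<kappa> x y w"
  "ternary_cubic_y \<kappa> (k * x) (k * y) (k * w) = k ^ 2 * ternary_cubic_y \<kappa> x y w"
  "ternary_cubic_w \<kappa> (k * x) (k * y) (k * w) = k ^ 2 * ternary_cubic_w \<kappa> x y w"
  by (simp_all add: ternary_cubic_defs power_mult_distrib algebra_simps power2_eq_square power3_eq_cube)

lemma singular_point_of_cubic:
  fixes f :: "'k::field mpoly"
  assumes f: "f \<in> forms {2, 3, 4} 3"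
    and eqs: "x\<^sub>0 * x\<^sub>1 * x\<^sub>2 + ternary_cubic (cubic_coeff f) x\<^sub>2 x\<^sub>3 x\<^sub>4 = 0" "x\<^sub>1 * x\<^sub>2 = 0" "x\<^sub>0 * x\<^sub>2 = 0"
      "x\<^sub>0 * x\<^sub>1 + ternary_cubic_x (cubic_coeff f) x\<^sub>2 x\<^sub>3 x\<^sub>4 = 0"
      "ternary_cubic_y (cubic_coeff f) x\<^sub>2 x\<^sub>3 x\<^sub>4 = 0" "ternary_cubic_w (cubic_coeff f) x\<^sub>2 x\<^sub>3 x\<^sub>4 = 0"
    and nz: "quint x\<^sub>0 x\<^sub>1 x\<^sub>2 x\<^sub>3 x\<^sub>4 \<noteq> 0\<^sub>v 5"
  shows "proj_pt (quint x\<^sub>0 x\<^sub>1 x\<^sub>2 x\<^sub>3 x\<^sub>4) \<in> sing_locus 5 (cubic f)"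
  unfolding sing_locus_def
proof (intro CollectI conjI ballI allI impI)
  show "proj_pt (quint x\<^sub>0 x\<^sub>1 x\<^sub>2 x\<^sub>3 x\<^sub>4) \<in> hypersurface 5 (cubic f)"
    by (subst in_hypersurface_iff[OF cubic_in_forms[OF f] quint_carrier nz])
      (simp add: eval_at_cubic eval_at_ternary[OF f] eqs(1))
  fix w i assume "w \<in> proj_pt (quint x\<^sub>0 x\<^sub>1 x\<^sub>2 x\<^sub>3 x\<^sub>4)" and i: "i < (5::nat)"
  then obtain k where w: "w = quint (k * x\<^sub>0) (k * x\<^sub>1) (k * x\<^sub>2) (k * x\<^sub>3) (k * x\<^sub>4)"
    by (auto simp: proj_pt_def quint_smult)
  have "k * x\<^sub>0 * (k * x\<^sub>1) + k ^ 2 * ternary_cubic_x (cubic_coeff f) x\<^sub>2 x\<^sub>3 x\<^sub>4 = k ^ 2 * 0"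
    unfolding eqs(4)[symmetric] by (simp add: power2_eq_square algebra_simps)
  moreover have "k * x\<^sub>1 * (k * x\<^sub>2) = 0" "k * x\<^sub>0 * (k * x\<^sub>2) = 0" using eqs(2,3) by auto
  moreover have "i = 0 \<or> i = Suc 0 \<or> i = 2 \<or> i = 3 \<or> i = 4" using i by auto
  ultimately show "eval_at w (pderiv_mpoly i (cubic f)) = 0"
    unfolding cubic_def eval_at_pderiv_add
    by (elim disjE) (simp_all add: w eval_at_pderiv_product[unfolded One_nat_def]
      eval_at_pderiv_ternary[OF f] ternary_cubic_homogeneous eqs(5,6))
qed

text \<open>
  The two coordinate points \<open>[1:0:0:0:0]\<close> and \<open>[0:1:0:0:0]\<close> are singular whatever the cubic form
  is, so they are the only singular points when there are two of them.
\<close>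

lemma no_further_singular_points:
  fixes f :: "'k::field mpoly"
  assumes f: "f \<in> forms {2, 3, 4} 3" and card: "card (sing_locus 5 (cubic f)) = 2"
    and eqs: "x\<^sub>0 * x\<^sub>1 * x\<^sub>2 + ternary_cubic (cubic_coeff f) x\<^sub>2 x\<^sub>3 x\<^sub>4 = 0" "x\<^sub>1 * x\<^sub>2 = 0" "x\<^sub>0 * x\<^sub>2 = 0"
      "x\<^sub>0 * x\<^sub>1 + ternary_cubic_x (cubic_coeff f) x\<^sub>2 x\<^sub>3 x\<^sub>4 = 0"
      "ternary_cubic_y (cubic_coeff f) x\<^sub>2 x\<^sub>3 x\<^sub>4 = 0" "ternary_cubic_w (cubic_coeff f) x\<^sub>2 x\<^sub>3 x\<^sub>4 = 0"
  shows "x\<^sub>2 = 0 \<and> x\<^sub>3 = 0 \<and> x\<^sub>4 = 0"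
proof (rule ccontr)
  assume nz: "\<not> (x\<^sub>2 = 0 \<and> x\<^sub>3 = 0 \<and> x\<^sub>4 = 0)"
  let ?e = "quint 1 0 0 0 0 :: 'k vec" and ?e' = "quint 0 1 0 0 0 :: 'k vec" and ?v = "quint x\<^sub>0 x\<^sub>1 x\<^sub>2 x\<^sub>3 x\<^sub>4"
  have "proj_pt ?v \<in> sing_locus 5 (cubic f)"
    by (rule singular_point_of_cubic[OF f eqs]) (use nz in \<open>auto simp: quint_eq_zero_iff\<close>)
  moreover have "proj_pt ?e \<in> sing_locus 5 (cubic f)" "proj_pt ?e' \<in> sing_locus 5 (cubic f)"
    by (rule singular_point_of_cubic[OF f]; simp add: ternary_cubic_defs quint_eq_zero_iff)+
  ultimately have sub: "{proj_pt ?e, proj_pt ?e', proj_pt ?v} \<subseteq> sing_locus 5 (cubic f)" by simp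
  have index_smult: "v = k \<cdot>\<^sub>v quint a b c d e \<Longrightarrow>
      v $ 0 = k * a \<and> v $ Suc 0 = k * b \<and> v $ 2 = k * c \<and> v $ 3 = k * d \<and> v $ 4 = k * e"
    for v and a b c d e k :: 'k by (simp add: quint_smult)
  have rep: "\<exists>k. v = k \<cdot>\<^sub>v w" if "proj_pt v = proj_pt w" for v w :: "'k vec"
    using proj_pt_self[of v] unfolding that by (auto simp: proj_pt_def)
  have "proj_pt ?v \<noteq> proj_pt ?e" "proj_pt ?v \<noteq> proj_pt ?e'"
    using nz by (auto dest!: rep index_smult)
  moreover have "proj_pt ?e \<noteq> proj_pt ?e'"
    by (auto dest!: rep index_smult)
  ultimately have "card {proj_pt ?e, proj_pt ?e', proj_pt ?v} = 3" by auto
  moreover have "finite (sing_locus 5 (cubic f))" by (rule card_ge_0_finite) (simp add: card)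
  ultimately show False using card_mono[OF _ sub] card by simp
qed


section \<open>The cubic as a family of quadrics\<close>

definition binary_cubic :: "(nat \<Rightarrow> 'k::comm_ring_1) \<Rightarrow> 'k \<Rightarrow> 'k \<Rightarrow> 'k" where
  "binary_cubic a z t = a 0 * z ^ 3 + a 1 * z ^ 2 * t + a 2 * z * t ^ 2 + a 3 * t ^ 3"

definition binary_quadratic :: "(nat \<Rightarrow> 'k::comm_ring_1) \<Rightarrow> 'k \<Rightarrow> 'k \<Rightarrow> 'k" where
  "binary_quadratic h z t = h 0 * z ^ 2 + h 1 * z * t + h 2 * t ^ 2"

definition binary_linear :: "(nat \<Rightarrow> 'k::comm_ring_1) \<Rightarrow> 'k \<Rightarrow> 'k \<Rightarrow> 'k" where
  "binary_linear c z t = c 0 * z + c 1 * t"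

lemmas binary_form_defs = binary_cubic_def binary_quadratic_def binary_linear_def

lemma binary_form_homogeneous:
  "binary_cubic a (k * z) (k * t) = k ^ 3 * binary_cubic a z t"
  "binary_quadratic h (k * z) (k * t) = k ^ 2 * binary_quadratic h z t"
  "binary_linear c (k * z) (k * t) = k * binary_linear c z t"
  by (simp_all add: binary_form_defs algebra_simps power2_eq_square power3_eq_cube)

lemma ternary_cubic_root_at_infinity:
  fixes \<kappa> :: "nat \<Rightarrow> nat \<Rightarrow> 'k::alg_closed_field"
  obtains \<alpha> \<beta> where "(\<alpha>, \<beta>) \<noteq> (0, 0)" "ternary_cubic \<kappa> 0 \<alpha> \<beta> = 0"
proof (cases "\<kappa> 3 0 = 0")
  case True
  then have "ternary_cubic \<kappa> 0 1 0 = 0" by (simp add: ternary_cubic_def)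
  then show thesis using that[of 1 0] by simp
next
  case False
  let ?p = "[:\<kappa> 0 3, \<kappa> 1 2, \<kappa> 2 1, \<kappa> 3 0:]"
  have "degree ?p > 0" using False by simp
  then obtain x where "poly ?p x = 0" using alg_closed_imp_poly_has_root by blast
  then have "ternary_cubic \<kappa> 0 x 1 = 0"
    by (simp add: ternary_cubic_def power2_eq_square power3_eq_cube algebra_simps)
  then show thesis using that[of x 1] by simp
qed

text \<open>
  A multiple root \<open>(y, w)\<close> of the cubic on the line at infinity \<open>x\<^sub>2 = 0\<close> would give the further
  singular point \<open>(1, - \<partial>f/\<partial>x\<^sub>2, 0, y, w)\<close>.
\<close>

lemma simple_roots_at_infinity:
  fixes f :: "'k::field mpoly"
  assumes "f \<in> forms {2, 3, 4} 3" "card (sing_locus 5 (cubic f)) = 2"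
    and "ternary_cubic (cubic_coeff f) 0 y w = 0"
    and "ternary_cubic_y (cubic_coeff f) 0 y w = 0" "ternary_cubic_w (cubic_coeff f) 0 y w = 0"
  shows "y = 0 \<and> w = 0"
  using no_further_singular_points[OF assms(1,2), of 1 "- ternary_cubic_x (cubic_coeff f) 0 y w" 0 y w]
    assms(3-5) by simp

text \<open>
  A root \<open>(\<alpha>, \<beta>)\<close> of the cubic at infinity is moved to \<open>(z, t, s) = (0, 0, 1)\<close>.  Vanishing there
  removes the term in \<open>s\<^sup>3\<close>, so the cubic becomes quadratic in \<open>s\<close>: this is the projection from
  the plane \<open>z = t = 0\<close> contained in the threefold, whose fibres are quadric surfaces.  At infinity
  the cubic reads \<open>t (a\<^sub>3 t\<^sup>2 + 2 h\<^sub>2 t s + c\<^sub>1 s\<^sup>2)\<close>; simplicity of its roots yields both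
  inequations, the second one being the discriminant of the second factor.
\<close>

lemma cubic_normal_form:
  fixes f :: "'k::{alg_closed_field, field_char_0} mpoly"
  assumes f: "f \<in> forms {2, 3, 4} 3" and card: "card (sing_locus 5 (cubic f)) = 2"
  obtains \<alpha> \<beta> \<gamma> \<delta> a h c where "\<beta> * \<gamma> - \<alpha> * \<delta> = 1" "c 1 \<noteq> 0" "h 2 ^ 2 \<noteq> a 3 * c 1"
    "\<And>z t s. ternary_cubic (cubic_coeff f) z (\<gamma> * t + \<alpha> * s) (\<delta> * t + \<beta> * s)
       = binary_cubic a z t + 2 * binary_quadratic h z t * s + binary_linear c z t * s ^ 2"
proof -
  let ?\<kappa> = "cubic_coeff f"
  obtain \<alpha> \<beta> where root: "(\<alpha>, \<beta>) \<noteq> (0, 0)" "ternary_cubic ?\<kappa> 0 \<alpha> \<beta> = 0"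
    by (rule ternary_cubic_root_at_infinity)
  obtain \<gamma> \<delta> where det: "\<beta> * \<gamma> - \<alpha> * \<delta> = 1"
  proof (cases "\<beta> = 0")
    case True then show thesis using root(1) that[of 0 "- inverse \<alpha>"] by simp
  next
    case False then show thesis using that[of "inverse \<beta>" 0] by simp
  qed
  define a where "a = (\<lambda>_::nat. 0 :: 'k)(0 := ?\<kappa> 0 0, 1 := ?\<kappa> 1 0 * \<gamma> + ?\<kappa> 0 1 * \<delta>,
     2 := ?\<kappa> 2 0 * \<gamma> ^ 2 + ?\<kappa> 1 1 * \<gamma> * \<delta> + ?\<kappa> 0 2 * \<delta> ^ 2,
     3 := ?\<kappa> 3 0 * \<gamma> ^ 3 + ?\<kappa> 2 1 * \<gamma> ^ 2 * \<delta> + ?\<kappa> 1 2 * \<gamma> * \<delta> ^ 2 + ?\<kappa> 0 3 * \<delta> ^ 3)"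
  define h where "h = (\<lambda>_::nat. 0 :: 'k)(0 := (?\<kappa> 1 0 * \<alpha> + ?\<kappa> 0 1 * \<beta>) / 2,
     1 := (2 * ?\<kappa> 2 0 * \<alpha> * \<gamma> + ?\<kappa> 1 1 * (\<alpha> * \<delta> + \<beta> * \<gamma>) + 2 * ?\<kappa> 0 2 * \<beta> * \<delta>) / 2,
     2 := (3 * ?\<kappa> 3 0 * \<alpha> * \<gamma> ^ 2 + ?\<kappa> 2 1 * (2 * \<alpha> * \<gamma> * \<delta> + \<beta> * \<gamma> ^ 2)
       + ?\<kappa> 1 2 * (\<alpha> * \<delta> ^ 2 + 2 * \<beta> * \<gamma> * \<delta>) + 3 * ?\<kappa> 0 3 * \<beta> * \<delta> ^ 2) / 2)"
  define c where "c = (\<lambda>_::nat. 0 :: 'k)(0 := ?\<kappa> 2 0 * \<alpha> ^ 2 + ?\<kappa> 1 1 * \<alpha> * \<beta> + ?\<kappa> 0 2 * \<beta> ^ 2,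
     1 := 3 * ?\<kappa> 3 0 * \<alpha> ^ 2 * \<gamma> + ?\<kappa> 2 1 * (2 * \<alpha> * \<beta> * \<gamma> + \<alpha> ^ 2 * \<delta>)
       + ?\<kappa> 1 2 * (\<beta> ^ 2 * \<gamma> + 2 * \<alpha> * \<beta> * \<delta>) + 3 * ?\<kappa> 0 3 * \<beta> ^ 2 * \<delta>)"
  have a: "a 0 = ?\<kappa> 0 0" "a 1 = ?\<kappa> 1 0 * \<gamma> + ?\<kappa> 0 1 * \<delta>"
     "a 2 = ?\<kappa> 2 0 * \<gamma> ^ 2 + ?\<kappa> 1 1 * \<gamma> * \<delta> + ?\<kappa> 0 2 * \<delta> ^ 2"
     "a 3 = ?\<kappa> 3 0 * \<gamma> ^ 3 + ?\<kappa> 2 1 * \<gamma> ^ 2 * \<delta> + ?\<kappa> 1 2 * \<gamma> * \<delta> ^ 2 + ?\<kappa> 0 3 * \<delta> ^ 3"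
    by (simp_all add: a_def)
  have h: "2 * h 0 = ?\<kappa> 1 0 * \<alpha> + ?\<kappa> 0 1 * \<beta>"
     "2 * h 1 = 2 * ?\<kappa> 2 0 * \<alpha> * \<gamma> + ?\<kappa> 1 1 * (\<alpha> * \<delta> + \<beta> * \<gamma>) + 2 * ?\<kappa> 0 2 * \<beta> * \<delta>"
     "2 * h 2 = 3 * ?\<kappa> 3 0 * \<alpha> * \<gamma> ^ 2 + ?\<kappa> 2 1 * (2 * \<alpha> * \<gamma> * \<delta> + \<beta> * \<gamma> ^ 2)
       + ?\<kappa> 1 2 * (\<alpha> * \<delta> ^ 2 + 2 * \<beta> * \<gamma> * \<delta>) + 3 * ?\<kappa> 0 3 * \<beta> * \<delta> ^ 2"
    by (simp_all add: h_def)
  have c: "c 0 = ?\<kappa> 2 0 * \<alpha> ^ 2 + ?\<kappa> 1 1 * \<alpha> * \<beta> + ?\<kappa> 0 2 * \<beta> ^ 2"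
     "c 1 = 3 * ?\<kappa> 3 0 * \<alpha> ^ 2 * \<gamma> + ?\<kappa> 2 1 * (2 * \<alpha> * \<beta> * \<gamma> + \<alpha> ^ 2 * \<delta>)
       + ?\<kappa> 1 2 * (\<beta> ^ 2 * \<gamma> + 2 * \<alpha> * \<beta> * \<delta>) + 3 * ?\<kappa> 0 3 * \<beta> ^ 2 * \<delta>"
    by (simp_all add: c_def)
  have root': "?\<kappa> 3 0 * \<alpha> ^ 3 + ?\<kappa> 2 1 * \<alpha> ^ 2 * \<beta> + ?\<kappa> 1 2 * \<alpha> * \<beta> ^ 2 + ?\<kappa> 0 3 * \<beta> ^ 3 = 0"
    using root(2) by (simp add: ternary_cubic_def)
  have expand: "ternary_cubic ?\<kappa> z (\<gamma> * t + \<alpha> * s) (\<delta> * t + \<beta> * s)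
      = binary_cubic a z t + 2 * binary_quadratic h z t * s + binary_linear c z t * s ^ 2" for z t s
  proof -
    have twice: "2 * binary_quadratic h z t = (2 * h 0) * z ^ 2 + (2 * h 1) * z * t + (2 * h 2) * t ^ 2"
      by (simp add: binary_quadratic_def algebra_simps)
    have "binary_cubic a z t + 2 * binary_quadratic h z t * s + binary_linear c z t * s ^ 2
      + (?\<kappa> 3 0 * \<alpha> ^ 3 + ?\<kappa> 2 1 * \<alpha> ^ 2 * \<beta> + ?\<kappa> 1 2 * \<alpha> * \<beta> ^ 2 + ?\<kappa> 0 3 * \<beta> ^ 3) * s ^ 3
      = ternary_cubic ?\<kappa> z (\<gamma> * t + \<alpha> * s) (\<delta> * t + \<beta> * s)"
      unfolding ternary_cubic_def binary_cubic_def binary_linear_def twice a c h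
      by (simp add: power2_eq_square power3_eq_cube algebra_simps)
    then show ?thesis unfolding root' by simp
  qed
  have deriv_s: "\<alpha> * ternary_cubic_y ?\<kappa> 0 (\<gamma> * t + \<alpha> * s) (\<delta> * t + \<beta> * s)
      + \<beta> * ternary_cubic_w ?\<kappa> 0 (\<gamma> * t + \<alpha> * s) (\<delta> * t + \<beta> * s) = 2 * h 2 * t ^ 2 + 2 * c 1 * t * s" for t s
  proof -
    have "\<alpha> * ternary_cubic_y ?\<kappa> 0 (\<gamma> * t + \<alpha> * s) (\<delta> * t + \<beta> * s)
      + \<beta> * ternary_cubic_w ?\<kappa> 0 (\<gamma> * t + \<alpha> * s) (\<delta> * t + \<beta> * s) = 2 * h 2 * t ^ 2 + 2 * c 1 * t * s
      + 3 * (?\<kappa> 3 0 * \<alpha> ^ 3 + ?\<kappa> 2 1 * \<alpha> ^ 2 * \<beta> + ?\<kappa> 1 2 * \<alpha> * \<beta> ^ 2 + ?\<kappa> 0 3 * \<beta> ^ 3) * s ^ 2"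
      unfolding ternary_cubic_defs c h
      by (simp add: power2_eq_square power3_eq_cube algebra_simps)
    then show ?thesis unfolding root' by simp
  qed
  have deriv_t: "\<gamma> * ternary_cubic_y ?\<kappa> 0 (\<gamma> * t + \<alpha> * s) (\<delta> * t + \<beta> * s)
      + \<delta> * ternary_cubic_w ?\<kappa> 0 (\<gamma> * t + \<alpha> * s) (\<delta> * t + \<beta> * s)
      = 3 * a 3 * t ^ 2 + 4 * h 2 * t * s + c 1 * s ^ 2" for t s
  proof -
    have "4 * h 2 = 2 * (2 * h 2)" by simp
    then show ?thesis
      unfolding ternary_cubic_defs a c h
      by (simp add: power2_eq_square power3_eq_cube algebra_simps)
  qed
  have simple: "t = 0 \<and> s = 0"
    if "a 3 * t ^ 3 + 2 * h 2 * t ^ 2 * s + c 1 * t * s ^ 2 = 0" "2 * h 2 * t ^ 2 + 2 * c 1 * t * s = 0"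
      "3 * a 3 * t ^ 2 + 4 * h 2 * t * s + c 1 * s ^ 2 = 0" for t s
  proof -
    let ?y = "\<gamma> * t + \<alpha> * s" and ?w = "\<delta> * t + \<beta> * s"
    have root_ts: "ternary_cubic ?\<kappa> 0 ?y ?w = 0"
      unfolding expand using that(1) by (simp add: binary_form_defs mult.assoc)
    have deriv: "\<alpha> * ternary_cubic_y ?\<kappa> 0 ?y ?w + \<beta> * ternary_cubic_w ?\<kappa> 0 ?y ?w = 0"
      "\<gamma> * ternary_cubic_y ?\<kappa> 0 ?y ?w + \<delta> * ternary_cubic_w ?\<kappa> 0 ?y ?w = 0"
      unfolding deriv_s deriv_t using that by auto
    have "p = 0 \<and> q = 0" if "\<alpha> * p + \<beta> * q = 0" "\<gamma> * p + \<delta> * q = 0" for p q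
    proof -
      have "(\<beta> * \<gamma> - \<alpha> * \<delta>) * p = \<beta> * (\<gamma> * p + \<delta> * q) - \<delta> * (\<alpha> * p + \<beta> * q)"
        "(\<beta> * \<gamma> - \<alpha> * \<delta>) * q = \<gamma> * (\<alpha> * p + \<beta> * q) - \<alpha> * (\<gamma> * p + \<delta> * q)"
        by (simp_all only: algebra_simps)
      then show ?thesis unfolding that det by simp
    qed
    from this[OF deriv] have "ternary_cubic_y ?\<kappa> 0 ?y ?w = 0" "ternary_cubic_w ?\<kappa> 0 ?y ?w = 0" by auto
    then have yw: "?y = 0 \<and> ?w = 0" by (rule simple_roots_at_infinity[OF f card root_ts])
    have "(\<beta> * \<gamma> - \<alpha> * \<delta>) * t = \<beta> * ?y - \<alpha> * ?w" "(\<beta> * \<gamma> - \<alpha> * \<delta>) * s = \<gamma> * ?w - \<delta> * ?y"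
      by (simp_all only: algebra_simps)
    then show ?thesis unfolding det yw[THEN conjunct1] yw[THEN conjunct2] by simp
  qed
  have c1: "c 1 \<noteq> 0" using simple[of 0 1] by auto
  have "h 2 ^ 2 \<noteq> a 3 * c 1"
  proof
    assume disc: "h 2 ^ 2 = a 3 * c 1"
    \<comment> \<open>With vanishing discriminant, \<open>(c\<^sub>1, - h\<^sub>2)\<close> is the double root of the quadratic factor.\<close>
    have "a 3 * c 1 ^ 3 + 2 * h 2 * c 1 ^ 2 * (- h 2) + c 1 * c 1 * (- h 2) ^ 2
        = c 1 ^ 2 * (a 3 * c 1 - h 2 ^ 2)"
      "3 * a 3 * c 1 ^ 2 + 4 * h 2 * c 1 * (- h 2) + c 1 * (- h 2) ^ 2
        = 3 * c 1 * (a 3 * c 1 - h 2 ^ 2)"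
      by (simp_all add: power2_eq_square power3_eq_cube algebra_simps)
    then have "c 1 = 0 \<and> - h 2 = 0"
      unfolding disc by (intro simple) (simp_all add: power2_eq_square algebra_simps)
    then show False using c1 by simp
  qed
  with det c1 expand show thesis by (intro that[of \<beta> \<gamma> \<alpha> \<delta> c h a])
qed

lemma form_fun_binary_linear:
  "form_fun n d p \<Longrightarrow> form_fun n d q \<Longrightarrow> form_fun n d (\<lambda>v. binary_linear c (p v) (q v))"
  unfolding binary_linear_def by (intro form_fun_add form_fun_scale)

lemma form_fun_binary_quadratic:
  assumes "form_fun n d p" "form_fun n d q" "d + d = k"
  shows "form_fun n k (\<lambda>v. binary_quadratic h (p v) (q v))"
proof -
  have "form_fun n k (\<lambda>v. p v ^ 2)" "form_fun n k (\<lambda>v. p v * q v)" "form_fun n k (\<lambda>v. q v ^ 2)"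
    using form_fun_power_eq[OF assms(1), of 2 k] form_fun_mult_eq[OF assms]
      form_fun_power_eq[OF assms(2), of 2 k] assms(3) by auto
  then show ?thesis
    unfolding binary_quadratic_def mult.assoc by (intro form_fun_add form_fun_scale)
qed

text \<open>
  Since \<open>c\<^sub>1\<close> is nonzero, \<open>z\<close> and \<open>C = c\<^sub>0 z + c\<^sub>1 t\<close> are coordinates as good as \<open>(z, t)\<close>, and in them
  the discriminant is a binary quartic.  Its representation as a norm from the extension of
  \<open>k(t/z)\<close> by a square root of \<open>- z C\<close> is the case of Tsen's theorem that provides an invariant
  rational point on the generic fibre.
\<close>

lemma discriminant_is_norm:
  fixes a h c :: "nat \<Rightarrow> 'k::{alg_closed_field, field_char_0}"
  assumes "c 1 \<noteq> 0"
  obtains y u where "\<And>z t. binary_quadratic h z t ^ 2 - binary_cubic a z t * binary_linear c z t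
      = binary_quadratic y z (binary_linear c z t) ^ 2
        + z * binary_linear c z t * binary_linear u z (binary_linear c z t) ^ 2"
proof -
  \<comment> \<open>Inverting \<open>x = c\<^sub>0 z + c\<^sub>1 t\<close> gives \<open>t = p x + q z\<close>; \<open>H\<close> and \<open>A\<close> are \<open>h\<close> and \<open>a\<close> in \<open>(z, x)\<close>.\<close>
  define p q where "p = 1 / c 1" and "q = - c 0 / c 1"
  define H where "H = (\<lambda>_::nat. 0 :: 'k)(0 := h 0 + h 1 * q + h 2 * q ^ 2, 1 := h 1 * p + 2 * h 2 * p * q,
    2 := h 2 * p ^ 2)"
  define A where "A = (\<lambda>_::nat. 0 :: 'k)(0 := a 0 + a 1 * q + a 2 * q ^ 2 + a 3 * q ^ 3,
    1 := p * (a 1 + 2 * a 2 * q + 3 * a 3 * q ^ 2), 2 := p ^ 2 * (a 2 + 3 * a 3 * q), 3 := a 3 * p ^ 3)"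
  define d where "d = (\<lambda>_::nat. 0 :: 'k)(0 := H 0 ^ 2, 1 := 2 * H 0 * H 1 - A 0,
    2 := H 1 ^ 2 + 2 * H 0 * H 2 - A 1, 3 := 2 * H 1 * H 2 - A 2, 4 := H 2 ^ 2 - A 3)"
  have H: "binary_quadratic h z (p * x + q * z) = binary_quadratic H z x" for z x
    by (simp add: binary_quadratic_def H_def power2_eq_square algebra_simps)
  have A: "binary_cubic a z (p * x + q * z) = binary_cubic A z x" for z x
    by (simp add: binary_cubic_def A_def power2_eq_square power3_eq_cube algebra_simps)
  have d: "binary_quadratic H z x ^ 2 - binary_cubic A z x * x
      = d 0 * z ^ 4 + d 1 * z ^ 3 * x + d 2 * z ^ 2 * x ^ 2 + d 3 * z * x ^ 3 + d 4 * x ^ 4" for z x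
    by (simp add: binary_quadratic_def binary_cubic_def d_def eval_nat_numeral algebra_simps)
  obtain y\<^sub>0 y\<^sub>1 y\<^sub>2 u\<^sub>0 u\<^sub>1 where yu:
    "\<And>z c. d 0 * z ^ 4 + d 1 * z ^ 3 * c + d 2 * z ^ 2 * c ^ 2 + d 3 * z * c ^ 3 + d 4 * c ^ 4
       = (y\<^sub>0 * z ^ 2 + y\<^sub>1 * z * c + y\<^sub>2 * c ^ 2) ^ 2 + z * c * (u\<^sub>0 * z + u\<^sub>1 * c) ^ 2"
    using binary_quartic_is_norm[of d] by blast
  define y u where "y = (\<lambda>_::nat. 0)(0 := y\<^sub>0, 1 := y\<^sub>1, 2 := y\<^sub>2)" and "u = (\<lambda>_::nat. 0)(0 := u\<^sub>0, 1 := u\<^sub>1)"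
  have y: "binary_quadratic y z x = y\<^sub>0 * z ^ 2 + y\<^sub>1 * z * x + y\<^sub>2 * x ^ 2"
    and u: "binary_linear u z x = u\<^sub>0 * z + u\<^sub>1 * x" for z x
    by (simp_all add: y_def u_def binary_quadratic_def binary_linear_def)
  show thesis
  proof (rule that)
    fix z t
    have t: "p * binary_linear c z t + q * z = t"
      using assms by (simp add: p_def q_def binary_linear_def field_simps)
    show "binary_quadratic h z t ^ 2 - binary_cubic a z t * binary_linear c z t
        = binary_quadratic y z (binary_linear c z t) ^ 2
          + z * binary_linear c z t * binary_linear u z (binary_linear c z t) ^ 2"
      using d[of z "binary_linear c z t"] unfolding yu y u by (simp flip: H A add: t)
  qed
qed


section \<open>Projection of the quadrics from an invariant section\<close>

text \<open>
  The normal form of the cubic together with a norm representation of its discriminant.  The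
  number \<open>r\<close> is a square root of the parameter \<open>a\<close> of the torus element: rescaling by it turns the
  action into the exchange of two coordinates.
\<close>

locale quadric_family =
  fixes f :: "'k::{alg_closed_field, field_char_0} mpoly" and r \<alpha> \<beta> \<gamma> \<delta> :: 'k and a h c y u :: "nat \<Rightarrow> 'k"
  assumes form: "f \<in> forms {2, 3, 4} 3" and r: "r \<noteq> 0" and det: "\<beta> * \<gamma> - \<alpha> * \<delta> = 1"
    and c1: "c 1 \<noteq> 0" and disc: "h 2 ^ 2 \<noteq> a 3 * c 1"
    and expand: "\<And>z t s. ternary_cubic (cubic_coeff f) z (\<gamma> * t + \<alpha> * s) (\<delta> * t + \<beta> * s)
       = binary_cubic a z t + 2 * binary_quadratic h z t * s + binary_linear c z t * s ^ 2"
    and norm: "\<And>z t. binary_quadratic h z t ^ 2 - binary_cubic a z t * binary_linear c z t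
       = binary_quadratic y z (binary_linear c z t) ^ 2
         + z * binary_linear c z t * binary_linear u z (binary_linear c z t) ^ 2"
begin

abbreviation "H \<equiv> binary_quadratic h"
abbreviation "C \<equiv> binary_linear c"

definition Y where "Y z t = binary_quadratic y z (C z t)"
definition U where "U z t = binary_linear u z (C z t)"
definition Q where "Q z t s = binary_cubic a z t + 2 * H z t * s + C z t * s ^ 2"

lemma norm_eq: "H z t ^ 2 - binary_cubic a z t * C z t = Y z t ^ 2 + z * C z t * U z t ^ 2"
  unfolding Y_def U_def by (rule norm)

lemma homogeneous:
  "H (k * z) (k * t) = k ^ 2 * H z t" "C (k * z) (k * t) = k * C z t"
  "Y (k * z) (k * t) = k ^ 2 * Y z t" "U (k * z) (k * t) = k * U z t"
  by (simp_all add: Y_def U_def binary_form_homogeneous)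

lemma Q_homogeneous: "Q (k * z) (k * t) (k * s) = k ^ 3 * Q z t s"
  by (simp add: Q_def binary_form_homogeneous algebra_simps power2_eq_square power3_eq_cube)

subsection \<open>Adapted coordinates\<close>

text \<open>
  The coordinates \<open>(z, t, s)\<close> replace \<open>(x\<^sub>2, x\<^sub>3, x\<^sub>4)\<close>, and \<open>(p, q)\<close> replaces \<open>(x\<^sub>0, x\<^sub>1)\<close> with
  \<open>x\<^sub>0 x\<^sub>1 = p\<^sup>2 - q\<^sup>2\<close>; the action only changes the sign of \<open>q\<close>.  The functions \<open>ct\<close>, \<open>cs\<close>, \<open>cp\<close>,
  \<open>cq\<close> read these coordinates off a vector.
\<close>

definition point where
  "point x\<^sub>0 x\<^sub>1 z t s = quint x\<^sub>0 x\<^sub>1 z (\<gamma> * t + \<alpha> * s) (\<delta> * t + \<beta> * s)"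

definition ct where "ct v = \<beta> * v $ 3 - \<alpha> * v $ 4"
definition cs where "cs v = \<gamma> * v $ 4 - \<delta> * v $ 3"
definition cp where "cp v = (r * v $ 0 + v $ 1 / r) / 2"
definition cq where "cq v = (r * v $ 0 - v $ 1 / r) / 2"

lemma point_carrier [simp]: "point x\<^sub>0 x\<^sub>1 z t s \<in> carrier_vec 5"
  by (simp add: point_def)

lemma point_nth [simp]:
  "point x\<^sub>0 x\<^sub>1 z t s $ 0 = x\<^sub>0" "point x\<^sub>0 x\<^sub>1 z t s $ Suc 0 = x\<^sub>1" "point x\<^sub>0 x\<^sub>1 z t s $ 2 = z"
  by (simp_all add: point_def)

lemma point_ct [simp]: "ct (point x\<^sub>0 x\<^sub>1 z t s) = t"
proof -
  have "ct (point x\<^sub>0 x\<^sub>1 z t s) = (\<beta> * \<gamma> - \<alpha> * \<delta>) * t"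
    by (simp add: ct_def point_def algebra_simps)
  then show ?thesis by (simp add: det)
qed

lemma point_cs [simp]: "cs (point x\<^sub>0 x\<^sub>1 z t s) = s"
proof -
  have "cs (point x\<^sub>0 x\<^sub>1 z t s) = (\<beta> * \<gamma> - \<alpha> * \<delta>) * s"
    by (simp add: cs_def point_def algebra_simps)
  then show ?thesis by (simp add: det)
qed

lemma point_of_vec:
  assumes "v \<in> carrier_vec 5"
  shows "v = point (v $ 0) (v $ Suc 0) (v $ 2) (ct v) (cs v)"
proof (rule vec5_eqI)
  have "\<gamma> * ct v + \<alpha> * cs v = (\<beta> * \<gamma> - \<alpha> * \<delta>) * v $ 3" "\<delta> * ct v + \<beta> * cs v = (\<beta> * \<gamma> - \<alpha> * \<delta>) * v $ 4"
    by (simp_all only: ct_def cs_def algebra_simps)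
  then show "v $ 3 = point (v $ 0) (v $ Suc 0) (v $ 2) (ct v) (cs v) $ 3"
    "v $ 4 = point (v $ 0) (v $ Suc 0) (v $ 2) (ct v) (cs v) $ 4"
    by (simp_all add: point_def det)
qed (use assms in auto)

lemma point_smult: "k \<cdot>\<^sub>v point x\<^sub>0 x\<^sub>1 z t s = point (k * x\<^sub>0) (k * x\<^sub>1) (k * z) (k * t) (k * s)"
  by (simp add: point_def quint_smult algebra_simps)

lemma point_eq_zero_iff: "point x\<^sub>0 x\<^sub>1 z t s = 0\<^sub>v 5 \<longleftrightarrow> x\<^sub>0 = 0 \<and> x\<^sub>1 = 0 \<and> z = 0 \<and> t = 0 \<and> s = 0"
proof
  assume zero: "point x\<^sub>0 x\<^sub>1 z t s = 0\<^sub>v 5"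
  have "t = ct (0\<^sub>v 5)" "s = cs (0\<^sub>v 5)" by (simp_all flip: zero)
  moreover have "x\<^sub>0 = 0 \<and> x\<^sub>1 = 0 \<and> z = 0"
    using zero unfolding point_def quint_eq_zero_iff by blast
  ultimately show "x\<^sub>0 = 0 \<and> x\<^sub>1 = 0 \<and> z = 0 \<and> t = 0 \<and> s = 0" by (simp add: ct_def cs_def)
qed (simp add: point_def quint_eq_zero_iff)

lemma eval_at_point: "eval_at (point x\<^sub>0 x\<^sub>1 z t s) (cubic f) = x\<^sub>0 * x\<^sub>1 * z + Q z t s"
  by (simp add: eval_at_cubic eval_at_ternary[OF form] point_def expand Q_def)

definition from_coords where
  "from_coords p q z t s = point ((p + q) / r) (r * (p - q)) z t s"

lemma from_coords_carrier [simp]: "from_coords p q z t s \<in> carrier_vec 5"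
  by (simp add: from_coords_def)

lemma from_coords_nth [simp]:
  "cp (from_coords p q z t s) = p" "cq (from_coords p q z t s) = q"
  "from_coords p q z t s $ 2 = z" "ct (from_coords p q z t s) = t" "cs (from_coords p q z t s) = s"
  using r by (simp_all add: from_coords_def cp_def cq_def field_simps)

lemma from_coords_smult:
  "k \<cdot>\<^sub>v from_coords p q z t s = from_coords (k * p) (k * q) (k * z) (k * t) (k * s)"
  by (simp add: from_coords_def point_smult algebra_simps)

lemma from_coords_of_vec:
  assumes "v \<in> carrier_vec 5"
  shows "v = from_coords (cp v) (cq v) (v $ 2) (ct v) (cs v)"
proof -
  have "(cp v + cq v) / r = v $ 0" "r * (cp v - cq v) = v $ Suc 0"
    using r by (simp_all add: cp_def cq_def field_simps)
  then show ?thesis unfolding from_coords_def using point_of_vec[OF assms] by simp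
qed

lemma eval_at_from_coords:
  "eval_at (from_coords p q z t s) (cubic f) = z * (p ^ 2 - q ^ 2) + Q z t s"
proof -
  have "(p + q) / r * (r * (p - q)) = (p + q) * (p - q)" using r by simp
  also have "\<dots> = p ^ 2 - q ^ 2" by (simp add: power2_eq_square algebra_simps)
  finally have "(p + q) / r * (r * (p - q)) = p ^ 2 - q ^ 2" .
  then show ?thesis unfolding from_coords_def eval_at_point by simp
qed

subsection \<open>The projection and its inverse\<close>

text \<open>
  Multiplied by \<open>C\<close>, the equation of the cubic becomes, by completing the square,
  \<open>z C (p\<^sup>2 - q\<^sup>2) + (C s + H)\<^sup>2 = Y\<^sup>2 + z C U\<^sup>2\<close>.
  Over \<open>k(t/z)\<close> this is a quadric with the rational point \<open>p = U\<close>, \<open>q = 0\<close>, \<open>C s + H = Y\<close>, fixed by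
  the sign change of \<open>q\<close>.  In the differences \<open>P = p - U\<close> and \<open>R = C s + H - Y\<close> it reads
  \<open>z C P (P + 2 U) + R (R + 2 Y) = z C q\<^sup>2\<close>, and projection from the point is \<open>[P : R : q]\<close>.  With
  the base coordinate \<open>[z : t]\<close> this gives the map \<open>\<Phi>\<close> to \<open>[z : t : R/P : z q/P]\<close>, where the
  factor \<open>z\<close> makes all entries homogeneous of degree 2 after clearing \<open>P\<close>.

  Conversely, given \<open>[z : t : m : n]\<close>, the points \<open>P = \<mu>\<close>, \<open>R = \<mu> m\<close>, \<open>q = \<mu> n/z\<close> form a line
  through the rational point.  It meets the quadric once more, where \<open>\<mu> E = z M\<close>; substituting
  and clearing the denominators \<open>E\<close> and \<open>C\<close> gives \<open>\<Psi>\<close>.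
\<close>

definition P where "P v = cp v - U (v $ 2) (ct v)"
definition R where "R v = C (v $ 2) (ct v) * cs v + H (v $ 2) (ct v) - Y (v $ 2) (ct v)"
definition K where
  "K v = - 2 * (v $ 2 * C (v $ 2) (ct v) * P v * U (v $ 2) (ct v) + R v * Y (v $ 2) (ct v))"

definition \<Phi> where "\<Phi> v = quad (P v * v $ 2) (P v * ct v) (R v) (v $ 2 * cq v)"
definition \<Phi>_factor where "\<Phi>_factor v = P v ^ 3 * (v $ 2 * C (v $ 2) (ct v)) * K v"

definition E where "E z t m n = z ^ 2 * C z t + z * m ^ 2 - C z t * n ^ 2"
definition M where "M z t m = - 2 * (z * C z t * U z t + m * Y z t)"

definition \<Psi>_coords where
  "\<Psi>_coords z t m n =
     from_coords (C z t * (E z t m n * U z t + z * M z t m)) (C z t * n * M z t m)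
       (E z t m n * C z t * z) (E z t m n * C z t * t)
       (m * z * M z t m + (Y z t - H z t) * E z t m n)"

definition \<Psi> where "\<Psi> w = \<Psi>_coords (w $ 0) (w $ Suc 0) (w $ 2) (w $ 3)"
definition \<Psi>_factor where
  "\<Psi>_factor w = E (w $ 0) (w $ Suc 0) (w $ 2) (w $ 3) * C (w $ 0) (w $ Suc 0) ^ 2
     * (w $ 0 * M (w $ 0) (w $ Suc 0) (w $ 2))"

lemma \<Psi>_carrier [simp]: "\<Psi> w \<in> carrier_vec 5"
  by (simp add: \<Psi>_def \<Psi>_coords_def)

lemma \<Phi>_carrier [simp]: "\<Phi> v \<in> carrier_vec 4"
  by (simp add: \<Phi>_def)

lemma completed_square:
  "C z t * (z * (p ^ 2 - q ^ 2) + Q z t s)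
     = z * C z t * (p ^ 2 - q ^ 2) + (C z t * s + H z t) ^ 2 - (Y z t ^ 2 + z * C z t * U z t ^ 2)"
  unfolding norm_eq[symmetric] Q_def by (simp add: power2_eq_square algebra_simps)

text \<open>
  The equation in the form \<open>key\<close> below is what allows \<open>E\<close>, taken at \<open>\<Phi> v\<close>, to split off the
  factor \<open>K\<close> that it shares with \<open>M\<close>.
\<close>

lemma \<Psi>_\<Phi>:
  assumes v: "v \<in> carrier_vec 5" and eq: "eval_at v (cubic f) = 0"
  shows "\<Psi> (\<Phi> v) = \<Phi>_factor v \<cdot>\<^sub>v v"
proof -
  define z t s p q where "z = v $ 2" and "t = ct v" and "s = cs v" and "p = cp v" and "q = cq v"
  define P' R' K' where "P' = P v" and "R' = R v" and "K' = K v"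
  let ?C = "C z t" and ?Y = "Y z t" and ?U = "U z t" and ?H = "H z t"
  note coords = z_def[symmetric] t_def[symmetric] s_def[symmetric] p_def[symmetric] q_def[symmetric]
    P'_def[symmetric] R'_def[symmetric] K'_def[symmetric]
  have p: "p = P' + ?U" and R: "?C * s = R' + ?Y - ?H" and K: "K' = - 2 * (z * ?C * P' * ?U + R' * ?Y)"
    by (simp_all add: P_def R_def K_def P'_def R'_def K'_def z_def t_def s_def p_def)
  have v_eq: "v = from_coords p q z t s"
    using from_coords_of_vec[OF v] by (simp add: coords)
  have "z * ?C * (p ^ 2 - q ^ 2) + (?C * s + ?H) ^ 2 - (?Y ^ 2 + z * ?C * ?U ^ 2) = 0"
    using eq completed_square[of z t p q s] by (simp add: v_eq eval_at_from_coords)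
  then have key: "z * ?C * q ^ 2 = z * ?C * P' * (P' + 2 * ?U) + R' * (R' + 2 * ?Y)"
    unfolding p R by (simp add: power2_eq_square algebra_simps)
  have "E (P' * z) (P' * t) R' (z * q) = P' * z * (z * ?C * P' ^ 2 + R' ^ 2 - z * ?C * q ^ 2)"
    by (simp add: E_def homogeneous power2_eq_square algebra_simps)
  also have "\<dots> = P' * z * K'"
    unfolding key K by (simp add: power2_eq_square algebra_simps)
  finally have E: "E (P' * z) (P' * t) R' (z * q) = P' * z * K'" .
  have M: "M (P' * z) (P' * t) R' = P' ^ 2 * K'"
    unfolding K by (simp add: M_def homogeneous power2_eq_square algebra_simps)
  let ?k = "P' ^ 3 * (z * ?C) * K'"
  have last: "R' * (P' * z) * (P' ^ 2 * K') + (P' ^ 2 * ?Y - P' ^ 2 * ?H) * (P' * z * K') = ?k * s"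
  proof -
    have "?k * s = P' ^ 3 * z * K' * (?C * s)" by (simp add: algebra_simps)
    also have "\<dots> = R' * (P' * z) * (P' ^ 2 * K') + (P' ^ 2 * ?Y - P' ^ 2 * ?H) * (P' * z * K')"
      unfolding R by (simp add: power2_eq_square power3_eq_cube algebra_simps)
    finally show ?thesis ..
  qed
  have "\<Psi> (\<Phi> v) = \<Psi>_coords (P' * z) (P' * t) R' (z * q)"
    by (simp add: \<Psi>_def \<Phi>_def coords)
  also have "\<dots> = from_coords (?k * p) (?k * q) (?k * z) (?k * t) (?k * s)"
    unfolding \<Psi>_coords_def E M homogeneous last
    by (simp add: p power2_eq_square power3_eq_cube algebra_simps)
  also have "\<dots> = ?k \<cdot>\<^sub>v v" by (simp add: v_eq from_coords_smult)
  also have "?k = \<Phi>_factor v" by (simp add: \<Phi>_factor_def coords)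
  finally show ?thesis .
qed

text \<open>
  Multiplied by its coefficient \<open>C\<close>, the equation at \<open>\<Psi> w\<close> has the factor \<open>M E - E M\<close>.  Where this
  coefficient vanishes, so do \<open>z\<close> and \<open>t\<close>, and the point lies in the plane \<open>z = t = 0\<close> of the cubic.
\<close>

lemma \<Psi>_on_cubic: "eval_at (\<Psi> w) (cubic f) = 0"
proof -
  define z t m n where "z = w $ 0" and "t = w $ Suc 0" and "m = w $ 2" and "n = w $ 3"
  define e k where "e = E z t m n" and "k = M z t m"
  let ?C = "C z t" and ?Y = "Y z t" and ?U = "U z t" and ?H = "H z t"
  define p q z' t' s where "p = ?C * (e * ?U + z * k)" and "q = ?C * n * k"
    and "z' = e * ?C * z" and "t' = e * ?C * t" and "s = m * z * k + (?Y - ?H) * e"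
  have "\<Psi> w = from_coords p q z' t' s"
    by (simp add: \<Psi>_def \<Psi>_coords_def z_def t_def m_def n_def e_def k_def p_def q_def z'_def t'_def s_def)
  then have eval: "eval_at (\<Psi> w) (cubic f) = z' * (p ^ 2 - q ^ 2) + Q z' t' s"
    by (simp only: eval_at_from_coords)
  show ?thesis
  proof (cases "e * ?C = 0")
    case True
    then have "z' = 0" "t' = 0" by (simp_all only: z'_def t'_def mult_zero_left)
    then show ?thesis unfolding eval by (simp add: Q_def binary_form_defs)
  next
    case False
    have k: "2 * (z * ?C * ?U + m * ?Y) = - k" and e: "z ^ 2 * ?C + z * m ^ 2 - ?C * n ^ 2 = e"
      by (simp_all add: k_def e_def M_def E_def)
    have sum: "C z' t' * s + H z' t' = e * ?C ^ 2 * (m * z * k + ?Y * e)"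
      unfolding z'_def t'_def s_def homogeneous by (simp add: power2_eq_square algebra_simps)
    have "C z' t' * (z' * (p ^ 2 - q ^ 2) + Q z' t' s)
        = e ^ 2 * ?C ^ 4 * (z * k) * (k * (z ^ 2 * ?C + z * m ^ 2 - ?C * n ^ 2) + e * (2 * (z * ?C * ?U + m * ?Y)))"
      unfolding completed_square sum unfolding z'_def t'_def homogeneous p_def q_def
      by (simp add: eval_nat_numeral algebra_simps)
    also have "\<dots> = 0" unfolding e k by simp
    finally show ?thesis unfolding eval using False by (simp add: z'_def t'_def homogeneous)
  qed
qed

lemma \<Phi>_\<Psi>:
  assumes w: "w \<in> carrier_vec 4"
  shows "\<Phi> (\<Psi> w) = \<Psi>_factor w \<cdot>\<^sub>v w"
proof -
  define z t m n where "z = w $ 0" and "t = w $ Suc 0" and "m = w $ 2" and "n = w $ 3"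
  define e k where "e = E z t m n" and "k = M z t m"
  let ?C = "C z t" and ?Y = "Y z t" and ?U = "U z t" and ?H = "H z t"
  let ?v = "from_coords (?C * (e * ?U + z * k)) (?C * n * k) (e * ?C * z) (e * ?C * t)
       (m * z * k + (?Y - ?H) * e)"
  have "P ?v = ?C * z * k" "R ?v = e * ?C ^ 2 * z * k * m"
    unfolding P_def R_def from_coords_nth homogeneous
    by (simp_all add: power2_eq_square algebra_simps)
  then have "\<Phi> ?v = \<Psi>_factor w \<cdot>\<^sub>v w"
    using w unfolding \<Phi>_def \<Psi>_factor_def
    by (intro vec4_eqI)
      (simp_all add: z_def[symmetric] t_def[symmetric] m_def[symmetric] n_def[symmetric]
        e_def[symmetric] k_def[symmetric] power2_eq_square algebra_simps)
  then show ?thesis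
    by (simp add: \<Psi>_def \<Psi>_coords_def z_def t_def m_def n_def e_def k_def)
qed

subsection \<open>Degrees\<close>

lemma form_fun_coords:
  "form_fun 5 1 (\<lambda>v. v $ 2)" "form_fun 5 1 ct" "form_fun 5 1 cs" "form_fun 5 1 cp" "form_fun 5 1 cq"
proof -
  have coord: "form_fun 5 1 (\<lambda>v. v $ i)" if "i < 5" for i using that by (rule form_fun_coord)
  show "form_fun 5 1 (\<lambda>v. v $ 2)" by (rule coord) simp
  show "form_fun 5 1 ct" "form_fun 5 1 cs"
    unfolding ct_def cs_def by (intro form_fun_diff form_fun_scale coord; simp)+
  have "cp = (\<lambda>v. (r / 2) * v $ 0 + (1 / (2 * r)) * v $ 1)"
    "cq = (\<lambda>v. (r / 2) * v $ 0 - (1 / (2 * r)) * v $ 1)"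
    by (auto simp: cp_def cq_def field_simps)
  then show "form_fun 5 1 cp" "form_fun 5 1 cq"
    by (simp_all only:) (intro form_fun_diff form_fun_add form_fun_scale coord; simp)+
qed

lemma form_fun_coefficients:
  assumes "form_fun n 1 p" "form_fun n 1 q"
  shows "form_fun n 1 (\<lambda>v. C (p v) (q v))" "form_fun n 1 (\<lambda>v. U (p v) (q v))"
    "form_fun n 2 (\<lambda>v. Y (p v) (q v))" "form_fun n 2 (\<lambda>v. H (p v) (q v))"
  unfolding U_def Y_def using assms
  by (auto intro!: form_fun_binary_linear form_fun_binary_quadratic[where d = 1])

lemma form_fun_\<Phi>:
  shows "form_fun 5 1 P" "form_fun 5 2 R" "form_fun 5 4 K" "form_fun 5 9 \<Phi>_factor"
    and "j < 4 \<Longrightarrow> form_fun 5 2 (\<lambda>v. \<Phi> v $ j)"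
proof -
  note base = form_fun_coords form_fun_coefficients[OF form_fun_coords(1,2)]
  show P: "form_fun 5 1 P" unfolding P_def by (intro form_fun_diff base)
  show R: "form_fun 5 2 R"
    unfolding R_def
    by (intro form_fun_diff form_fun_add form_fun_mult_eq[where d = 1 and e = 1] base) simp
  have "form_fun 5 2 (\<lambda>v. v $ 2 * C (v $ 2) (ct v))"
    by (intro form_fun_mult_eq[where d = 1 and e = 1] base) simp
  note zC = this
  have "form_fun 5 3 (\<lambda>v. v $ 2 * C (v $ 2) (ct v) * P v)"
    by (rule form_fun_mult_eq[OF zC P]) simp
  then have "form_fun 5 4 (\<lambda>v. v $ 2 * C (v $ 2) (ct v) * P v * U (v $ 2) (ct v))"
    by (rule form_fun_mult_eq[OF _ base(7)]) simp
  moreover have "form_fun 5 4 (\<lambda>v. R v * Y (v $ 2) (ct v))"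
    by (rule form_fun_mult_eq[OF R base(8)]) simp
  ultimately show K: "form_fun 5 4 K"
    unfolding K_def by (intro form_fun_scale form_fun_add)
  have "form_fun 5 3 (\<lambda>v. P v ^ 3)" by (rule form_fun_power_eq[OF P]) simp
  then have "form_fun 5 5 (\<lambda>v. P v ^ 3 * (v $ 2 * C (v $ 2) (ct v)))"
    by (rule form_fun_mult_eq[OF _ zC]) simp
  then show "form_fun 5 9 \<Phi>_factor"
    unfolding \<Phi>_factor_def by (rule form_fun_mult_eq[OF _ K]) simp
  assume "j < 4"
  then consider "j = 0" | "j = Suc 0" | "j = 2" | "j = 3" by linarith
  then show "form_fun 5 2 (\<lambda>v. \<Phi> v $ j)"
    by cases (simp_all add: \<Phi>_def R form_fun_mult_eq[OF P base(1)] form_fun_mult_eq[OF P base(2)]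
      form_fun_mult_eq[OF base(1) base(5)])
qed

lemma form_fun_\<Psi>:
  shows "form_fun 4 9 \<Psi>_factor" and "i < 5 \<Longrightarrow> form_fun 4 5 (\<lambda>w. \<Psi> w $ i)"
proof -
  have coord: "form_fun 4 1 (\<lambda>w. w $ 0)" "form_fun 4 1 (\<lambda>w. w $ Suc 0)" "form_fun 4 1 (\<lambda>w. w $ 2)"
    "form_fun 4 1 (\<lambda>w. w $ 3)"
    by (rule form_fun_coord; simp)+
  note base = coord form_fun_coefficients[OF coord(1,2)]
  have E: "form_fun 4 3 (\<lambda>w. E (w $ 0) (w $ Suc 0) (w $ 2) (w $ 3))"
    unfolding E_def
    by (intro form_fun_diff form_fun_add form_fun_mult_eq[where d = 2 and e = 1 and k = 3]
       form_fun_mult_eq[OF coord(1), where e = 2] form_fun_mult_eq[OF base(5), where e = 2]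
       form_fun_power_eq[where d = 1 and k = 2] base) simp_all
  have zC: "form_fun 4 2 (\<lambda>w. w $ 0 * C (w $ 0) (w $ Suc 0))"
    by (rule form_fun_mult_eq[OF base(1) base(5)]) simp
  have M: "form_fun 4 3 (\<lambda>w. M (w $ 0) (w $ Suc 0) (w $ 2))"
    unfolding M_def
    by (intro form_fun_scale form_fun_add form_fun_mult_eq[OF zC base(6)]
        form_fun_mult_eq[OF base(3) base(7)]) simp_all
  have zM: "form_fun 4 4 (\<lambda>w. w $ 0 * M (w $ 0) (w $ Suc 0) (w $ 2))"
    by (rule form_fun_mult_eq[OF base(1) M]) simp
  have C2: "form_fun 4 2 (\<lambda>w. C (w $ 0) (w $ Suc 0) ^ 2)"
    by (rule form_fun_power_eq[OF base(5)]) simp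
  have "form_fun 4 5 (\<lambda>w. E (w $ 0) (w $ Suc 0) (w $ 2) (w $ 3) * C (w $ 0) (w $ Suc 0) ^ 2)"
    by (rule form_fun_mult_eq[OF E C2]) simp
  then show "form_fun 4 9 \<Psi>_factor"
    unfolding \<Psi>_factor_def by (rule form_fun_mult_eq[OF _ zM]) simp
  have EU: "form_fun 4 4 (\<lambda>w. E (w $ 0) (w $ Suc 0) (w $ 2) (w $ 3) * U (w $ 0) (w $ Suc 0))"
    by (rule form_fun_mult_eq[OF E base(6)]) simp
  have p: "form_fun 4 5 (\<lambda>w. C (w $ 0) (w $ Suc 0)
      * (E (w $ 0) (w $ Suc 0) (w $ 2) (w $ 3) * U (w $ 0) (w $ Suc 0) + w $ 0 * M (w $ 0) (w $ Suc 0) (w $ 2)))"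
    by (rule form_fun_mult_eq[OF base(5) form_fun_add[OF EU zM]]) simp
  have "form_fun 4 2 (\<lambda>w. C (w $ 0) (w $ Suc 0) * w $ 3)"
    by (rule form_fun_mult_eq[OF base(5) base(4)]) simp
  then have q: "form_fun 4 5 (\<lambda>w. C (w $ 0) (w $ Suc 0) * w $ 3 * M (w $ 0) (w $ Suc 0) (w $ 2))"
    by (rule form_fun_mult_eq[OF _ M]) simp
  have EC: "form_fun 4 4 (\<lambda>w. E (w $ 0) (w $ Suc 0) (w $ 2) (w $ 3) * C (w $ 0) (w $ Suc 0))"
    by (rule form_fun_mult_eq[OF E base(5)]) simp
  have z: "form_fun 4 5 (\<lambda>w. E (w $ 0) (w $ Suc 0) (w $ 2) (w $ 3) * C (w $ 0) (w $ Suc 0) * w $ 0)"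
    and t: "form_fun 4 5 (\<lambda>w. E (w $ 0) (w $ Suc 0) (w $ 2) (w $ 3) * C (w $ 0) (w $ Suc 0) * w $ Suc 0)"
    by (rule form_fun_mult_eq[OF EC base(1)], simp, rule form_fun_mult_eq[OF EC base(2)], simp)
  have "form_fun 4 2 (\<lambda>w. w $ 2 * w $ 0)"
    by (rule form_fun_mult_eq[OF base(3) base(1)]) simp
  then have "form_fun 4 5 (\<lambda>w. w $ 2 * w $ 0 * M (w $ 0) (w $ Suc 0) (w $ 2))"
    by (rule form_fun_mult_eq[OF _ M]) simp
  moreover have "form_fun 4 5 (\<lambda>w. (Y (w $ 0) (w $ Suc 0) - H (w $ 0) (w $ Suc 0))
      * E (w $ 0) (w $ Suc 0) (w $ 2) (w $ 3))"
    by (rule form_fun_mult_eq[OF form_fun_diff[OF base(7,8)] E]) simp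
  ultimately have s: "form_fun 4 5 (\<lambda>w. w $ 2 * w $ 0 * M (w $ 0) (w $ Suc 0) (w $ 2)
      + (Y (w $ 0) (w $ Suc 0) - H (w $ 0) (w $ Suc 0)) * E (w $ 0) (w $ Suc 0) (w $ 2) (w $ 3))"
    by (rule form_fun_add)
  have divide: "form_fun 4 5 (\<lambda>w. g w / r)" if "form_fun 4 5 g" for g
    using form_fun_scale[OF that, of "1 / r"] by simp
  assume "i < 5"
  then consider "i = 0" | "i = Suc 0" | "i = 2" | "i = 3" | "i = 4" by linarith
  then show "form_fun 4 5 (\<lambda>w. \<Psi> w $ i)"
    unfolding \<Psi>_def \<Psi>_coords_def from_coords_def point_def
    by cases (simp_all add: divide form_fun_scale form_fun_add form_fun_diff p q z t s)
qed

subsection \<open>Density of the domain of the projection\<close>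

text \<open>
  Otherwise the norm form of the discriminant would vanish at \<open>(z, t) = (0, 1)\<close>, where its value
  is \<open>h\<^sub>2\<^sup>2 - a\<^sub>3 c\<^sub>1\<close>.
\<close>

lemma Y_nonzero: "y 2 \<noteq> 0"
proof
  assume "y 2 = 0"
  then have "h 2 ^ 2 - a 3 * c 1 = 0"
    using norm[of 0 1] by (simp add: binary_form_defs)
  then show False using disc by simp
qed

lemma \<Phi>_factor_coords:
  "\<Phi>_factor (from_coords p q z t s) = (p - U z t) ^ 3 * (z * C z t)
     * (- 2 * (z * C z t * (p - U z t) * U z t + (C z t * s + H z t - Y z t) * Y z t))"
  by (simp add: \<Phi>_factor_def P_def R_def K_def)

text \<open>
  On \<open>z = 1\<close> the factor is a polynomial in \<open>p\<close>, \<open>t\<close>, \<open>s\<close> alone, so these three can be chosen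
  freely; extraction of a square root for \<open>q\<close> then puts the point on the cubic.
\<close>

lemma exists_point_in_domain:
  obtains p q t s where "p \<noteq> 0" "p ^ 2 - q ^ 2 + Q 1 t s = 0"
    "\<And>q'. \<Phi>_factor (from_coords p q' 1 t s) \<noteq> 0"
proof -
  have "finite {x. poly [:0, y 0, y 1, y 2:] x = 0}"
    using Y_nonzero by (intro poly_roots_finite) simp
  then obtain x where "x \<notin> {x. poly [:0, y 0, y 1, y 2:] x = 0}"
    using ex_new_if_finite[OF infinite_UNIV_char_0] by blast
  moreover have "poly [:0, y 0, y 1, y 2:] x = x * binary_quadratic y 1 x"
    by (simp add: binary_quadratic_def power2_eq_square algebra_simps)
  ultimately have x: "x \<noteq> 0" "binary_quadratic y 1 x \<noteq> 0" by auto
  define t where "t = (x - c 0) / c 1"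
  have C: "C 1 t = x" using c1 by (simp add: t_def binary_linear_def)
  then have Y: "Y 1 t \<noteq> 0" using x(2) by (simp add: Y_def)
  have "finite {0, U 1 t}" by simp
  then obtain p where "p \<notin> {0, U 1 t}"
    using ex_new_if_finite[OF infinite_UNIV_char_0] by blast
  then have p: "p \<noteq> 0" "p \<noteq> U 1 t" by auto
  \<comment> \<open>\<open>s\<close> is chosen such that the last factor of \<open>\<Phi>_factor\<close> takes the value \<open>- 2\<close>.\<close>
  define s where "s = ((1 - x * (p - U 1 t) * U 1 t) / Y 1 t - H 1 t + Y 1 t) / x"
  have "x * s + H 1 t - Y 1 t = (1 - x * (p - U 1 t) * U 1 t) / Y 1 t"
    using x(1) by (simp add: s_def)
  then have "\<Phi>_factor (from_coords p q' 1 t s) = (p - U 1 t) ^ 3 * x * (- 2)" for q'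
    using Y by (simp add: \<Phi>_factor_coords C)
  then have "\<Phi>_factor (from_coords p q' 1 t s) \<noteq> 0" for q' using p x(1) by simp
  moreover obtain q where "q ^ 2 = p ^ 2 + Q 1 t s" using nth_root_exists[of 2] by auto
  ultimately show thesis using p(1) that[of p q t s] by simp
qed

text \<open>
  As \<open>p\<close> is nonzero, \<open>q\<close> and \<open>- q\<close> cannot both equal \<open>p\<close>.
\<close>

lemma exists_domain_point_off_diagonal:
  "\<exists>p q t s. p - q \<noteq> 0 \<and> (p + q) * (p - q) + Q 1 t s = 0
     \<and> (\<forall>q'. \<Phi>_factor (from_coords p q' 1 t s) \<noteq> 0)"
proof -
  obtain p q t s where pq: "p \<noteq> 0" "p ^ 2 - q ^ 2 + Q 1 t s = 0"
    and factor: "\<forall>q'. \<Phi>_factor (from_coords p q' 1 t s) \<noteq> 0"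
    by (rule exists_point_in_domain) blast
  define q\<^sub>1 where "q\<^sub>1 = (if p = q then - q else q)"
  have "p - q\<^sub>1 \<noteq> 0" using pq(1) by (auto simp: q\<^sub>1_def)
  moreover have "(p + q\<^sub>1) * (p - q\<^sub>1) = p ^ 2 - q ^ 2"
    by (simp add: q\<^sub>1_def power2_eq_square algebra_simps)
  ultimately show ?thesis using pq(2) factor by metis
qed

lemma exists_domain_point_chart_1:
  obtains x\<^sub>0 x\<^sub>1 t s where
    "x\<^sub>1 \<noteq> 0" "x\<^sub>0 * x\<^sub>1 * 1 + Q 1 t s = 0" "\<Phi>_factor (point x\<^sub>0 x\<^sub>1 1 t s) \<noteq> 0"
proof -
  obtain p q t s where *: "p - q \<noteq> 0" "(p + q) * (p - q) + Q 1 t s = 0"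
    "\<forall>q'. \<Phi>_factor (from_coords p q' 1 t s) \<noteq> 0"
    using exists_domain_point_off_diagonal by blast
  have "(p + q) / r * (r * (p - q)) = (p + q) * (p - q)" using r by simp
  then show thesis
    using * r that[of "r * (p - q)" "(p + q) / r" t s] unfolding from_coords_def by simp
qed

lemma exists_domain_point_chart_0:
  obtains x\<^sub>0 x\<^sub>1 t s where
    "x\<^sub>0 \<noteq> 0" "x\<^sub>0 * x\<^sub>1 * 1 + Q 1 t s = 0" "\<Phi>_factor (point x\<^sub>0 x\<^sub>1 1 t s) \<noteq> 0"
proof -
  obtain p q t s where *: "p - q \<noteq> 0" "(p + q) * (p - q) + Q 1 t s = 0"
    "\<forall>q'. \<Phi>_factor (from_coords p q' 1 t s) \<noteq> 0"
    using exists_domain_point_off_diagonal by blast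
  have "(p - q) / r * (r * (p + q)) = (p + q) * (p - q)" using r by simp
  moreover have "\<Phi>_factor (point ((p - q) / r) (r * (p + q)) 1 t s) \<noteq> 0"
    using *(3)[rule_format, of "- q"] by (simp add: from_coords_def)
  moreover have "(p - q) * (p + q) + Q 1 t s = 0" using *(2) by (simp only: mult.commute)
  ultimately show thesis
    using *(1) r that[of "(p - q) / r" "r * (p + q)" t s] by simp
qed

text \<open>
  Every point of the cubic is reached from the domain by a chain of curves: points with
  \<open>z \<noteq> 0\<close> and \<open>x\<^sub>1 \<noteq> 0\<close> or \<open>x\<^sub>0 \<noteq> 0\<close> inside a chart; the remaining points with \<open>z \<noteq> 0\<close> by moving \<open>x\<^sub>0\<close>;
  points with \<open>z = 0\<close> by a curve leaving this hyperplane, which needs a nonzero differential of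
  the cubic form and, after moving \<open>x\<^sub>1\<close> if necessary, a nonzero \<open>x\<^sub>1\<close>; and last the line
  \<open>z = t = s = 0\<close> through the two singular points.
\<close>

definition domain_closure where
  "domain_closure = subtopology (zariski 5) (hypersurface 5 (cubic f)) closure_of
     {p \<in> hypersurface 5 (cubic f). \<forall>v\<in>p. \<Phi>_factor v \<noteq> 0}"

definition in_closure where
  "in_closure x\<^sub>0 x\<^sub>1 z t s \<longleftrightarrow> point x\<^sub>0 x\<^sub>1 z t s \<noteq> 0\<^sub>v 5 \<and> proj_pt (point x\<^sub>0 x\<^sub>1 z t s) \<in> domain_closure"

lemma hypersurface_subset: "hypersurface 5 (cubic f) \<subseteq> proj_space 5"
  by (auto simp: hypersurface_def)

lemma point_in_hypersurface_iff:
  "point x\<^sub>0 x\<^sub>1 z t s \<noteq> 0\<^sub>v 5 \<Longrightarrow>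
   proj_pt (point x\<^sub>0 x\<^sub>1 z t s) \<in> hypersurface 5 (cubic f) \<longleftrightarrow> x\<^sub>0 * x\<^sub>1 * z + Q z t s = 0"
  by (subst in_hypersurface_iff[OF cubic_in_forms[OF form] point_carrier]) (simp_all add: eval_at_point)

lemma poly_fun_Q:
  "poly_fun Z \<Longrightarrow> poly_fun T \<Longrightarrow> poly_fun S \<Longrightarrow> poly_fun (\<lambda>x. Q (Z x) (T x) (S x))"
  unfolding Q_def binary_form_defs by (intro poly_fun_intros)

lemma poly_fun_point:
  assumes "poly_fun X\<^sub>0" "poly_fun X\<^sub>1" "poly_fun Z" "poly_fun T" "poly_fun S" "i < 5"
  shows "poly_fun (\<lambda>x. point (X\<^sub>0 x) (X\<^sub>1 x) (Z x) (T x) (S x) $ i)"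
proof -
  consider "i = 0" | "i = Suc 0" | "i = 2" | "i = 3" | "i = 4" using assms(6) by linarith
  then show ?thesis
    by cases (simp_all add: point_def assms(1-5) poly_fun_intros)
qed

lemma in_closure_by_curve:
  assumes poly: "poly_fun X\<^sub>0" "poly_fun X\<^sub>1" "poly_fun Z" "poly_fun T" "poly_fun S"
    and on_cubic: "\<And>x. X\<^sub>0 x * X\<^sub>1 x * Z x + Q (Z x) (T x) (S x) = 0"
    and start: "k \<noteq> 0" "X\<^sub>0 0 = k * x\<^sub>0" "X\<^sub>1 0 = k * x\<^sub>1" "Z 0 = k * z" "T 0 = k * t" "S 0 = k * s"
    and nz: "point x\<^sub>0 x\<^sub>1 z t s \<noteq> 0\<^sub>v 5"
    and g: "poly_fun g" "g e \<noteq> 0" "\<And>x. g x \<noteq> 0 \<Longrightarrow> in_closure (X\<^sub>0 x) (X\<^sub>1 x) (Z x) (T x) (S x)"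
  shows "in_closure x\<^sub>0 x\<^sub>1 z t s"
proof -
  define curve where "curve = (\<lambda>x. point (X\<^sub>0 x) (X\<^sub>1 x) (Z x) (T x) (S x))"
  have "curve 0 = k \<cdot>\<^sub>v point x\<^sub>0 x\<^sub>1 z t s" by (simp add: curve_def start point_smult)
  then have eq: "proj_pt (curve 0) = proj_pt (point x\<^sub>0 x\<^sub>1 z t s)" using start(1) by (simp add: proj_pt_smult)
  have "curve 0 \<noteq> 0\<^sub>v 5" using nz start unfolding curve_def point_eq_zero_iff by auto
  then have "proj_pt (curve 0) \<in> hypersurface 5 (cubic f)"
    using point_in_hypersurface_iff on_cubic unfolding curve_def by blast
  then have "proj_pt (curve 0) \<in> domain_closure"
    unfolding domain_closure_def
  proof (rule curve_in_closure[OF hypersurface_subset, where g = g])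
    show "poly_fun (\<lambda>x. curve x $ i)" if "i < 5" for i
      unfolding curve_def using poly_fun_point[OF poly that] .
    show "curve x \<in> carrier_vec 5" for x by (simp add: curve_def)
  qed (use g in \<open>auto simp: in_closure_def curve_def domain_closure_def\<close>)
  then show ?thesis using nz by (simp add: in_closure_def eq)
qed

lemma in_closure_if_in_domain:
  assumes "x\<^sub>0 * x\<^sub>1 * z + Q z t s = 0" "\<Phi>_factor (point x\<^sub>0 x\<^sub>1 z t s) \<noteq> 0"
  shows "in_closure x\<^sub>0 x\<^sub>1 z t s"
proof -
  let ?D = "{p \<in> hypersurface 5 (cubic f). \<forall>v\<in>p. \<Phi>_factor v \<noteq> 0}"
  have nz: "point x\<^sub>0 x\<^sub>1 z t s \<noteq> 0\<^sub>v 5"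
  proof
    assume "point x\<^sub>0 x\<^sub>1 z t s = 0\<^sub>v 5"
    then have "point x\<^sub>0 x\<^sub>1 z t s $ 2 = 0" by simp
    then show False using assms(2) by (simp add: \<Phi>_factor_def)
  qed
  have "proj_pt (point x\<^sub>0 x\<^sub>1 z t s) \<in> ?D"
    using assms form_fun_zero_proj_pt(2)[OF form_fun_\<Phi>(4) point_carrier]
    by (simp add: point_in_hypersurface_iff nz)
  moreover have "?D \<subseteq> domain_closure"
    unfolding domain_closure_def
    by (rule closure_of_subset) (use hypersurface_subset in \<open>auto simp: topspace_zariski\<close>)
  ultimately show ?thesis using nz by (auto simp: in_closure_def)
qed

text \<open>
  Where \<open>z\<close> and one of the coordinates \<open>x\<close>, \<open>x'\<close> is nonzero, the cubic is the graph of the other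
  one, and two points are joined by the curve over a straight line.
\<close>

lemma curve_in_chart:
  assumes "x * x' * z + Q z t s = 0" "x \<noteq> 0" "z \<noteq> 0"
    and "w * w' * z\<^sub>1 + Q z\<^sub>1 t\<^sub>1 s\<^sub>1 = 0" "w \<noteq> 0" "z\<^sub>1 \<noteq> 0"
  obtains X X' Z T S k k\<^sub>1 where
    "poly_fun X" "poly_fun X'" "poly_fun Z" "poly_fun T" "poly_fun S"
    "\<And>e. X e * X' e * Z e + Q (Z e) (T e) (S e) = 0"
    "k \<noteq> 0" "X 0 = k * x" "X' 0 = k * x'" "Z 0 = k * z" "T 0 = k * t" "S 0 = k * s"
    "k\<^sub>1 \<noteq> 0" "X 1 = k\<^sub>1 * w" "X' 1 = k\<^sub>1 * w'" "Z 1 = k\<^sub>1 * z\<^sub>1" "T 1 = k\<^sub>1 * t\<^sub>1" "S 1 = k\<^sub>1 * s\<^sub>1"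
proof -
  define l where "l = (\<lambda>p q e :: 'k. p + e * (q - p))"
  have l: "l p q 0 = p" "l p q 1 = q" for p q by (simp_all add: l_def)
  have poly: "poly_fun (l p q)" for p q unfolding l_def by (intro poly_fun_intros)
  define k where "k = (\<lambda>e. l x w e * l z z\<^sub>1 e)"
  define q where "q = (\<lambda>e. - Q (l z z\<^sub>1 e) (l t t\<^sub>1 e) (l s s\<^sub>1 e))"
  have polys: "poly_fun k" "poly_fun q"
    unfolding k_def q_def by (intro poly_fun_intros poly_fun_Q poly)+
  have ends: "q 0 = k 0 * x'" "q 1 = k 1 * w'"
    using assms(1,4) by (simp_all add: q_def k_def l algebra_simps add_eq_0_iff2)
  show thesis
  proof (rule that[of "\<lambda>e. k e * l x w e" q "\<lambda>e. k e * l z z\<^sub>1 e" "\<lambda>e. k e * l t t\<^sub>1 e"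
        "\<lambda>e. k e * l s s\<^sub>1 e" "k 0" "k 1"])
    show "k e * l x w e * q e * (k e * l z z\<^sub>1 e)
        + Q (k e * l z z\<^sub>1 e) (k e * l t t\<^sub>1 e) (k e * l s s\<^sub>1 e) = 0" for e
      unfolding Q_homogeneous by (simp add: q_def k_def power3_eq_cube algebra_simps)
  qed (use assms ends in \<open>simp_all add: l polys poly poly_fun_mult k_def\<close>)
qed

lemma in_closure_chart_1:
  assumes "x\<^sub>0 * x\<^sub>1 * z + Q z t s = 0" "x\<^sub>1 \<noteq> 0" "z \<noteq> 0"
  shows "in_closure x\<^sub>0 x\<^sub>1 z t s"
proof -
  obtain w\<^sub>0 w\<^sub>1 t\<^sub>1 s\<^sub>1 where w: "w\<^sub>1 \<noteq> 0" "w\<^sub>0 * w\<^sub>1 * 1 + Q 1 t\<^sub>1 s\<^sub>1 = 0" "\<Phi>_factor (point w\<^sub>0 w\<^sub>1 1 t\<^sub>1 s\<^sub>1) \<noteq> 0"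
    by (rule exists_domain_point_chart_1)
  have "x\<^sub>1 * x\<^sub>0 * z + Q z t s = 0" "w\<^sub>1 * w\<^sub>0 * 1 + Q 1 t\<^sub>1 s\<^sub>1 = 0"
    using assms(1) w(2) by (simp_all add: mult_ac)
  note chart = this
  show ?thesis
  proof (rule curve_in_chart[OF chart(1) assms(2,3) chart(2) w(1) one_neq_zero])
    fix X X' Z T S k k\<^sub>1
    assume poly: "poly_fun X" "poly_fun X'" "poly_fun Z" "poly_fun T" "poly_fun S"
    and on_cubic: "\<And>e. X e * X' e * Z e + Q (Z e) (T e) (S e) = 0"
    and start: "k \<noteq> 0" "X 0 = k * x\<^sub>1" "X' 0 = k * x\<^sub>0" "Z 0 = k * z" "T 0 = k * t" "S 0 = k * s"
    and finish: "k\<^sub>1 \<noteq> 0" "X 1 = k\<^sub>1 * w\<^sub>1" "X' 1 = k\<^sub>1 * w\<^sub>0" "Z 1 = k\<^sub>1 * 1" "T 1 = k\<^sub>1 * t\<^sub>1" "S 1 = k\<^sub>1 * s\<^sub>1"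
  have on_cubic': "X' e * X e * Z e + Q (Z e) (T e) (S e) = 0" for e
    using on_cubic[of e] by (simp add: mult_ac)
  show "in_closure x\<^sub>0 x\<^sub>1 z t s"
  proof (rule in_closure_by_curve[OF poly(2,1,3-5) on_cubic' start(1,3,2,4-6)])
    show "point x\<^sub>0 x\<^sub>1 z t s \<noteq> 0\<^sub>v 5" using assms by (simp add: point_eq_zero_iff)
    show "poly_fun (\<lambda>e. \<Phi>_factor (point (X' e) (X e) (Z e) (T e) (S e)))"
      by (intro poly_fun_form_fun[OF form_fun_\<Phi>(4)] poly_fun_point poly)
    have "point (X' 1) (X 1) (Z 1) (T 1) (S 1) = k\<^sub>1 \<cdot>\<^sub>v point w\<^sub>0 w\<^sub>1 1 t\<^sub>1 s\<^sub>1"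
      by (simp add: finish point_smult)
    then show "\<Phi>_factor (point (X' 1) (X 1) (Z 1) (T 1) (S 1)) \<noteq> 0"
      using form_fun_homogeneous[OF form_fun_\<Phi>(4)] w(3) finish(1) by simp
  qed (rule in_closure_if_in_domain[OF on_cubic'])
  qed
qed

lemma in_closure_chart_0:
  assumes "x\<^sub>0 * x\<^sub>1 * z + Q z t s = 0" "x\<^sub>0 \<noteq> 0" "z \<noteq> 0"
  shows "in_closure x\<^sub>0 x\<^sub>1 z t s"
proof -
  obtain w\<^sub>0 w\<^sub>1 t\<^sub>1 s\<^sub>1 where w: "w\<^sub>0 \<noteq> 0" "w\<^sub>0 * w\<^sub>1 * 1 + Q 1 t\<^sub>1 s\<^sub>1 = 0" "\<Phi>_factor (point w\<^sub>0 w\<^sub>1 1 t\<^sub>1 s\<^sub>1) \<noteq> 0"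
    by (rule exists_domain_point_chart_0)
  show ?thesis
  proof (rule curve_in_chart[OF assms w(2,1) one_neq_zero])
    fix X X' Z T S k k\<^sub>1
    assume poly: "poly_fun X" "poly_fun X'" "poly_fun Z" "poly_fun T" "poly_fun S"
    and on_cubic: "\<And>e. X e * X' e * Z e + Q (Z e) (T e) (S e) = 0"
    and start: "k \<noteq> 0" "X 0 = k * x\<^sub>0" "X' 0 = k * x\<^sub>1" "Z 0 = k * z" "T 0 = k * t" "S 0 = k * s"
    and finish: "k\<^sub>1 \<noteq> 0" "X 1 = k\<^sub>1 * w\<^sub>0" "X' 1 = k\<^sub>1 * w\<^sub>1" "Z 1 = k\<^sub>1 * 1" "T 1 = k\<^sub>1 * t\<^sub>1" "S 1 = k\<^sub>1 * s\<^sub>1"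
  show "in_closure x\<^sub>0 x\<^sub>1 z t s"
  proof (rule in_closure_by_curve[OF poly on_cubic start])
    show "point x\<^sub>0 x\<^sub>1 z t s \<noteq> 0\<^sub>v 5" using assms by (simp add: point_eq_zero_iff)
    show "poly_fun (\<lambda>e. \<Phi>_factor (point (X e) (X' e) (Z e) (T e) (S e)))"
      by (intro poly_fun_form_fun[OF form_fun_\<Phi>(4)] poly_fun_point poly)
    have "point (X 1) (X' 1) (Z 1) (T 1) (S 1) = k\<^sub>1 \<cdot>\<^sub>v point w\<^sub>0 w\<^sub>1 1 t\<^sub>1 s\<^sub>1"
      by (simp add: finish point_smult)
    then show "\<Phi>_factor (point (X 1) (X' 1) (Z 1) (T 1) (S 1)) \<noteq> 0"
      using form_fun_homogeneous[OF form_fun_\<Phi>(4)] w(3) finish(1) by simp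
  qed (rule in_closure_if_in_domain[OF on_cubic])
  qed
qed

lemma in_closure_affine:
  assumes "x\<^sub>0 * x\<^sub>1 * z + Q z t s = 0" "z \<noteq> 0"
  shows "in_closure x\<^sub>0 x\<^sub>1 z t s"
proof (cases "x\<^sub>1 = 0")
  case True
  show ?thesis
  proof (cases "x\<^sub>0 = 0")
    case [simp]: True
    have Q: "Q z t s = 0" using assms(1) by simp
    show ?thesis
    proof (rule in_closure_by_curve[of "\<lambda>e. e" "\<lambda>e. 0" "\<lambda>e. z" "\<lambda>e. t" "\<lambda>e. s" 1 _ _ _ _ _ "\<lambda>e. e" 1])
      show "in_closure e 0 z t s" if "e \<noteq> 0" for e using that Q assms(2) by (intro in_closure_chart_0) auto
    qed (use assms Q \<open>x\<^sub>1 = 0\<close> in \<open>auto simp: poly_fun_intros point_eq_zero_iff\<close>)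
  qed (use assms in_closure_chart_0 in blast)
qed (use assms in_closure_chart_1 in blast)

text \<open>
  As \<open>Q\<close> vanishes at \<open>(0, t, s)\<close>, its value along a line through this point is divisible by the
  parameter; the part of the quotient free of \<open>e\<close> is the differential of \<open>Q\<close> at \<open>(0, t, s)\<close> in the
  direction \<open>(1, \<tau>, \<sigma>)\<close>.
\<close>

lemma Q_expansion_at_infinity:
  assumes "Q 0 t s = 0"
  obtains g\<^sub>1 g\<^sub>2 where "\<And>e. Q e (t + e * \<tau>) (s + e * \<sigma>) = e * ((a 2 * t ^ 2 + 2 * h 1 * t * s + c 0 * s ^ 2)
     + \<tau> * (3 * a 3 * t ^ 2 + 4 * h 2 * t * s + c 1 * s ^ 2) + \<sigma> * (2 * h 2 * t ^ 2 + 2 * c 1 * t * s)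
     + e * g\<^sub>1 + e ^ 2 * g\<^sub>2)"
proof
  fix e
  have "Q e (t + e * \<tau>) (s + e * \<sigma>) = Q 0 t s + e * ((a 2 * t ^ 2 + 2 * h 1 * t * s + c 0 * s ^ 2)
     + \<tau> * (3 * a 3 * t ^ 2 + 4 * h 2 * t * s + c 1 * s ^ 2) + \<sigma> * (2 * h 2 * t ^ 2 + 2 * c 1 * t * s)
     + e * (a 1 * t + 2 * a 2 * t * \<tau> + 3 * a 3 * t * \<tau> ^ 2
        + 2 * (h 0 * s + h 1 * (t * \<sigma> + \<tau> * s) + h 2 * (2 * t * \<tau> * \<sigma> + \<tau> ^ 2 * s))
        + 2 * c 0 * s * \<sigma> + c 1 * (t * \<sigma> ^ 2 + 2 * \<tau> * s * \<sigma>))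
     + e ^ 2 * (a 0 + a 1 * \<tau> + a 2 * \<tau> ^ 2 + a 3 * \<tau> ^ 3 + 2 * (h 0 + h 1 * \<tau> + h 2 * \<tau> ^ 2) * \<sigma>
        + (c 0 + c 1 * \<tau>) * \<sigma> ^ 2))"
    by (simp add: Q_def binary_form_defs power2_eq_square power3_eq_cube algebra_simps)
  then show "Q e (t + e * \<tau>) (s + e * \<sigma>) = e * ((a 2 * t ^ 2 + 2 * h 1 * t * s + c 0 * s ^ 2)
     + \<tau> * (3 * a 3 * t ^ 2 + 4 * h 2 * t * s + c 1 * s ^ 2) + \<sigma> * (2 * h 2 * t ^ 2 + 2 * c 1 * t * s)
     + e * (a 1 * t + 2 * a 2 * t * \<tau> + 3 * a 3 * t * \<tau> ^ 2
        + 2 * (h 0 * s + h 1 * (t * \<sigma> + \<tau> * s) + h 2 * (2 * t * \<tau> * \<sigma> + \<tau> ^ 2 * s))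
        + 2 * c 0 * s * \<sigma> + c 1 * (t * \<sigma> ^ 2 + 2 * \<tau> * s * \<sigma>))
     + e ^ 2 * (a 0 + a 1 * \<tau> + a 2 * \<tau> ^ 2 + a 3 * \<tau> ^ 3 + 2 * (h 0 + h 1 * \<tau> + h 2 * \<tau> ^ 2) * \<sigma>
        + (c 0 + c 1 * \<tau>) * \<sigma> ^ 2))"
    using assms by simp
qed

text \<open>
  The partial derivatives of \<open>Q\<close> in \<open>t\<close> and \<open>s\<close> at \<open>(0, t, s)\<close> vanish together only at multiple
  roots at infinity, which the discriminant and \<open>c\<^sub>1 \<noteq> 0\<close> exclude.
\<close>

lemma differential_at_infinity_nonzero:
  assumes "(t, s) \<noteq> (0, 0)"
  shows "3 * a 3 * t ^ 2 + 4 * h 2 * t * s + c 1 * s ^ 2 \<noteq> 0 \<or> 2 * h 2 * t ^ 2 + 2 * c 1 * t * s \<noteq> 0"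
proof (rule ccontr)
  assume "\<not> ?thesis"
  then have *: "3 * a 3 * t ^ 2 + 4 * h 2 * t * s + c 1 * s ^ 2 = 0" "2 * h 2 * t ^ 2 + 2 * c 1 * t * s = 0"
    by auto
  show False
  proof (cases "t = 0")
    case True
    then show False using * c1 assms by simp
  next
    case False
    have "2 * t * (h 2 * t + c 1 * s) = 0" using *(2) by (simp add: power2_eq_square algebra_simps)
    then have s: "c 1 * s = - h 2 * t" using False by (simp add: add_eq_0_iff)
    have "c 1 * (3 * a 3 * t ^ 2 + 4 * h 2 * t * s + c 1 * s ^ 2)
        = 3 * (a 3 * c 1) * t ^ 2 + 4 * h 2 * t * (c 1 * s) + (c 1 * s) ^ 2"
      by (simp add: power2_eq_square algebra_simps)
    also have "\<dots> = 3 * t ^ 2 * (a 3 * c 1 - h 2 ^ 2)"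
      unfolding s by (simp add: power2_eq_square algebra_simps)
    finally show False using *(1) False disc by simp
  qed
qed

text \<open>
  The direction \<open>(1, \<tau>, \<sigma>)\<close> is chosen such that the equation, divided by \<open>z = e\<close>, is solved at
  \<open>e = 0\<close> by the given \<open>x\<^sub>0\<close>; for other \<open>e\<close> it then determines a polynomial \<open>x\<^sub>0(e)\<close>.
\<close>

lemma in_closure_at_infinity_smooth:
  assumes Q: "Q 0 t s = 0" and nz: "(t, s) \<noteq> (0, 0)" and x\<^sub>1: "x\<^sub>1 \<noteq> 0"
  shows "in_closure x\<^sub>0 x\<^sub>1 0 t s"
proof -
  define dz dt ds where "dz = a 2 * t ^ 2 + 2 * h 1 * t * s + c 0 * s ^ 2"
    and "dt = 3 * a 3 * t ^ 2 + 4 * h 2 * t * s + c 1 * s ^ 2" and "ds = 2 * h 2 * t ^ 2 + 2 * c 1 * t * s"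
  have "dt \<noteq> 0 \<or> ds \<noteq> 0"
    unfolding dt_def ds_def by (rule differential_at_infinity_nonzero[OF nz])
  then obtain \<tau> \<sigma> where tangent: "dz + \<tau> * dt + \<sigma> * ds = - (x\<^sub>0 * x\<^sub>1)"
  proof
    assume "dt \<noteq> 0"
    then show thesis using that[of "(- (x\<^sub>0 * x\<^sub>1) - dz) / dt" 0] by simp
  next
    assume "ds \<noteq> 0"
    then show thesis using that[of 0 "(- (x\<^sub>0 * x\<^sub>1) - dz) / ds"] by simp
  qed
  obtain g\<^sub>1 g\<^sub>2 where g: "\<And>e. Q e (t + e * \<tau>) (s + e * \<sigma>) = e * (dz + \<tau> * dt + \<sigma> * ds + e * g\<^sub>1 + e ^ 2 * g\<^sub>2)"
    unfolding dz_def dt_def ds_def using Q_expansion_at_infinity[OF Q] by blast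
  obtain h\<^sub>1 h\<^sub>2 where h: "g\<^sub>1 = h\<^sub>1 * x\<^sub>1" "g\<^sub>2 = h\<^sub>2 * x\<^sub>1"
    using x\<^sub>1 that[of "g\<^sub>1 / x\<^sub>1" "g\<^sub>2 / x\<^sub>1"] by simp
  let ?X = "\<lambda>e. x\<^sub>0 - e * h\<^sub>1 - e ^ 2 * h\<^sub>2"
  have on_cubic: "?X e * x\<^sub>1 * e + Q e (t + e * \<tau>) (s + e * \<sigma>) = 0" for e
    unfolding g tangent h by (simp add: algebra_simps)
  show ?thesis
  proof (rule in_closure_by_curve[of ?X "\<lambda>e. x\<^sub>1" "\<lambda>e. e" "\<lambda>e. t + e * \<tau>" "\<lambda>e. s + e * \<sigma>" 1 _ _ _ _ _ "\<lambda>e. e" 1])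
    show "in_closure (?X e) x\<^sub>1 e (t + e * \<tau>) (s + e * \<sigma>)" if "e \<noteq> 0" for e
      by (rule in_closure_affine[OF on_cubic that])
  qed (use on_cubic x\<^sub>1 in \<open>auto simp: point_eq_zero_iff intro!: poly_fun_intros\<close>)
qed

lemma in_closure_at_infinity:
  assumes Q: "Q 0 t s = 0" and nz: "(t, s) \<noteq> (0, 0)"
  shows "in_closure x\<^sub>0 x\<^sub>1 0 t s"
proof (cases "x\<^sub>1 = 0")
  case True
  show ?thesis
  proof (rule in_closure_by_curve[of "\<lambda>e. x\<^sub>0" "\<lambda>e. e" "\<lambda>e. 0" "\<lambda>e. t" "\<lambda>e. s" 1 _ _ _ _ _ "\<lambda>e. e" 1])
    show "in_closure x\<^sub>0 e 0 t s" if "e \<noteq> 0" for e by (rule in_closure_at_infinity_smooth[OF Q nz that])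
  qed (use assms True in \<open>auto simp: point_eq_zero_iff poly_fun_intros\<close>)
qed (rule in_closure_at_infinity_smooth[OF Q nz])

lemma in_closure_singular_line:
  assumes "(x\<^sub>0, x\<^sub>1) \<noteq> (0, 0)"
  shows "in_closure x\<^sub>0 x\<^sub>1 0 0 0"
proof -
  have Q: "Q 0 0 e = 0" for e by (simp add: Q_def binary_form_defs)
  show ?thesis
  proof (rule in_closure_by_curve[of "\<lambda>e. x\<^sub>0" "\<lambda>e. x\<^sub>1" "\<lambda>e. 0" "\<lambda>e. 0" "\<lambda>e. e" 1 _ _ _ _ _ "\<lambda>e. e" 1])
    show "in_closure x\<^sub>0 x\<^sub>1 0 0 e" if "e \<noteq> 0" for e using that by (intro in_closure_at_infinity[OF Q]) simp
  qed (use assms Q in \<open>auto simp: point_eq_zero_iff poly_fun_intros\<close>)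
qed

lemma domain_dense: "domain_closure = hypersurface 5 (cubic f)"
proof
  show "domain_closure \<subseteq> hypersurface 5 (cubic f)"
    unfolding domain_closure_def
    using closure_of_subset_topspace[of "subtopology (zariski 5) (hypersurface 5 (cubic f))"] by auto
  show "hypersurface 5 (cubic f) \<subseteq> domain_closure"
  proof
    fix p assume p: "p \<in> hypersurface 5 (cubic f)"
    then obtain v where v: "v \<in> carrier_vec 5" "v \<noteq> 0\<^sub>v 5" "p = proj_pt v"
      using hypersurface_subset by (blast elim: proj_spaceE)
    obtain x\<^sub>0 x\<^sub>1 z t s where v_eq: "v = point x\<^sub>0 x\<^sub>1 z t s" using point_of_vec[OF v(1)] by blast
    have on_cubic: "x\<^sub>0 * x\<^sub>1 * z + Q z t s = 0"
      using p v(2) point_in_hypersurface_iff unfolding v(3) v_eq by blast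
    have nz: "\<not> (x\<^sub>0 = 0 \<and> x\<^sub>1 = 0 \<and> z = 0 \<and> t = 0 \<and> s = 0)"
      using v(2) unfolding v_eq point_eq_zero_iff .
    have "in_closure x\<^sub>0 x\<^sub>1 z t s"
    proof (cases "z = 0")
      case False
      with on_cubic show ?thesis by (rule in_closure_affine)
    next
      case [simp]: True
      show ?thesis
        using in_closure_singular_line[of x\<^sub>0 x\<^sub>1] in_closure_at_infinity[of t s x\<^sub>0 x\<^sub>1] nz on_cubic
        by (cases "t = 0 \<and> s = 0") auto
    qed
    then show "p \<in> domain_closure" by (simp add: in_closure_def v(3) v_eq)
  qed
qed

end


section \<open>The action and its linearization\<close>

definition reflection :: "'k::field mat" where
  "reflection = mat 4 4 (\<lambda>(i, j). if i = j then if i = 3 then - 1 else 1 else 0)"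

lemma reflection_carrier [simp]: "reflection \<in> carrier_mat 4 4"
  by (simp add: reflection_def)

lemma reflection_mult_vec: "reflection *\<^sub>v quad w\<^sub>0 w\<^sub>1 w\<^sub>2 w\<^sub>3 = quad w\<^sub>0 w\<^sub>1 w\<^sub>2 (- w\<^sub>3)"
proof (rule vec4_eqI)
  let ?w = "quad w\<^sub>0 w\<^sub>1 w\<^sub>2 w\<^sub>3"
  show "reflection *\<^sub>v ?w \<in> carrier_vec 4"
    by (rule mult_mat_vec_carrier[OF reflection_carrier quad_carrier])
  have entry: "(reflection *\<^sub>v ?w) $ i = (if i = 3 then - (?w $ i) else ?w $ i)" if "i < 4" for i
  proof -
    have "(reflection *\<^sub>v ?w) $ i = (\<Sum>l\<in>{0..<4}. reflection $$ (i, l) * ?w $ l)"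
      using that by (simp add: reflection_def scalar_prod_def)
    also have "\<dots> = (\<Sum>l\<in>{0..<4}. if l = i then (if i = 3 then - (?w $ i) else ?w $ i) else 0)"
      using that by (intro sum.cong) (auto simp: reflection_def)
    finally show ?thesis using that by simp
  qed
  show "(reflection *\<^sub>v ?w) $ 0 = quad w\<^sub>0 w\<^sub>1 w\<^sub>2 (- w\<^sub>3) $ 0"
    "(reflection *\<^sub>v ?w) $ Suc 0 = quad w\<^sub>0 w\<^sub>1 w\<^sub>2 (- w\<^sub>3) $ Suc 0"
    "(reflection *\<^sub>v ?w) $ 2 = quad w\<^sub>0 w\<^sub>1 w\<^sub>2 (- w\<^sub>3) $ 2"
    "(reflection *\<^sub>v ?w) $ 3 = quad w\<^sub>0 w\<^sub>1 w\<^sub>2 (- w\<^sub>3) $ 3"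
    by (simp_all add: entry)
qed simp

lemma reflection_square: "reflection * reflection = 1\<^sub>m 4"
proof (rule eq_matI)
  fix i j assume ij: "i < dim_row (1\<^sub>m 4 :: 'a mat)" "j < dim_col (1\<^sub>m 4 :: 'a mat)"
  have "(reflection * reflection) $$ (i, j) = (\<Sum>l<4. reflection $$ (i, l) * (reflection $$ (l, j) :: 'a))"
    using ij by (simp add: reflection_def scalar_prod_def atLeast0LessThan)
  also have "\<dots> = (\<Sum>l<4. if l = i then (if i = j then 1 else 0) else 0)"
    using ij by (intro sum.cong) (auto simp: reflection_def)
  also have "\<dots> = 1\<^sub>m 4 $$ (i, j)" using ij by simp
  finally show "(reflection * reflection :: 'a mat) $$ (i, j) = 1\<^sub>m 4 $$ (i, j)" .
qed (simp_all add: reflection_def)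

lemma one_mat_in_GL: "1\<^sub>m m \<in> carrier (GL m)"
  by (auto simp: GL_def units_of_def Units_def ring_mat_simps intro!: bexI[of _ "1\<^sub>m m"])

lemma reflection_in_GL: "reflection \<in> carrier (GL 4)"
  by (auto simp: GL_def units_of_def Units_def ring_mat_simps reflection_square
      intro!: bexI[of _ reflection])

lemma GL_mult: "A \<otimes>\<^bsub>GL m\<^esub> B = A * B"
  by (simp add: GL_def units_of_def ring_mat_simps)

lemma mat_image_proj_pt:
  assumes "A \<in> carrier_mat n n" "w \<in> carrier_vec n"
  shows "(\<lambda>v. A *\<^sub>v v) ` proj_pt w = proj_pt (A *\<^sub>v w)"
  using assms by (auto simp: proj_pt_def mult_mat_vec image_iff) (metis mult_mat_vec)+

text \<open>
  The generator is an involution, so the group it generates has at most two elements.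
\<close>

lemma sigma_tau_group_elements:
  assumes f: "f \<in> forms {2, 3, 4} d" and a: "a \<noteq> 0" and S: "S = hypersurface 5 (cubic f)"
  shows "carrier (sigma_tau_group a S) \<subseteq> {\<one>\<^bsub>BijGroup S\<^esub>, sigma_tau a S}"
    and "sigma_tau a S \<otimes>\<^bsub>BijGroup S\<^esub> sigma_tau a S = \<one>\<^bsub>BijGroup S\<^esub>"
proof -
  interpret group "BijGroup S" by (rule group_BijGroup)
  have \<sigma>: "sigma_tau a S \<in> carrier (BijGroup S)" unfolding S by (rule sigma_tau_in_Bij[OF f a])
  then have bij: "sigma_tau a S \<in> Bij S" by (simp add: BijGroup_def)
  have maps: "sigma_tau a S p \<in> S" if "p \<in> S" for p
    using bij that by (auto simp: Bij_def bij_betw_def)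
  have "sigma_tau a S (sigma_tau a S p) = p" if "p \<in> S" for p
  proof -
    have "v \<in> carrier_vec 5" if "v \<in> p" for v
      using proj_space_rep(1)[of p 5 v] that \<open>p \<in> S\<close> by (auto simp: S hypersurface_def)
    then have "(sigma12 \<circ> tau a) ` (sigma12 \<circ> tau a) ` p = (\<lambda>v. v) ` p"
      unfolding image_image by (intro image_cong) (auto simp: sigma_tau_involution[OF a])
    then show ?thesis using that maps[OF that] by (simp add: sigma_tau_def)
  qed
  then show square: "sigma_tau a S \<otimes>\<^bsub>BijGroup S\<^esub> sigma_tau a S = \<one>\<^bsub>BijGroup S\<^esub>"
    using bij by (auto simp: BijGroup_def compose_def intro!: ext)
  have "subgroup {\<one>\<^bsub>BijGroup S\<^esub>, sigma_tau a S} (BijGroup S)"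
  proof (rule subgroupI)
    show "inv\<^bsub>BijGroup S\<^esub> g \<in> {\<one>\<^bsub>BijGroup S\<^esub>, sigma_tau a S}"
      if "g \<in> {\<one>\<^bsub>BijGroup S\<^esub>, sigma_tau a S}" for g
      using that inv_equality[OF square \<sigma> \<sigma>] by auto
  qed (use \<sigma> square in auto)
  then show "carrier (sigma_tau_group a S) \<subseteq> {\<one>\<^bsub>BijGroup S\<^esub>, sigma_tau a S}"
    unfolding sigma_tau_group_def by (rule subgroup_generated_minimal) simp
qed

context quadric_family
begin

lemma \<Phi>_sigma_tau:
  assumes "v \<in> carrier_vec 5"
  shows "\<Phi> (sigma12 (tau (r ^ 2) v)) = reflection *\<^sub>v \<Phi> v"
proof -
  let ?w = "sigma12 (tau (r ^ 2) v)"
  have "r * (inverse (r ^ 2) * v $ 1) = v $ 1 / r" "r ^ 2 * v $ 0 / r = r * v $ 0"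
    using r by (simp_all add: power2_eq_square field_simps)
  then have "cp ?w = cp v" "cq ?w = - cq v"
    unfolding cp_def cq_def by (simp_all add: sigma_tau_nth minus_divide_left)
  moreover have "ct ?w = ct v" "cs ?w = cs v" "?w $ 2 = v $ 2"
    by (simp_all add: ct_def cs_def sigma_tau_nth)
  ultimately show ?thesis
    by (simp add: \<Phi>_def P_def R_def reflection_mult_vec)
qed

text \<open>
  Two ways of computing \<open>\<Phi> (\<Psi> (\<Phi> v))\<close> show that \<open>\<Phi>\<close> maps the domain into the nonzero locus of
  the factor of \<open>\<Psi>\<close>.
\<close>

lemma exists_point_with_\<Psi>_factor_nonzero:
  obtains w where "w \<in> carrier_vec 4" "\<Psi>_factor w \<noteq> 0"
proof -
  obtain x\<^sub>0 x\<^sub>1 t s where x: "x\<^sub>0 * x\<^sub>1 * 1 + Q 1 t s = 0" "\<Phi>_factor (point x\<^sub>0 x\<^sub>1 1 t s) \<noteq> 0"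
    by (rule exists_domain_point_chart_1)
  let ?v = "point x\<^sub>0 x\<^sub>1 1 t s"
  have "\<Psi> (\<Phi> ?v) = \<Phi>_factor ?v \<cdot>\<^sub>v ?v" by (rule \<Psi>_\<Phi>) (simp_all add: eval_at_point x(1)[simplified])
  then have "\<Phi> (\<Psi> (\<Phi> ?v)) $ 0 = \<Phi> (\<Phi>_factor ?v \<cdot>\<^sub>v ?v) $ 0" by simp
  also have "\<dots> = \<Phi>_factor ?v ^ 2 * \<Phi> ?v $ 0"
    using form_fun_homogeneous[OF form_fun_\<Phi>(5)[of 0] point_carrier] by simp
  finally have "\<Psi>_factor (\<Phi> ?v) * \<Phi> ?v $ 0 = \<Phi>_factor ?v ^ 2 * \<Phi> ?v $ 0"
    by (simp add: \<Phi>_\<Psi> carrier_vecD[OF \<Phi>_carrier])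
  moreover have "\<Phi> ?v $ 0 \<noteq> 0" using x(2) by (auto simp: \<Phi>_def \<Phi>_factor_def)
  ultimately have "\<Psi>_factor (\<Phi> ?v) \<noteq> 0" using x(2) by auto
  then show thesis by (rule that[OF \<Phi>_carrier])
qed

text \<open>
  The representation is \<open>diag (1, 1, 1, -1)\<close>.  It is defined by distinguishing the identity from all
  other permutations, which gives a homomorphism on a group of order at most two.
\<close>

lemma linearizable_sigma_tau:
  "linearizable (sigma_tau_group (r ^ 2) (hypersurface 5 (cubic f))) 5 (hypersurface 5 (cubic f)) (\<lambda>g. g)"
proof -
  let ?S = "hypersurface 5 (cubic f)"
  let ?G = "sigma_tau_group (r ^ 2) ?S" and ?\<sigma> = "sigma_tau (r ^ 2) ?S"
  let ?one = "\<one>\<^bsub>BijGroup ?S\<^esub>"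
  have a: "r ^ 2 \<noteq> 0" using r by simp
  note elements = sigma_tau_group_elements[OF form a refl]
  interpret group "BijGroup ?S" by (rule group_BijGroup)
  define \<rho> :: "_ \<Rightarrow> 'k mat" where "\<rho> g = (if g = ?one then 1\<^sub>m 4 else reflection)" for g
  have \<sigma>: "?\<sigma> \<in> carrier (BijGroup ?S)" by (rule sigma_tau_in_Bij[OF form a])
  have hom: "\<rho> \<in> hom ?G (GL 4)"
  proof (rule homI)
    fix g g' assume "g \<in> carrier ?G" "g' \<in> carrier ?G"
    then have "g \<in> {?one, ?\<sigma>}" "g' \<in> {?one, ?\<sigma>}" using elements(1) by auto
    moreover have "g \<otimes>\<^bsub>?G\<^esub> g' = g \<otimes>\<^bsub>BijGroup ?S\<^esub> g'" by (simp add: sigma_tau_group_def)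
    ultimately show "\<rho> (g \<otimes>\<^bsub>?G\<^esub> g') = \<rho> g \<otimes>\<^bsub>GL 4\<^esub> \<rho> g'"
      using elements(2) \<sigma> by (auto simp: \<rho>_def GL_mult reflection_square left_mult_one_mat[OF reflection_carrier]
        right_mult_one_mat[OF reflection_carrier])
  qed (simp add: \<rho>_def one_mat_in_GL reflection_in_GL)
  obtain w where w: "w \<in> carrier_vec 4" "\<Psi>_factor w \<noteq> 0" by (rule exists_point_with_\<Psi>_factor_nonzero)
  have "equivariantly_birational ?G 5 ?S (\<lambda>g. g) 4 (proj_space 4) (\<lambda>g p. (\<lambda>v. \<rho> g *\<^sub>v v) ` p)"
  proof (rule equivariantly_birational_by_forms[OF cubic_in_forms[OF form] form_fun_\<Phi>(5) \<Phi>_carrier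
        form_fun_\<Psi>(2) \<Psi>_carrier form_fun_\<Phi>(4) form_fun_\<Psi>(1) _ _ _ \<Psi>_\<Phi> \<Psi>_on_cubic \<Phi>_\<Psi>
        domain_dense[unfolded domain_closure_def] w])
    fix g p v assume g: "g \<in> carrier ?G" and p: "p \<in> ?S" and v: "v \<in> p"
    have v5: "v \<in> carrier_vec 5" using proj_space_rep(1)[of p 5 v] p v by (auto simp: hypersurface_def)
    show "\<exists>v'\<in>g p. proj_pt (\<Phi> v') = (\<lambda>v. \<rho> g *\<^sub>v v) ` proj_pt (\<Phi> v)"
    proof (cases "g = ?one")
      case True
      then have "g p = p" using p by (simp add: BijGroup_def)
      moreover have "(\<lambda>v. \<rho> g *\<^sub>v v) ` proj_pt (\<Phi> v) = proj_pt (\<Phi> v)"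
        using True by (simp add: \<rho>_def mat_image_proj_pt[where n = 4])
      ultimately show ?thesis using v by auto
    next
      case False
      then have "g = ?\<sigma>" using g elements(1) by auto
      then have "sigma12 (tau (r ^ 2) v) \<in> g p" using p v by (simp add: sigma_tau_def)
      moreover have "(\<lambda>v. \<rho> g *\<^sub>v v) ` proj_pt (\<Phi> v) = proj_pt (\<Phi> (sigma12 (tau (r ^ 2) v)))"
        using False by (simp add: \<rho>_def mat_image_proj_pt[where n = 4] \<Phi>_sigma_tau[OF v5])
      ultimately show ?thesis by auto
    qed
  qed simp_all
  then show ?thesis unfolding linearizable_def using hom by blast
qed

end

theorem proposition5p19:
  fixes f3 :: "'k::{alg_closed_field, field_char_0} mpoly" and a :: 'k
  assumes "uncountable (UNIV :: 'k set)"
    and "f3 \<in> forms {2, 3, 4} 3"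
    and "has_2D4 (cubic f3)"
    and "a \<noteq> 0"
  shows "linearizable (sigma_tau_group a (hypersurface 5 (cubic f3)))
           5 (hypersurface 5 (cubic f3)) (\<lambda>g. g)"
proof -
  obtain r where square: "r ^ 2 = a" using nth_root_exists[of 2 a] by auto
  have "card (sing_locus 5 (cubic f3)) = 2" using assms(3) by (simp add: has_2D4_def)
  then show ?thesis
  proof (rule cubic_normal_form[OF assms(2)])
    fix \<alpha> \<beta> \<gamma> \<delta> :: 'k and b h c :: "nat \<Rightarrow> 'k"
    assume det: "\<beta> * \<gamma> - \<alpha> * \<delta> = 1" and c: "c 1 \<noteq> 0" and disc: "h 2 ^ 2 \<noteq> b 3 * c 1"
      and expand: "\<And>z t s. ternary_cubic (cubic_coeff f3) z (\<gamma> * t + \<alpha> * s) (\<delta> * t + \<beta> * s)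
         = binary_cubic b z t + 2 * binary_quadratic h z t * s + binary_linear c z t * s ^ 2"
    show ?thesis
    proof (rule discriminant_is_norm[of c h b, OF c])
      fix y u :: "nat \<Rightarrow> 'k"
      assume norm: "\<And>z t. binary_quadratic h z t ^ 2 - binary_cubic b z t * binary_linear c z t
          = binary_quadratic y z (binary_linear c z t) ^ 2
            + z * binary_linear c z t * binary_linear u z (binary_linear c z t) ^ 2"
      interpret quadric_family f3 r \<alpha> \<beta> \<gamma> \<delta> b h c y u
        using assms(2,4) square det c disc expand norm by unfold_locales auto
      show ?thesis by (rule linearizable_sigma_tau[unfolded square])
    qed
  qed
qed

end
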